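(* Let $n$ be a positive integer and let $\mathcal{N}\to\mathcal{B}_1$ be an $n$-fold covering over $\mathcal{B}_1$. If $n$ is odd then $\mathcal{N}$ is homeomorphic to $\mathcal{B}_1$. If $n$ is even then $\mathcal{N}$ is homeomorphic to $\mathcal{G}_1$ or $\mathcal{B}_1$ or $\mathcal{B}_2$. The corresponding numbers of non-equivalent $n$-fold coverings (with $\mathcal{N}$ homeomorphic to $\mathcal{G}_1$, $\mathcal{B}_1$, $\mathcal{B}_2$ respectively) are given by $$\text{(i)}\quad c_{\mathbb{Z}^3,\pi_1(\mathcal{B}_1)}(n)=\frac12\sum_{2l\mid n}\ \sum_{m\mid\frac n{2l}}\Big(l^2+\frac52+\frac32(-1)^l\Big)m,$$ $$\text{(ii)}\quad c_{\pi_1(\mathcal{B}_1),\pi_1(\mathcal{B}_1)}(n)=\sum_{l\mid n}\Big(\frac32+\frac12(-1)^l\Big)\sigma_1\!\left(\frac nl\right)-\sum_{2l\mid n}\Big(\frac32+\frac12(-1)^l\Big)\sigma_1\!\left(\frac n{2l}\right),$$ $$\text{(iii)}\quad c_{\pi_1(\mathcal{B}_2),\pi_1(\mathcal{B}_1)}(n)=2\Big(\sum_{2l\mid n}\sigma_1\!\left(\frac n{2l}\right)-\sum_{4l\mid n}\sigma_1\!\left(\frac n{4l}\right)\Big).$$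
   Context: $\mathcal{G}_1$ is the 3-torus, with $\pi_1(\mathcal{G}_1)=\mathbb{Z}^3$. $\mathcal{B}_1$ and $\mathcal{B}_2$ (first and second amphicosm) are the closed flat non-orientable 3-manifolds with fundamental groups $\pi_1(\mathcal{B}_1)=\langle a,b,c : cac^{-1}a^{-1}=cbc^{-1}b^{-1}=1,\ aba^{-1}b=1\rangle$ and $\pi_1(\mathcal{B}_2)=\langle \alpha,\beta,\gamma : \gamma\beta\gamma^{-1}=\alpha\gamma\alpha^{-1}\gamma^{-1}=\beta,\ \alpha\beta\alpha^{-1}=\beta^{-1}\rangle$; $\mathcal{B}_1$ is the product of the Klein bottle and a circle. Coverings are by connected manifolds; two coverings $\rho:\mathcal{N}\to\mathcal{M}$, $\rho':\mathcal{N}'\to\mathcal{M}$ are equivalent if there is a homeomorphism $\eta:\mathcal{N}\to\mathcal{N}'$ with $\rho=\rho'\circ\eta$. Equivalence classes of $n$-fold coverings of $\mathcal{M}$ correspond to conjugacy classes of index-$n$ subgroups of $\pi_1(\mathcal{M})$. $c_{H,G}(n)$ denotes the number of conjugacy classes (in $G$) of subgroups of index $n$ in $G$ that are isomorphic to $H$. $\sigma_1(m)$ is the sum of the positive divisors of the positive integer $m$. A sum $\sum_{jl\mid n}$ ($j$ a fixed integer) runs over all positive integers $l$ such that $jl$ divides $n$, and equals $0$ if there are none. *)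

theory Defs
  imports "HOL-Analysis.Analysis" "HOL-Algebra.Elementary_Groups"
begin

datatype 'g letter = Gen 'g | Inv 'g

fun letter_inv :: "'g letter \<Rightarrow> 'g letter" where
  "letter_inv (Gen g) = Inv g"
| "letter_inv (Inv g) = Gen g"

text \<open>A pair \<open>(l, r)\<close> in \<open>R\<close> stands for the relation \<open>l = r\<close>.\<close>

inductive pres_eq :: "('g letter list \<times> 'g letter list) set \<Rightarrow> 'g letter list \<Rightarrow> 'g letter list \<Rightarrow> bool"
  for R where
  refl: "pres_eq R w w"
| sym: "pres_eq R v w \<Longrightarrow> pres_eq R w v"
| trans: "pres_eq R u v \<Longrightarrow> pres_eq R v w \<Longrightarrow> pres_eq R u w"
| cancel: "pres_eq R (u @ [x, letter_inv x] @ v) (u @ v)"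
| relation: "(l, r) \<in> R \<Longrightarrow> pres_eq R (u @ l @ v) (u @ r @ v)"

definition pres_class :: "('g letter list \<times> 'g letter list) set \<Rightarrow> 'g letter list \<Rightarrow> 'g letter list set" where
  "pres_class R w = {v. pres_eq R w v}"

text \<open>The generating set is the whole type \<open>'g\<close>.\<close>

definition presented_group ::
    "('g letter list \<times> 'g letter list) set \<Rightarrow> 'g letter list set monoid" where
  "presented_group R =
     \<lparr>carrier = range (pres_class R),
      monoid.mult = (\<lambda>X Y. \<Union>u\<in>X. \<Union>v\<in>Y. pres_class R (u @ v)),
      one = pres_class R []\<rparr>"

lemma pres_class_eq_iff: "pres_class R u = pres_class R v \<longleftrightarrow> pres_eq R u v"
proof
  assume "pres_class R u = pres_class R v"
  moreover have "v \<in> pres_class R v" by (simp add: pres_class_def pres_eq.refl)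
  ultimately show "pres_eq R u v" by (simp add: pres_class_def set_eq_iff)
next
  assume "pres_eq R u v"
  then have "pres_eq R u w \<longleftrightarrow> pres_eq R v w" for w
    using pres_eq.sym pres_eq.trans by metis
  then show "pres_class R u = pres_class R v" by (simp add: pres_class_def)
qed

lemma pres_eq_append1: "pres_eq R u u' \<Longrightarrow> pres_eq R (u @ z) (u' @ z)"
proof (induction rule: pres_eq.induct)
  case (refl w)
  show ?case by (rule pres_eq.refl)
next
  case (sym v w)
  show ?case by (rule pres_eq.sym) (rule sym.IH)
next
  case (trans u v w)
  show ?case by (rule pres_eq.trans) (rule trans.IH)+
next
  case (cancel u x w)
  show ?case using pres_eq.cancel[of R u x "w @ z"] by simp
next
  case (relation l r u w)
  then show ?case using pres_eq.relation[of l r R u "w @ z"] by simp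
qed

lemma pres_eq_append2: "pres_eq R u u' \<Longrightarrow> pres_eq R (z @ u) (z @ u')"
proof (induction rule: pres_eq.induct)
  case (refl w)
  show ?case by (rule pres_eq.refl)
next
  case (sym v w)
  show ?case by (rule pres_eq.sym) (rule sym.IH)
next
  case (trans u v w)
  show ?case by (rule pres_eq.trans) (rule trans.IH)+
next
  case (cancel u x w)
  show ?case using pres_eq.cancel[of R "z @ u" x w] by simp
next
  case (relation l r u w)
  then show ?case using pres_eq.relation[of l r R "z @ u" w] by simp
qed

lemma presented_group_mult:
  "pres_class R u \<otimes>\<^bsub>presented_group R\<^esub> pres_class R v = pres_class R (u @ v)"
proof -
  have eq: "pres_class R (u' @ v') = pres_class R (u @ v)"
    if "u' \<in> pres_class R u" "v' \<in> pres_class R v" for u' v'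
  proof -
    have "pres_eq R (u' @ v') (u @ v')" "pres_eq R (u @ v') (u @ v)"
      using that by (simp_all add: pres_class_def pres_eq.sym pres_eq_append1 pres_eq_append2)
    then show ?thesis unfolding pres_class_eq_iff by (rule pres_eq.trans)
  qed
  moreover have "u \<in> pres_class R u" "v \<in> pres_class R v"
    by (simp_all add: pres_class_def pres_eq.refl)
  ultimately have "(\<Union>u'\<in>pres_class R u. \<Union>v'\<in>pres_class R v. pres_class R (u' @ v'))
      = pres_class R (u @ v)"
    by blast
  then show ?thesis by (simp add: presented_group_def)
qed

lemma pres_eq_inverse: "pres_eq R (rev (map letter_inv w) @ w) []"
proof (induction w)
  case Nil
  show ?case by (simp add: pres_eq.refl)
next
  case (Cons x w)
  have inv_inv: "letter_inv (letter_inv x) = x" by (cases x) auto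
  have "pres_eq R (rev (map letter_inv w) @ [letter_inv x, x] @ w) (rev (map letter_inv w) @ w)"
    using pres_eq.cancel[of R "rev (map letter_inv w)" "letter_inv x" w] by (simp add: inv_inv)
  then have "pres_eq R (rev (map letter_inv w) @ [letter_inv x, x] @ w) []"
    using Cons.IH by (rule pres_eq.trans)
  then show ?case by simp
qed

lemma group_presented_group: "group (presented_group R)"
proof (rule groupI)
  fix X assume "X \<in> carrier (presented_group R)"
  then obtain w where X: "X = pres_class R w" by (auto simp: presented_group_def)
  have one: "\<one>\<^bsub>presented_group R\<^esub> = pres_class R []" by (simp add: presented_group_def)
  show "\<one>\<^bsub>presented_group R\<^esub> \<otimes>\<^bsub>presented_group R\<^esub> X = X"
    by (simp add: X one presented_group_mult)
  have "pres_class R (rev (map letter_inv w)) \<otimes>\<^bsub>presented_group R\<^esub> X = \<one>\<^bsub>presented_group R\<^esub>"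
    unfolding X one presented_group_mult pres_class_eq_iff by (rule pres_eq_inverse)
  then show "\<exists>Y\<in>carrier (presented_group R). Y \<otimes>\<^bsub>presented_group R\<^esub> X = \<one>\<^bsub>presented_group R\<^esub>"
    by (auto simp: presented_group_def)
next
  fix X Y assume "X \<in> carrier (presented_group R)" "Y \<in> carrier (presented_group R)"
  then obtain u v where "X = pres_class R u" "Y = pres_class R v" by (auto simp: presented_group_def)
  then show "X \<otimes>\<^bsub>presented_group R\<^esub> Y \<in> carrier (presented_group R)"
    by (simp add: presented_group_mult) (simp add: presented_group_def)
next
  fix X Y Z assume "X \<in> carrier (presented_group R)" "Y \<in> carrier (presented_group R)"
    "Z \<in> carrier (presented_group R)"
  then obtain u v w where "X = pres_class R u" "Y = pres_class R v" "Z = pres_class R w"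
    by (auto simp: presented_group_def)
  then show "X \<otimes>\<^bsub>presented_group R\<^esub> Y \<otimes>\<^bsub>presented_group R\<^esub> Z =
      X \<otimes>\<^bsub>presented_group R\<^esub> (Y \<otimes>\<^bsub>presented_group R\<^esub> Z)"
    by (simp add: presented_group_mult)
qed (simp add: presented_group_def)


datatype gen = Ga | Gb | Gc

abbreviation (input) "ga \<equiv> Gen Ga"
abbreviation (input) "gb \<equiv> Gen Gb"
abbreviation (input) "gc \<equiv> Gen Gc"
abbreviation (input) "ga' \<equiv> Inv Ga"
abbreviation (input) "gb' \<equiv> Inv Gb"
abbreviation (input) "gc' \<equiv> Inv Gc"

definition pi1_G1 :: "(int \<times> int \<times> int) monoid" where
  "pi1_G1 = integer_group \<times>\<times> (integer_group \<times>\<times> integer_group)"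

definition pi1_B1 :: "gen letter list set monoid" where
  "pi1_B1 = presented_group
     {([gc, ga, gc', ga'], []),
      ([gc, gb, gc', gb'], []),
      ([ga, gb, ga', gb], [])}"

text \<open>Here \<open>Ga\<close>, \<open>Gb\<close>, \<open>Gc\<close> are the generators \<open>\<alpha>\<close>, \<open>\<beta>\<close>, \<open>\<gamma>\<close>.\<close>

definition pi1_B2 :: "gen letter list set monoid" where
  "pi1_B2 = presented_group
     {([gc, gb, gc'], [gb]),
      ([ga, gc, ga', gc'], [gb]),
      ([ga, gb, ga'], [gb'])}"


definition orbit_rel :: "('a \<Rightarrow> 'a) set \<Rightarrow> ('a \<times> 'a) set" where
  "orbit_rel F = {(x, y). equivclp (\<lambda>u v. \<exists>f\<in>F. v = f u) x y}"

text \<open>For bijections \<open>F\<close>, the classes of \<^term>\<open>orbit_rel F\<close> are the orbits of the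
  group generated by \<open>F\<close>. Points of the quotient space are the orbits themselves.\<close>

definition orbit_space :: "('a::topological_space \<Rightarrow> 'a) set \<Rightarrow> 'a set topology" where
  "orbit_space F = topology (\<lambda>U. U \<subseteq> UNIV // orbit_rel F \<and> open (\<Union>U))"

lemma equiv_orbit_rel: "equiv UNIV (orbit_rel F)"
proof (rule equivI)
  show "orbit_rel F \<subseteq> UNIV \<times> UNIV" by simp
  show "refl (orbit_rel F)" by (simp add: orbit_rel_def refl_on_def)
  show "sym (orbit_rel F)"
    unfolding orbit_rel_def by (rule symI) (simp, erule equivclp_sym)
  show "trans (orbit_rel F)"
    unfolding orbit_rel_def by (rule transI) (simp, erule (1) equivclp_trans)
qed

lemma openin_orbit_space:
  "openin (orbit_space F) U \<longleftrightarrow> U \<subseteq> UNIV // orbit_rel F \<and> open (\<Union>U)"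
proof -
  have "istopology (\<lambda>U. U \<subseteq> UNIV // orbit_rel F \<and> open (\<Union>U))"
    unfolding istopology_def
  proof (intro conjI allI impI)
    fix S T assume S: "S \<subseteq> UNIV // orbit_rel F \<and> open (\<Union>S)" and T: "T \<subseteq> UNIV // orbit_rel F \<and> open (\<Union>T)"
    show "S \<inter> T \<subseteq> UNIV // orbit_rel F" using S by blast
    have "X = Y" if "X \<in> S" "Y \<in> T" "x \<in> X" "x \<in> Y" for X Y x
      using quotient_disj[OF equiv_orbit_rel, of X F Y] S T that by blast
    then have "\<Union>(S \<inter> T) = \<Union>S \<inter> \<Union>T" by blast
    then show "open (\<Union>(S \<inter> T))" using S T by auto
  next
    fix K assume K: "\<forall>S\<in>K. S \<subseteq> UNIV // orbit_rel F \<and> open (\<Union>S)"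
    then show "\<Union>K \<subseteq> UNIV // orbit_rel F" by blast
    have "\<Union>(\<Union>K) = (\<Union>S\<in>K. \<Union>S)" by blast
    then show "open (\<Union>(\<Union>K))" using K by auto
  qed
  then show ?thesis unfolding orbit_space_def by (simp add: topology_inverse')
qed

lemma topspace_orbit_space: "topspace (orbit_space F) = UNIV // orbit_rel F"
proof -
  have "\<Union>(UNIV // orbit_rel F) = UNIV" by (rule Union_quotient[OF equiv_orbit_rel])
  then have "openin (orbit_space F) (UNIV // orbit_rel F)" by (simp add: openin_orbit_space)
  then show ?thesis
    by (metis openin_orbit_space openin_subset openin_topspace subset_antisym)
qed

lemma quotient_map_orbit_space:
  "quotient_map euclidean (orbit_space F) (\<lambda>x. orbit_rel F `` {x})"
  unfolding quotient_map_def
proof (intro conjI allI impI)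
  show "(\<lambda>x. orbit_rel F `` {x}) ` topspace euclidean = topspace (orbit_space F)"
    by (auto simp: topspace_orbit_space quotient_def)
  fix U assume U: "U \<subseteq> topspace (orbit_space F)"
  have "{x. orbit_rel F `` {x} \<in> U} = \<Union>U"
  proof (intro equalityI subsetI)
    fix x assume "x \<in> {x. orbit_rel F `` {x} \<in> U}"
    then show "x \<in> \<Union>U" using equiv_class_self[OF equiv_orbit_rel, of x F] by auto
  next
    fix x assume "x \<in> \<Union>U"
    then obtain y where "orbit_rel F `` {y} \<in> U" "x \<in> orbit_rel F `` {y}"
      using U by (auto simp: topspace_orbit_space quotient_def)
    then show "x \<in> {x. orbit_rel F `` {x} \<in> U}"
      using equiv_class_eq[OF equiv_orbit_rel, of y x F] by auto
  qed
  then show "openin euclidean {x \<in> topspace euclidean. orbit_rel F `` {x} \<in> U} =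
      openin (orbit_space F) U"
    using U by (simp add: openin_orbit_space topspace_orbit_space)
qed

type_synonym R3 = "real \<times> real \<times> real"

definition G1 :: "R3 set topology" where
  "G1 = orbit_space {\<lambda>(x, y, z). (x + 1, y, z), \<lambda>(x, y, z). (x, y + 1, z), \<lambda>(x, y, z). (x, y, z + 1)}"

text \<open>The three isometries are \<open>a\<close>, \<open>b\<close>, \<open>c\<close> of \<^const>\<open>pi1_B1\<close>, acting freely and properly
  discontinuously. The first two act on \<open>(x, y)\<close> only and have the Klein bottle as quotient of
  the plane.\<close>

definition B1 :: "R3 set topology" where
  "B1 = orbit_space {\<lambda>(x, y, z). (x + 1, - y, z), \<lambda>(x, y, z). (x, y + 1, z), \<lambda>(x, y, z). (x, y, z + 1)}"

text \<open>Likewise for \<open>\<alpha>\<close>, \<open>\<beta>\<close>, \<open>\<gamma>\<close> of \<^const>\<open>pi1_B2\<close>. The shift of \<open>\<gamma>\<close> by \<open>-1/2\<close> along \<open>\<beta>\<close>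
  produces the relation \<open>\<alpha>\<gamma>\<alpha>\<inverse>\<gamma>\<inverse> = \<beta>\<close>.\<close>

definition B2 :: "R3 set topology" where
  "B2 = orbit_space {\<lambda>(x, y, z). (x + 1, - y, z), \<lambda>(x, y, z). (x, y + 1, z), \<lambda>(x, y, z). (x, y - 1/2, z + 1)}"


text \<open>The counterpart of \<^const>\<open>covering_space\<close> for abstract topologies.\<close>

definition covering_map :: "'a topology \<Rightarrow> 'b topology \<Rightarrow> ('a \<Rightarrow> 'b) \<Rightarrow> bool" where
  "covering_map X Y p \<longleftrightarrow>
     continuous_map X Y p \<and> p ` topspace X = topspace Y \<and>
     (\<forall>y\<in>topspace Y. \<exists>V. openin Y V \<and> y \<in> V \<and>
        (\<exists>\<U>. \<Union>\<U> = {x \<in> topspace X. p x \<in> V} \<and>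
             (\<forall>U\<in>\<U>. openin X U) \<and> pairwise disjnt \<U> \<and>
             (\<forall>U\<in>\<U>. homeomorphic_map (subtopology X U) (subtopology Y V) p)))"

text \<open>If \<open>Y\<close> is a manifold and \<open>n > 0\<close>, then \<open>X\<close> below is automatically a manifold, so
  connectedness is all that has to be required of it.\<close>

definition fold_covering :: "nat \<Rightarrow> 'a topology \<Rightarrow> 'b topology \<Rightarrow> ('a \<Rightarrow> 'b) \<Rightarrow> bool" where
  "fold_covering n X Y p \<longleftrightarrow>
     covering_map X Y p \<and> connected_space X \<and>
     (\<forall>y\<in>topspace Y. finite {x \<in> topspace X. p x = y} \<and> card {x \<in> topspace X. p x = y} = n)"

definition covering_equiv ::
    "(('a topology \<times> ('a \<Rightarrow> 'b)) \<times> ('a topology \<times> ('a \<Rightarrow> 'b))) set" where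
  "covering_equiv =
     {((X, p), (X', p')). \<exists>\<eta>. homeomorphic_map X X' \<eta> \<and> (\<forall>x\<in>topspace X. p x = p' (\<eta> x))}"

text \<open>Equivalence classes of \<open>n\<close>-fold coverings of \<open>Y\<close> by spaces homeomorphic to \<open>Z\<close>, the points
  of the covering spaces being taken from the type \<open>'a\<close>. Every finite
  covering of a closed 3-manifold
  has the cardinality of the continuum, so any \<open>'a\<close> into which \<open>R3\<close> injects represents all of
  them up to equivalence, and the number of classes does not depend on \<open>'a\<close>.\<close>

definition covering_classes ::
    "nat \<Rightarrow> 'c topology \<Rightarrow> 'b topology \<Rightarrow> ('a topology \<times> ('a \<Rightarrow> 'b)) set set" where
  "covering_classes n Z Y =
     {(X, p). fold_covering n X Y p \<and> X homeomorphic_space Z} // covering_equiv"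


definition subgroup_conj :: "('a, 'm) monoid_scheme \<Rightarrow> ('a set \<times> 'a set) set" where
  "subgroup_conj G = {(K, K'). \<exists>g\<in>carrier G. K' = (g <#\<^bsub>G\<^esub> K) #>\<^bsub>G\<^esub> inv\<^bsub>G\<^esub> g}"

definition subgroup_classes ::
    "('b, 'k) monoid_scheme \<Rightarrow> ('a, 'm) monoid_scheme \<Rightarrow> nat \<Rightarrow> 'a set set set" where
  "subgroup_classes H G n =
     {K. subgroup K G \<and> finite (rcosets\<^bsub>G\<^esub> K) \<and> card (rcosets\<^bsub>G\<^esub> K) = n \<and>
         (G\<lparr>carrier := K\<rparr>) \<cong> H} // subgroup_conj G"

definition conj_count :: "('b, 'k) monoid_scheme \<Rightarrow> ('a, 'm) monoid_scheme \<Rightarrow> nat \<Rightarrow> nat" where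
  "conj_count H G n = card (subgroup_classes H G n)"

definition sigma1 :: "nat \<Rightarrow> nat" where
  "sigma1 m = (\<Sum>d | d dvd m. d)"

end

theory Submission
  imports Defs
begin

text \<open>
  Let \<open>D\<close> be the group of isometries of the space \<open>R3\<close> with quotient \<open>B1\<close>. A map from \<open>R3\<close> lifts
  through every covering, first on small boxes (Lebesgue number), then on larger and larger ones by
  gluing along faces. Lifting the quotient map \<open>R3 \<rightarrow> B1\<close> to the total space \<open>N\<close> of a
  covering identifies \<open>N\<close> with \<open>R3 / K\<close> for a subgroup \<open>K\<close> of \<open>D\<close>, unique up to conjugation; the
  fibres are the cosets of \<open>K\<close>. Lifting a homeomorphism of orbit spaces shows that it induces an
  isomorphism of the deck groups.

  Both amphicosm groups consist of triples \<open>(i, j, k)\<close>, standing for \<open>b\<^sup>j c\<^sup>k a\<^sup>i\<close>. A subgroup of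
  finite index in the group of \<open>B1\<close> projects to the \<open>(i, k)\<close>-plane onto a lattice with Hermite basis
  \<open>(p, r)\<close>, \<open>(0, q)\<close> and meets the \<open>j\<close>-axis in the multiples of some \<open>b\<close>, so it is given by these
  numbers and by the \<open>j\<close>-coordinates \<open>s\<close>, \<open>t\<close> modulo \<open>b\<close> of lifts of the two basis vectors. Its index
  is \<open>p q b\<close>. If \<open>p\<close> is even, it consists of translations and \<open>s\<close>, \<open>t\<close> are arbitrary;
  conjugation acts on them as \<open>\<plusminus> 1\<close>, which gives (i). If \<open>p\<close> is odd, then \<open>2 t \<equiv> 0\<close> modulo \<open>b\<close>, and the two
  solutions \<open>t = 0\<close> and \<open>t = b / 2\<close> give \<open>B1\<close> and \<open>B2\<close>; conjugation changes \<open>s\<close> by sign and by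
  even numbers, which gives (ii) and (iii).
\<close>

section \<open>Lifting maps from Euclidean 3-space through covering maps\<close>

text \<open>Deck groups of isometries stand in for fundamental groups. Homeomorphic orbit spaces
  have isomorphic deck groups by lifting; the converse, needed to sort coverings by the isomorphism
  type of their subgroups, is a rigidity statement. It comes out of the classification itself: an
  affine chart carries each subgroup of finite index to one of three standard groups, and these are
  pairwise non-isomorphic. So one normal form serves the topology, the algebra and the counting. In
  the formulas \<open>l\<close> is \<open>b\<close> (for (iii), half of \<open>b\<close>), the inner
  divisor is \<open>q\<close>, which is also the number of values of \<open>r\<close>, and
  \<open>p\<close> is determined by \<open>n\<close>. The term \<open>5/2 + 3/2 * (-1) ^ l\<close>
  is the number, 4 or 1, of pairs \<open>(s, t)\<close> fixed by the sign change, which Burnside's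
  lemma averages with the \<open>l^2\<close> pairs in all. The factor
  \<open>3/2 + 1/2 * (-1) ^ l\<close> is \<open>gcd 2 l\<close>, the number of classes of
  \<open>s\<close>. The subtracted sums discard even \<open>p\<close>.\<close>

lemma covering_map_evenly:
  assumes "covering_map N Y p" and "y \<in> topspace Y"
  shows "\<exists>V \<U>. openin Y V \<and> y \<in> V \<and> \<Union>\<U> = {x \<in> topspace N. p x \<in> V} \<and>
    (\<forall>U\<in>\<U>. openin N U) \<and> (\<forall>U\<in>\<U>. \<forall>U'\<in>\<U>. U \<inter> U' \<noteq> {} \<longrightarrow> U = U') \<and>
    (\<forall>U\<in>\<U>. homeomorphic_map (subtopology N U) (subtopology Y V) p)"
proof -
  obtain V \<U> where V: "openin Y V" "y \<in> V" "\<Union>\<U> = {x \<in> topspace N. p x \<in> V}"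
    "\<forall>U\<in>\<U>. openin N U" "pairwise disjnt \<U>"
    "\<forall>U\<in>\<U>. homeomorphic_map (subtopology N U) (subtopology Y V) p"
    using assms unfolding covering_map_def by blast
  have "\<forall>U\<in>\<U>. \<forall>U'\<in>\<U>. U \<inter> U' \<noteq> {} \<longrightarrow> U = U'"
    using V(5) by (auto simp: pairwise_def disjnt_def)
  then show ?thesis
    using V by (intro exI[of _ V] exI[of _ \<U>] conjI)
qed

text \<open>The agreement set is open and closed: near any point each map stays in one sheet over a
  common evenly covered set, and whether the two sheets coincide decides agreement on the whole
  neighbourhood.\<close>

lemma covering_map_lift_unique:
  assumes cov: "covering_map N Y p" and X: "connected_space X"
    and f: "continuous_map X N f" and g: "continuous_map X N g"
    and eq: "\<And>t. t \<in> topspace X \<Longrightarrow> p (f t) = p (g t)"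
    and s: "s \<in> topspace X" "f s = g s" and t: "t \<in> topspace X"
  shows "f t = g t"
proof -
  let ?E = "{t \<in> topspace X. f t = g t}"
  have fN: "f t \<in> topspace N" and gN: "g t \<in> topspace N" if "t \<in> topspace X" for t
    using f g that continuous_map_image_subset_topspace by blast+
  have pc: "continuous_map N Y p"
    using cov by (simp add: covering_map_def)
  have loc: "\<exists>W. openin X W \<and> t \<in> W \<and> (W \<subseteq> ?E \<or> W \<inter> ?E = {})" if t: "t \<in> topspace X" for t
  proof -
    have y: "p (f t) \<in> topspace Y"
      using fN[OF t] pc continuous_map_image_subset_topspace by blast
    obtain V \<U> where V: "openin Y V" "p (f t) \<in> V" "\<Union>\<U> = {x \<in> topspace N. p x \<in> V}"
      and op: "\<forall>U\<in>\<U>. openin N U" and disj: "\<forall>U\<in>\<U>. \<forall>U'\<in>\<U>. U \<inter> U' \<noteq> {} \<longrightarrow> U = U'"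
      and hom: "\<forall>U\<in>\<U>. homeomorphic_map (subtopology N U) (subtopology Y V) p"
      using covering_map_evenly[OF cov y] by (elim exE conjE)
    have "f t \<in> \<Union>\<U>" "g t \<in> \<Union>\<U>"
      using V(2) eq[OF t] fN[OF t] gN[OF t] by (simp_all add: V(3))
    then obtain U U' where U: "U \<in> \<U>" "f t \<in> U" and U': "U' \<in> \<U>" "g t \<in> U'"
      by blast
    define W where "W = {t \<in> topspace X. f t \<in> U} \<inter> {t \<in> topspace X. g t \<in> U'}"
    have W: "openin X W"
      unfolding W_def using f g bspec[OF op U(1)] bspec[OF op U'(1)]
      by (intro openin_Int openin_continuous_map_preimage)
    have tW: "t \<in> W"
      using t U U' by (simp add: W_def)
    have "W \<subseteq> ?E" if "U = U'"
    proof -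
      have "inj_on p (topspace (subtopology N U))"
        using bspec[OF hom U(1)] by (simp add: homeomorphic_map_def)
      then have "inj_on p U"
        using openin_subset[OF bspec[OF op U(1)]] by (simp add: inf.absorb2)
      then show ?thesis
        using that eq by (auto simp: W_def inj_on_def)
    qed
    moreover have "W \<inter> ?E = {}" if "U \<noteq> U'"
      using that bspec[OF bspec[OF disj U(1)] U'(1)] by (auto simp: W_def)
    ultimately show ?thesis
      using W tW by blast
  qed
  have "openin X ?E"
    by (subst openin_subopen) (use loc in blast)
  moreover have "openin X (topspace X - ?E)"
  proof (subst openin_subopen, intro ballI)
    fix t assume "t \<in> topspace X - ?E"
    then obtain W where "openin X W" "t \<in> W" "W \<inter> ?E = {}"
      using loc[of t] by blast
    then show "\<exists>T. openin X T \<and> t \<in> T \<and> T \<subseteq> topspace X - ?E"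
      using openin_subset by blast
  qed
  ultimately have "openin X ?E \<and> closedin X ?E"
    by (auto simp: closedin_def)
  then have "?E = {} \<or> ?E = topspace X"
    using X unfolding connected_space_clopen_in by blast
  then show ?thesis
    using s t by blast
qed

text \<open>One \<open>V\<close> serves all points of the fibre. The last clause says that the
  sections are open maps; it is what later makes a lift of the orbit map open.\<close>

lemma covering_map_local_section:
  assumes cov: "covering_map N Y p" and y: "y \<in> topspace Y"
  obtains V where "openin Y V" "y \<in> V"
    "\<And>x. x \<in> topspace N \<Longrightarrow> p x \<in> V \<Longrightarrow>
      \<exists>s. continuous_map (subtopology Y V) N s \<and> (\<forall>z\<in>V. p (s z) = z) \<and> s (p x) = x
        \<and> (\<forall>W\<subseteq>V. openin Y W \<longrightarrow> openin N (s ` W))"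
proof -
  obtain V \<U> where V: "openin Y V" "y \<in> V" "\<Union>\<U> = {x \<in> topspace N. p x \<in> V}"
      and op: "\<forall>U\<in>\<U>. openin N U"
      and hom: "\<forall>U\<in>\<U>. homeomorphic_map (subtopology N U) (subtopology Y V) p"
    using covering_map_evenly[OF assms] by (elim exE conjE)
  have *: "\<exists>s. continuous_map (subtopology Y V) N s \<and> (\<forall>z\<in>V. p (s z) = z) \<and> s (p x) = x
        \<and> (\<forall>W\<subseteq>V. openin Y W \<longrightarrow> openin N (s ` W))"
    if x: "x \<in> topspace N" "p x \<in> V" for x
  proof -
    obtain U where U: "U \<in> \<U>" "x \<in> U"
      using V(3) x by blast
    obtain s where s: "homeomorphic_maps (subtopology N U) (subtopology Y V) p s"
      using bspec[OF hom U(1)] by (auto simp: homeomorphic_map_maps)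
    have tops: "topspace (subtopology N U) = U" "topspace (subtopology Y V) = V"
      using openin_subset[OF bspec[OF op U(1)]] openin_subset[OF V(1)] by auto
    have "continuous_map (subtopology Y V) N s"
      using s by (auto simp: homeomorphic_maps_def intro: continuous_map_into_fulltopology)
    moreover have "\<forall>z\<in>V. p (s z) = z" "\<forall>x\<in>U. s (p x) = x"
      using s by (auto simp: homeomorphic_maps_def tops simp del: topspace_subtopology)
    moreover have "openin N (s ` W)" if "W \<subseteq> V" "openin Y W" for W
    proof -
      have "open_map (subtopology Y V) (subtopology N U) s"
        using s homeomorphic_maps_sym homeomorphic_imp_open_map homeomorphic_map_maps by blast
      moreover have "openin (subtopology Y V) W"
        using that by (metis inf.absorb1 openin_subtopology_Int)
      ultimately have "openin (subtopology N U) (s ` W)"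
        by (simp add: open_map_def)
      then show ?thesis
        using bspec[OF op U(1)] openin_trans_full by blast
    qed
    ultimately show ?thesis
      using U(2) by blast
  qed
  show thesis
    using V(1,2) * by (rule that)
qed

text \<open>Every starting point and every point of the fibre above it are allowed, so that in
  gluing two pieces the lift over the second can start wherever the first one arrived.\<close>

definition liftable :: "'b topology \<Rightarrow> ('b \<Rightarrow> 'c) \<Rightarrow> ('v::topological_space \<Rightarrow> 'c) \<Rightarrow> 'v set \<Rightarrow> bool" where
  "liftable N p q S \<longleftrightarrow> (\<forall>s\<in>S. \<forall>x\<in>topspace N. p x = q s \<longrightarrow>
     (\<exists>f. continuous_map (top_of_set S) N f \<and> (\<forall>t\<in>S. p (f t) = q t) \<and> f s = x))"

text \<open>The two lifts agree at one point of the overlap, hence on all of it because it is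
  connected; closedness of both pieces lets them be pasted.\<close>

lemma liftable_Un:
  assumes cov: "covering_map N Y p" and S: "closed S" "liftable N p q S"
    and T: "closed T" "liftable N p q T" and ST: "connected (S \<inter> T)" "S \<inter> T \<noteq> {}"
  shows "liftable N p q (S \<union> T)"
proof -
  \<comment> \<open>Only starting points in the first set are treated; exchanging the two sets
    covers the rest.\<close>
  have half: "\<exists>f. continuous_map (top_of_set (S \<union> T)) N f \<and> (\<forall>t\<in>S \<union> T. p (f t) = q t) \<and> f s = x"
    if S: "closed S" "liftable N p q S" and T: "closed T" "liftable N p q T"
      and ST: "connected (S \<inter> T)" "S \<inter> T \<noteq> {}"
      and s: "s \<in> S" and x: "x \<in> topspace N" "p x = q s" for S T s x
  proof -
    obtain f where f: "continuous_map (top_of_set S) N f" "\<forall>t\<in>S. p (f t) = q t" "f s = x"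
      using S(2) s x unfolding liftable_def by blast
    obtain u where u: "u \<in> S" "u \<in> T"
      using ST by blast
    have "f u \<in> topspace N"
      using continuous_map_image_subset_topspace[OF f(1)] u by auto
    then obtain g where g: "continuous_map (top_of_set T) N g" "\<forall>t\<in>T. p (g t) = q t" "g u = f u"
      using T(2) u f(2) unfolding liftable_def by metis
    have fg: "f t = g t" if "t \<in> S \<inter> T" for t
    proof (rule covering_map_lift_unique[OF cov, of "top_of_set (S \<inter> T)" f g u])
      show "connected_space (top_of_set (S \<inter> T))"
        using ST(1) by (simp add: connected_space_subtopology connectedin_absolute)
      show "continuous_map (top_of_set (S \<inter> T)) N f" "continuous_map (top_of_set (S \<inter> T)) N g"
        using f(1) g(1) continuous_map_from_subtopology_mono by blast+
    qed (use f g u that in auto)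
    define h where "h t = (if t \<in> S then f t else g t)" for t
    have "continuous_map (top_of_set (S \<union> T)) N h"
    proof (rule pasting_lemma_closed[of "{True, False}" _ "\<lambda>i. if i then S else T"
          N "\<lambda>i. if i then f else g"])
      fix i :: bool
      show "closedin (top_of_set (S \<union> T)) (if i then S else T)"
        using S(1) T(1) by (auto intro: closed_subset)
      have "S \<inter> (S \<union> T) = S" "T \<inter> (S \<union> T) = T" by auto
      then show "continuous_map (subtopology (top_of_set (S \<union> T)) (if i then S else T)) N
          (if i then f else g)"
        using f(1) g(1) by (simp add: subtopology_subtopology Int_commute)
    qed (use fg in \<open>auto simp: h_def split: if_splits\<close>)
    moreover have "\<forall>t\<in>S \<union> T. p (h t) = q t"
      using f(2) g(2) by (auto simp: h_def)
    ultimately show ?thesis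
      using s f(3) by (intro exI[of _ h]) (auto simp: h_def)
  qed
  show ?thesis
    unfolding liftable_def
    using half[OF S T ST] half[OF T S] ST by (metis Int_commute Un_commute Un_iff)
qed

lemma liftable_subset_section:
  assumes S: "continuous_map (top_of_set S) Y q" "q ` S \<subseteq> V"
    and V: "\<And>x. x \<in> topspace N \<Longrightarrow> p x \<in> V \<Longrightarrow>
      \<exists>s. continuous_map (subtopology Y V) N s \<and> (\<forall>z\<in>V. p (s z) = z) \<and> s (p x) = x"
  shows "liftable N p q S"
  unfolding liftable_def
proof (intro ballI impI)
  fix s x assume s: "s \<in> S" and x: "x \<in> topspace N" "p x = q s"
  then obtain \<sigma> where \<sigma>: "continuous_map (subtopology Y V) N \<sigma>" "\<forall>z\<in>V. p (\<sigma> z) = z" "\<sigma> (p x) = x"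
    using V[of x] S(2) by auto
  have "continuous_map (top_of_set S) N (\<sigma> \<circ> q)"
    using S \<sigma>(1) by (intro continuous_map_compose) (auto simp: continuous_map_in_subtopology)
  then show "\<exists>f. continuous_map (top_of_set S) N f \<and> (\<forall>t\<in>S. p (f t) = q t) \<and> f s = x"
    using \<sigma> S(2) x s by (intro exI[of _ "\<sigma> \<circ> q"]) auto
qed

lemma diameter_box_le:
  fixes a b :: real
  assumes "a \<le> b" "c \<le> d" "e \<le> f" "b - a \<le> h" "d - c \<le> h" "f - e \<le> h"
  shows "diameter ({a..b} \<times> {c..d} \<times> {e..f}) \<le> 3 * h"
proof (rule diameter_le)
  fix u v assume "u \<in> {a..b} \<times> {c..d} \<times> {e..f}" "v \<in> {a..b} \<times> {c..d} \<times> {e..f}"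
  then obtain x y z x' y' z' where uv: "u = (x, y, z)" "v = (x', y', z')"
    and "\<bar>x - x'\<bar> \<le> h" "\<bar>y - y'\<bar> \<le> h" "\<bar>z - z'\<bar> \<le> h"
    using assms(4-6) by (cases u, cases v) (auto simp: abs_le_iff)
  moreover have "norm (u - v) \<le> \<bar>x - x'\<bar> + (\<bar>y - y'\<bar> + \<bar>z - z'\<bar>)"
    unfolding uv using norm_Pair_le[of "x - x'" "(y - y', z - z')"] norm_Pair_le[of "y - y'" "z - z'"]
    by simp
  ultimately show "norm (u - v) \<le> 3 * h" by linarith
qed (use assms in auto)

text \<open>\<open>F x y\<close> is meant as a box with one side running from \<open>x\<close> to
  \<open>y\<close>, and \<open>F y y\<close> as the face shared by adjacent boxes; convexity makes
  this overlap connected. The bounds \<open>l\<close> and \<open>u\<close> are there because small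
  boxes are liftable only inside the compact cube that has the Lebesgue number.\<close>

lemma liftable_interval_glue:
  fixes F :: "real \<Rightarrow> real \<Rightarrow> 'v::real_normed_vector set"
  assumes cov: "covering_map N Y p" and h: "h > 0"
    and F: "\<And>x y. x \<le> y \<Longrightarrow> closed (F x y)" "\<And>x. convex (F x x) \<and> F x x \<noteq> {}"
      "\<And>x y z. x \<le> y \<Longrightarrow> y \<le> z \<Longrightarrow> F x y \<union> F y z = F x z \<and> F x y \<inter> F y z = F y y"
    and small: "\<And>x y. l \<le> x \<Longrightarrow> x \<le> y \<Longrightarrow> y \<le> u \<Longrightarrow> y - x \<le> h \<Longrightarrow> liftable N p q (F x y)"
    and ab: "l \<le> a" "a \<le> b" "b \<le> u"
  shows "liftable N p q (F a b)"
proof -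
  have "l \<le> a \<and> a \<le> b \<and> b \<le> u \<longrightarrow> liftable N p q (F a b)"
  \<comment> \<open>Bisection principle: a property that passes to the union of adjacent intervals
    and holds on all short intervals around each point holds on the whole interval.\<close>
  proof (rule Bolzano[where P = "\<lambda>a b. l \<le> a \<and> a \<le> b \<and> b \<le> u \<longrightarrow> liftable N p q (F a b)", OF ab(2)])
    fix x y z :: real
    assume xy: "l \<le> x \<and> x \<le> y \<and> y \<le> u \<longrightarrow> liftable N p q (F x y)"
      "l \<le> y \<and> y \<le> z \<and> z \<le> u \<longrightarrow> liftable N p q (F y z)" "x \<le> y" "y \<le> z"
    show "l \<le> x \<and> x \<le> z \<and> z \<le> u \<longrightarrow> liftable N p q (F x z)"
      using liftable_Un[OF cov F(1)[OF xy(3)] _ F(1)[OF xy(4)], of q] xy F(2)[of y] F(3)[OF xy(3,4)]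
        convex_connected[of "F y y"] by auto
  next
    show "\<exists>\<delta>>0. \<forall>x y. x \<le> t \<and> t \<le> y \<and> y - x < \<delta> \<longrightarrow> l \<le> x \<and> x \<le> y \<and> y \<le> u \<longrightarrow> liftable N p q (F x y)" for t
      using h small by (intro exI[of _ h]) auto
  qed
  then show ?thesis using ab by blast
qed

lemma liftable_cube:
  fixes q :: "R3 \<Rightarrow> 'c"
  assumes cov: "covering_map N Y p" and q: "continuous_map euclidean Y q"
  shows "liftable N p q ({-m..m} \<times> {-m..m} \<times> {-m..m})"
proof (cases "0 \<le> m")
  case False
  then show ?thesis by (simp add: liftable_def)
next
  case True
  let ?C = "{-m..m} \<times> {-m..m} \<times> {-m..m}"
  define \<C> where "\<C> = {q -` V | V. openin Y V \<and> (\<forall>x. x \<in> topspace N \<longrightarrow> p x \<in> V \<longrightarrow>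
      (\<exists>s. continuous_map (subtopology Y V) N s \<and> (\<forall>z\<in>V. p (s z) = z) \<and> s (p x) = x))}"
  have "\<exists>B\<in>\<C>. v \<in> B" for v
  proof -
    have "q v \<in> topspace Y"
      using continuous_map_image_subset_topspace[OF q] by auto
    then show ?thesis
      unfolding \<C>_def using covering_map_local_section[OF cov, of "q v"]
      by (smt (verit) mem_Collect_eq vimageI)
  qed
  then have cover: "?C \<subseteq> \<Union>\<C>" "\<C> \<noteq> {}" by auto
  have "open B" if "B \<in> \<C>" for B
    using that openin_continuous_map_preimage[OF q] by (auto simp: \<C>_def vimage_def)
  moreover have "compact ?C"
    by (intro compact_Times compact_Icc)
  ultimately obtain \<delta> where \<delta>: "0 < \<delta>" "\<And>T. T \<subseteq> ?C \<Longrightarrow> diameter T < \<delta> \<Longrightarrow> \<exists>B\<in>\<C>. T \<subseteq> B"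
    using Lebesgue_number_lemma[OF _ cover(2,1)] by metis
  \<comment> \<open>A box with sides at most \<open>h\<close> has diameter at most
    \<open>3 * h\<close>, which has to stay strictly below the Lebesgue number.\<close>
  define h where "h = \<delta> / 4"
  have h: "h > 0" "3 * h < \<delta>"
    using \<delta>(1) by (auto simp: h_def)
  have small: "liftable N p q ({a..b} \<times> {c..d} \<times> {e..f})"
    if "a \<le> b" "c \<le> d" "e \<le> f" "b - a \<le> h" "d - c \<le> h" "f - e \<le> h"
      "-m \<le> a" "b \<le> m" "-m \<le> c" "d \<le> m" "-m \<le> e" "f \<le> m" for a b c d e f
  proof -
    have "diameter ({a..b} \<times> {c..d} \<times> {e..f}) < \<delta>"
      using diameter_box_le[OF that(1-6)] h(2) by linarith
    moreover have "{a..b} \<times> {c..d} \<times> {e..f} \<subseteq> ?C"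
      using that by auto
    ultimately obtain V where "{a..b} \<times> {c..d} \<times> {e..f} \<subseteq> q -` V"
       "(\<forall>x. x \<in> topspace N \<longrightarrow> p x \<in> V \<longrightarrow>
      (\<exists>s. continuous_map (subtopology Y V) N s \<and> (\<forall>z\<in>V. p (s z) = z) \<and> s (p x) = x))"
      using \<delta>(2) unfolding \<C>_def by (smt (verit) mem_Collect_eq)
    then show ?thesis
      by (intro liftable_subset_section[of _ Y q V])
        (use q in \<open>auto intro: continuous_map_from_subtopology\<close>)
  qed
  \<comment> \<open>The sides are released from the bound \<open>h\<close> one at a time, here the
    first.\<close>
  have long1: "liftable N p q ({a..b} \<times> {c..d} \<times> {e..f})"
    if "a \<le> b" "c \<le> d" "e \<le> f" "d - c \<le> h" "f - e \<le> h"
      "-m \<le> a" "b \<le> m" "-m \<le> c" "d \<le> m" "-m \<le> e" "f \<le> m" for a b c d e f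
    by (rule liftable_interval_glue[OF cov h(1), where F = "\<lambda>a b. {a..b} \<times> {c..d} \<times> {e..f}" and l = "-m" and u = m])
      (use that small in \<open>auto intro!: closed_Times convex_Times\<close>)
  have long2: "liftable N p q ({a..b} \<times> {c..d} \<times> {e..f})"
    if "a \<le> b" "c \<le> d" "e \<le> f" "f - e \<le> h"
      "-m \<le> a" "b \<le> m" "-m \<le> c" "d \<le> m" "-m \<le> e" "f \<le> m" for a b c d e f
    by (rule liftable_interval_glue[OF cov h(1), where F = "\<lambda>c d. {a..b} \<times> {c..d} \<times> {e..f}" and l = "-m" and u = m])
      (use that long1 in \<open>auto intro!: closed_Times convex_Times\<close>)
  show ?thesis
    by (rule liftable_interval_glue[OF cov h(1), where F = "\<lambda>e f. {-m..m} \<times> {-m..m} \<times> {e..f}" and l = "-m" and u = m])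
      (use True long2 in \<open>auto intro!: closed_Times convex_Times\<close>)
qed

lemma covering_map_lift_R3:
  fixes q :: "R3 \<Rightarrow> 'c"
  assumes cov: "covering_map N Y p" and q: "continuous_map euclidean Y q"
    and x: "x \<in> topspace N" "p x = q 0"
  shows "\<exists>f. continuous_map euclidean N f \<and> (\<forall>v. p (f v) = q v)"
proof -
  define C :: "nat \<Rightarrow> R3 set" where "C m = {-real m..real m} \<times> {-real m..real m} \<times> {-real m..real m}" for m
  have "\<exists>f. continuous_map (top_of_set (C m)) N f \<and> (\<forall>t\<in>C m. p (f t) = q t) \<and> f 0 = x" for m
  proof -
    have "0 \<in> C m" by (auto simp: C_def zero_prod_def)
    then show ?thesis
      using liftable_cube[OF cov q, of "real m"] x unfolding liftable_def C_def[symmetric] by blast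
  qed
  then obtain f where f: "\<And>m. continuous_map (top_of_set (C m)) N (f m)"
    "\<And>m t. t \<in> C m \<Longrightarrow> p (f m t) = q t" "\<And>m. f m 0 = x"
    by metis
  have agree: "f i t = f j t" if "i \<le> j" "t \<in> C i" for i j t
  proof (rule covering_map_lift_unique[OF cov, of "top_of_set (C i)" "f i" "f j" 0])
    have "convex (C i)" unfolding C_def by (intro convex_Times) auto
    then show "connected_space (top_of_set (C i))"
      using convex_connected[of "C i"] by (simp add: connected_space_subtopology)
    have sub: "C i \<subseteq> C j" using that(1) by (auto simp: C_def)
    then show "continuous_map (top_of_set (C i)) N (f j)"
      using f(1) continuous_map_from_subtopology_mono by blast
    show "p (f i u) = p (f j u)" if "u \<in> topspace (top_of_set (C i))" for u
      using that sub f(2)[of u i] f(2)[of u j] by auto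
    show "0 \<in> topspace (top_of_set (C i))" by (simp add: C_def zero_prod_def)
    show "f i 0 = f j 0" by (simp only: f(3))
    show "t \<in> topspace (top_of_set (C i))" using that by simp
  qed (rule f(1))
  have agree': "f i t = f j t" if "t \<in> C i" "t \<in> C j" for i j t
    using agree[of i j t] agree[of j i t] that nat_le_linear[of i j] by metis
  \<comment> \<open>Infinitely many pieces are pasted along an open cover, so the closed cubes are
    replaced by their interiors.\<close>
  define O' :: "nat \<Rightarrow> R3 set"
    where "O' m = {-real m<..<real m} \<times> {-real m<..<real m} \<times> {-real m<..<real m}" for m
  have OC: "O' m \<subseteq> C m" for m by (auto simp: O'_def C_def)
  have cover: "\<exists>m. t \<in> O' m" for t
  proof -
    obtain a b c where t: "t = (a, b, c)" by (cases t)
    obtain m :: nat where "\<bar>a\<bar> + \<bar>b\<bar> + \<bar>c\<bar> < real m"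
      using reals_Archimedean2 by blast
    then show ?thesis by (intro exI[of _ m]) (auto simp: t O'_def)
  qed
  obtain \<mu> where \<mu>: "\<And>t. t \<in> O' (\<mu> t)"
    using cover by metis
  define g where "g t = f (\<mu> t) t" for t
  have "continuous_map euclidean N g"
  proof (rule pasting_lemma[where I = UNIV and T = O' and f = f])
    show "openin euclidean (O' i)" for i
      unfolding O'_def open_openin[symmetric] by (intro open_Times open_greaterThanLessThan)
    show "continuous_map (subtopology euclidean (O' i)) N (f i)" for i
      using f(1) OC continuous_map_from_subtopology_mono by blast
    show "f i t = f j t" if "t \<in> topspace euclidean \<inter> O' i \<inter> O' j" for i j t
      using that OC agree' by blast
    show "\<exists>j. j \<in> UNIV \<and> t \<in> O' j \<and> g t = f j t" for t
      using \<mu> g_def by blast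
  qed
  moreover have "p (g v) = q v" for v
    using f(2) \<mu>[of v] OC unfolding g_def by blast
  ultimately show ?thesis
    by blast
qed

section \<open>Deck groups and orbit spaces\<close>

text \<open>The device behind all comparisons of classes below: a set of classes is replaced by the
  values of a complete invariant.\<close>

lemma card_image_same_kernel:
  assumes "\<And>a b. a \<in> A \<Longrightarrow> b \<in> A \<Longrightarrow> f a = f b \<longleftrightarrow> g a = g b"
  shows "card (f ` A) = card (g ` A)" "finite (f ` A) \<longleftrightarrow> finite (g ` A)"
proof -
  have "bij_betw (\<lambda>y. g (inv_into A f y)) (f ` A) (g ` A)"
    unfolding bij_betw_def
  proof
    have *: "g (inv_into A f (f a)) = g a" if "a \<in> A" for a
      using assms that by (meson f_inv_into_f image_eqI inv_into_into)
    show "inj_on (\<lambda>y. g (inv_into A f y)) (f ` A)"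
      using assms by (auto simp: inj_on_def *)
    show "(\<lambda>y. g (inv_into A f y)) ` f ` A = g ` A"
      by (simp add: image_image * cong: image_cong)
  qed
  then show "card (f ` A) = card (g ` A)" "finite (f ` A) \<longleftrightarrow> finite (g ` A)"
    using bij_betw_same_card bij_betw_finite by blast+
qed

text \<open>Each quotient map factors continuously through the other, and the two factors are
  inverse to each other.\<close>

lemma quotient_map_same_kernel:
  assumes f: "quotient_map X N f" and f': "quotient_map X N' f'"
    and eq: "\<And>v w. v \<in> topspace X \<Longrightarrow> w \<in> topspace X \<Longrightarrow> f v = f w \<longleftrightarrow> f' v = f' w"
  obtains \<eta> where "homeomorphic_map N N' \<eta>" "\<And>v. v \<in> topspace X \<Longrightarrow> \<eta> (f v) = f' v"
proof -
  obtain \<eta> where \<eta>: "continuous_map N N' \<eta>" "\<And>v. v \<in> topspace X \<Longrightarrow> \<eta> (f v) = f' v"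
    using quotient_map_lift_exists[OF f quotient_imp_continuous_map[OF f']] eq by metis
  obtain \<theta> where \<theta>: "continuous_map N' N \<theta>" "\<And>v. v \<in> topspace X \<Longrightarrow> \<theta> (f' v) = f v"
    using quotient_map_lift_exists[OF f' quotient_imp_continuous_map[OF f]] eq by metis
  have "homeomorphic_maps N N' \<eta> \<theta>"
    unfolding homeomorphic_maps_def quotient_imp_surjective_map[OF f, symmetric]
      quotient_imp_surjective_map[OF f', symmetric]
    using \<eta> \<theta> by (intro conjI ballI) (auto simp: image_iff)
  then show thesis
    using \<eta>(2) that homeomorphic_map_maps by blast
qed

lemma covering_map_lift_unique_R3:
  fixes f g :: "R3 \<Rightarrow> 'a"
  assumes "covering_map N Y p" "continuous_map euclidean N f" "continuous_map euclidean N g"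
    and "\<And>v. p (f v) = p (g v)" and "f s = g s"
  shows "f = g"
proof
  have "connected_space (euclidean :: R3 topology)"
    using connected_UNIV[where 'a = R3] by (metis connectedin_iff_connected connectedin_topspace topspace_euclidean)
  then show "f v = g v" for v
    using covering_map_lift_unique[OF assms(1) _ assms(2,3), of s v] assms(4,5) by auto
qed

text \<open>The uniform displacement bound makes the action free and properly discontinuous at once.\<close>

definition deck :: "('v::metric_space \<Rightarrow> 'v) set \<Rightarrow> bool" where
  "deck D \<longleftrightarrow> id \<in> D \<and> (\<forall>g\<in>D. continuous_on UNIV g) \<and> (\<forall>g\<in>D. \<forall>h\<in>D. g \<circ> h \<in> D) \<and>
     (\<forall>g\<in>D. \<exists>h\<in>D. h \<circ> g = id \<and> g \<circ> h = id) \<and>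
     (\<exists>\<delta>>0. \<forall>g\<in>D. \<forall>v. dist v (g v) < \<delta> \<longrightarrow> g = id)"

definition deck_group :: "('v \<Rightarrow> 'v) set \<Rightarrow> ('v \<Rightarrow> 'v) monoid" where
  "deck_group D = \<lparr>carrier = D, monoid.mult = (\<circ>), one = id\<rparr>"

lemma deck_group_simps [simp]:
  "carrier (deck_group D) = D" "\<one>\<^bsub>deck_group D\<^esub> = id" "g \<otimes>\<^bsub>deck_group D\<^esub> h = g \<circ> h"
  "deck_group D\<lparr>carrier := K\<rparr> = deck_group K"
  by (simp_all add: deck_group_def)

abbreviation orbit_map :: "('v::metric_space \<Rightarrow> 'v) set \<Rightarrow> 'v \<Rightarrow> 'v set" where
  "orbit_map D v \<equiv> orbit_rel D `` {v}"

context
  fixes D :: "('v::metric_space \<Rightarrow> 'v) set"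
  assumes D: "deck D"
begin

lemma deck_id: "id \<in> D" and deck_comp: "g \<in> D \<Longrightarrow> h \<in> D \<Longrightarrow> g \<circ> h \<in> D"
  and deck_continuous: "g \<in> D \<Longrightarrow> continuous_on UNIV g"
  and deck_inverse: "g \<in> D \<Longrightarrow> \<exists>h\<in>D. h \<circ> g = id \<and> g \<circ> h = id"
  and deck_displacement: "\<exists>\<delta>>0. \<forall>g\<in>D. \<forall>v. dist v (g v) < \<delta> \<longrightarrow> g = id"
  using D unfolding deck_def by blast+

lemma deck_comp_apply: "g \<in> D \<Longrightarrow> h \<in> D \<Longrightarrow> (\<lambda>v. g (h v)) \<in> D"
  using deck_comp[of g h] by (simp add: comp_def)

lemma deck_inverse_apply: "g \<in> D \<Longrightarrow> \<exists>h\<in>D. (\<forall>v. h (g v) = v) \<and> (\<forall>v. g (h v) = v)"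
  using deck_inverse[of g] by (auto simp: fun_eq_iff)

lemma group_deck_group: "group (deck_group D)"
proof (rule groupI)
  show "\<exists>h\<in>carrier (deck_group D). h \<otimes>\<^bsub>deck_group D\<^esub> g = \<one>\<^bsub>deck_group D\<^esub>"
    if "g \<in> carrier (deck_group D)" for g
    using deck_inverse[of g] that by auto
qed (use deck_id deck_comp in \<open>auto simp: comp_assoc\<close>)

lemma deck_free: "g \<in> D \<Longrightarrow> g v = v \<Longrightarrow> g = id"
  using deck_displacement by (metis dist_self)

lemma deck_free2:
  assumes "g \<in> D" "h \<in> D" "g v = h v"
  shows "g = h"
proof -
  obtain h' where h': "h' \<in> D" "h' \<circ> h = id" "h \<circ> h' = id"
    using deck_inverse[OF assms(2)] by blast
  have "(h' \<circ> g) v = v"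
    using h'(2) assms(3) by (metis comp_apply id_apply)
  then have "h' \<circ> g = id"
    using deck_free[OF deck_comp[OF h'(1) assms(1)]] by blast
  then show ?thesis
    using h'(3) by (metis comp_assoc comp_id id_comp)
qed

text \<open>\<open>D\<close> is closed under composition and inverses, so a chain of steps in either
  direction collapses to a single element.\<close>

lemma orbit_rel_deck: "(v, w) \<in> orbit_rel D \<longleftrightarrow> (\<exists>g\<in>D. w = g v)"
proof
  assume "(v, w) \<in> orbit_rel D"
  then have "equivclp (\<lambda>u v. \<exists>g\<in>D. v = g u) v w"
    by (simp add: orbit_rel_def)
  then show "\<exists>g\<in>D. w = g v"
  proof (induction rule: equivclp_induct)
    case base
    show ?case using deck_id by (metis id_apply)
  next
    case (step y z)
    then obtain g where g: "g \<in> D" "y = g v" by blast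
    from step(2) obtain h where h: "h \<in> D" "z = h y"
      using deck_inverse_apply by metis
    show ?case
      using deck_comp_apply[OF h(1) g(1)] g(2) h(2) by (intro bexI[of _ "\<lambda>v. h (g v)"]) auto
  qed
next
  assume "\<exists>g\<in>D. w = g v"
  then show "(v, w) \<in> orbit_rel D"
    by (auto simp: orbit_rel_def intro: r_into_equivclp)
qed

lemma orbit_map_eq_iff: "orbit_map D v = orbit_map D w \<longleftrightarrow> (\<exists>g\<in>D. w = g v)"
  using eq_equiv_class_iff[OF equiv_orbit_rel, of v w D] by (simp add: orbit_rel_deck)

lemma deck_open_image:
  assumes "g \<in> D" "open S"
  shows "open (g ` S)"
proof -
  obtain h where h: "h \<in> D" "\<And>v. h (g v) = v" "\<And>v. g (h v) = v"
    using deck_inverse_apply[OF assms(1)] by blast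
  have "g ` S = h -` S"
    by (auto simp: h(2)) (metis h(3) imageI)
  then show ?thesis
    using deck_continuous[OF h(1)] assms(2) by (simp add: open_vimage)
qed

lemma continuous_map_orbit_map: "continuous_map euclidean (orbit_space D) (orbit_map D)"
  by (rule quotient_imp_continuous_map) (rule quotient_map_orbit_space)

lemma topspace_orbit_space_image: "topspace (orbit_space D) = range (orbit_map D)"
  by (auto simp: topspace_orbit_space quotient_def)

lemma orbit_map_in_topspace: "orbit_map D v \<in> topspace (orbit_space D)"
  unfolding topspace_orbit_space_image by (rule rangeI)

lemma orbit_map_apply: "g \<in> D \<Longrightarrow> orbit_map D (g v) = orbit_map D v"
  using orbit_map_eq_iff[of v "g v"] by metis

text \<open>The saturation of an open set is the union of its translates, which are open.\<close>

lemma open_map_orbit_map: "open_map euclidean (orbit_space D) (orbit_map D)"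
  unfolding open_map_def
proof (intro allI impI)
  fix S :: "'v set" assume "openin euclidean S"
  then have S: "open S" by simp
  have "\<Union>(orbit_map D ` S) = (\<Union>g\<in>D. g ` S)"
    unfolding Image_def by (force simp: orbit_rel_deck)
  moreover have "open (\<Union>g\<in>D. g ` S)"
    using deck_open_image S by blast
  ultimately show "openin (orbit_space D) (orbit_map D ` S)"
    by (auto simp: openin_orbit_space quotient_def)
qed

end

section \<open>Coverings as quotients by subgroups of the deck group\<close>

text \<open>\<open>f\<close> presents \<open>N\<close> as the quotient by \<open>K\<close>, lying
  over the quotient by \<open>D\<close>. Since the points of \<open>N\<close> may come from any
  type, the quotient is described through the fibres of \<open>f\<close> and not as an orbit
  space.\<close>

definition uniformizes :: "('v::metric_space \<Rightarrow> 'a) \<Rightarrow> ('v \<Rightarrow> 'v) set \<Rightarrow> ('v \<Rightarrow> 'v) set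
    \<Rightarrow> 'a topology \<Rightarrow> ('a \<Rightarrow> 'v set) \<Rightarrow> bool" where
  "uniformizes f K D N p \<longleftrightarrow> quotient_map euclidean N f \<and> (\<forall>v. p (f v) = orbit_map D v) \<and>
     (\<forall>v w. f v = f w \<longleftrightarrow> (\<exists>k\<in>K. w = k v))"

lemma subgroup_deck:
  assumes D: "deck D" and K: "subgroup K (deck_group D)"
  shows "deck K" "K \<subseteq> D"
proof -
  show sub: "K \<subseteq> D"
    using subgroup.subset[OF K] by simp
  have "\<exists>h\<in>K. h \<circ> g = id \<and> g \<circ> h = id" if "g \<in> K" for g
    using subgroup.m_inv_closed[OF K that] that sub
      group.l_inv[OF group_deck_group[OF D], of g] group.r_inv[OF group_deck_group[OF D], of g]
    by (intro bexI[of _ "inv\<^bsub>deck_group D\<^esub> g"]) auto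
  moreover have "\<exists>\<delta>>0. \<forall>g\<in>K. \<forall>v. dist v (g v) < \<delta> \<longrightarrow> g = id"
    using deck_displacement[OF D] sub by blast
  ultimately show "deck K"
    unfolding deck_def
    using subgroup.one_closed[OF K] subgroup.m_closed[OF K] deck_continuous[OF D] sub by auto
qed

text \<open>The image of a ball of half the displacement bound is evenly covered; its sheets are the
  images under \<open>f\<close> of the translates of the ball.\<close>

lemma uniformizes_covering_map:
  assumes D: "deck D" and K: "deck K" "K \<subseteq> D" and f: "uniformizes f K D N p"
  shows "covering_map N (orbit_space D) p"
proof -
  let ?Y = "orbit_space D" and ?q = "orbit_map D"
  have fq: "quotient_map euclidean N f" and pf: "\<And>v. p (f v) = ?q v"
    and ker: "\<And>v w. f v = f w \<longleftrightarrow> (\<exists>k\<in>K. w = k v)"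
    using f by (auto simp: uniformizes_def)
  have N: "topspace N = range f"
    using quotient_imp_surjective_map[OF fq] by simp
  have "p \<circ> f = ?q"
    using pf by auto
  then have pc: "continuous_map N ?Y p"
    using continuous_compose_quotient_map[OF fq, of ?Y p] continuous_map_orbit_map[OF D] by simp
  have ps: "p ` topspace N = topspace ?Y"
    unfolding N topspace_orbit_space_image[OF D] by (simp add: image_image pf)
  have fopen: "openin N (f ` S)" if "open S" for S
  proof -
    have "{v. f v \<in> f ` S} = (\<Union>k\<in>K. k ` S)"
    proof (intro equalityI subsetI)
      fix v assume "v \<in> {v. f v \<in> f ` S}"
      then obtain s where "s \<in> S" "f s = f v" by auto
      then show "v \<in> (\<Union>k\<in>K. k ` S)" using ker by blast
    next
      fix v assume "v \<in> (\<Union>k\<in>K. k ` S)"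
      then obtain s k where "s \<in> S" "k \<in> K" "v = k s" by blast
      then show "v \<in> {v. f v \<in> f ` S}" using ker[of s v] by (metis image_eqI mem_Collect_eq)
    qed
    moreover have "open (\<Union>k\<in>K. k ` S)"
      using deck_open_image[OF K(1)] that by blast
    moreover have "open {v. f v \<in> f ` S} = openin N (f ` S)"
      using fq N unfolding quotient_map_def by (simp add: image_mono)
    ultimately show ?thesis by simp
  qed
  have popen: "openin ?Y (p ` W)" if "openin N W" for W
  proof -
    have "open {v. f v \<in> W}"
      using openin_continuous_map_preimage[OF quotient_imp_continuous_map[OF fq] that] by simp
    moreover have "p ` W = ?q ` {v. f v \<in> W}"
    proof -
      have "W = f ` {v. f v \<in> W}"
        using openin_subset[OF that] N by (auto simp: image_iff)
      then have "p ` W = p ` (f ` {v. f v \<in> W})" by simp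
      then show ?thesis by (simp add: image_image pf)
    qed
    ultimately show ?thesis
      using open_map_orbit_map[OF D] by (simp add: open_map_def)
  qed
  have "\<exists>V. openin ?Y V \<and> y \<in> V \<and>
        (\<exists>\<U>. \<Union>\<U> = {x \<in> topspace N. p x \<in> V} \<and>
             (\<forall>U\<in>\<U>. openin N U) \<and> pairwise disjnt \<U> \<and>
             (\<forall>U\<in>\<U>. homeomorphic_map (subtopology N U) (subtopology ?Y V) p))"
    if y: "y \<in> topspace ?Y" for y
  proof -
    obtain v0 where v0: "y = ?q v0"
      using y topspace_orbit_space_image[OF D] by blast
    obtain \<delta> where \<delta>: "\<delta> > 0" "\<And>g v. g \<in> D \<Longrightarrow> dist v (g v) < \<delta> \<Longrightarrow> g = id"
      using deck_displacement[OF D] by blast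
    \<comment> \<open>Two points of \<open>B\<close> are less than \<open>\<delta>\<close> apart, so
      only the identity of \<open>D\<close> carries a point of \<open>B\<close> into
      \<open>B\<close>.\<close>
    define B where "B = ball v0 (\<delta> / 2)"
    have small: "g = id" if "g \<in> D" "u \<in> B" "g u \<in> B" for g u
    proof (rule \<delta>(2)[OF that(1)])
      show "dist u (g u) < \<delta>"
        using dist_triangle_half_r[of v0 u \<delta> "g u"] that by (simp add: B_def)
    qed
    define V where "V = ?q ` B"
    define \<U> where "\<U> = (\<lambda>g. f ` g ` B) ` D"
    have V: "openin ?Y V"
      unfolding V_def B_def using open_map_orbit_map[OF D] by (simp add: open_map_def)
    have yV: "y \<in> V"
      using \<delta>(1) by (simp add: v0 V_def B_def)
    have qg: "?q (g u) = ?q u" if "g \<in> D" for g u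
      using orbit_map_eq_iff[OF D, of u "g u"] that by auto
    have UU: "\<Union>\<U> = {x \<in> topspace N. p x \<in> V}"
    proof (intro equalityI subsetI)
      fix x assume "x \<in> \<Union>\<U>"
      then show "x \<in> {x \<in> topspace N. p x \<in> V}"
        by (auto simp: \<U>_def N V_def pf qg)
    next
      fix x assume "x \<in> {x \<in> topspace N. p x \<in> V}"
      then obtain w u where w: "x = f w" "u \<in> B" "?q u = ?q w"
        by (auto simp: N V_def pf)
      then obtain g where "g \<in> D" "w = g u"
        using orbit_map_eq_iff[OF D] by blast
      then show "x \<in> \<Union>\<U>"
        using w by (auto simp: \<U>_def)
    qed
    have Uopen: "openin N U" if "U \<in> \<U>" for U
    proof -
      obtain g where "g \<in> D" "U = f ` g ` B"
        using \<open>U \<in> \<U>\<close> unfolding \<U>_def by blast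
      then show ?thesis
        using fopen deck_open_image[OF D] by (simp add: B_def)
    qed
    \<comment> \<open>If the sheets meet, then \<open>g\<close> followed by some \<open>k\<close> in
      \<open>K\<close> and by the inverse of \<open>h\<close> returns a point of \<open>B\<close> to
      \<open>B\<close>, hence is the identity. So \<open>h = k \<circ> g\<close>, and
      \<open>f\<close> does not see \<open>k\<close>.\<close>
    have "f ` g ` B = f ` h ` B" if g: "g \<in> D" and h: "h \<in> D" and x: "x \<in> f ` g ` B" "x \<in> f ` h ` B" for g h x
    proof -
      obtain u w where u: "u \<in> B" "x = f (g u)" and w: "w \<in> B" "x = f (h w)"
        using x by blast
      then obtain k where k: "k \<in> K" "h w = k (g u)"
        using ker[of "g u" "h w"] by auto
      obtain h' where h': "h' \<in> D" "\<And>v. h' (h v) = v" "\<And>v. h (h' v) = v"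
        using deck_inverse_apply[OF D h] by blast
      have "(\<lambda>v. h' (k (g v))) \<in> D"
        using deck_comp_apply[OF D h'(1) deck_comp_apply[OF D _ g]] k(1) K(2) by blast
      moreover have "h' (k (g u)) = w"
        using k(2) h'(2) by metis
      ultimately have "(\<lambda>v. h' (k (g v))) = id"
        using small[of "\<lambda>v. h' (k (g v))" u] u w by simp
      then have "k (g v) = h v" for v
        using h'(3) by (metis id_apply)
      then have "f (g v) = f (h v)" for v
        using ker k(1) by metis
      then show ?thesis by (simp add: image_image)
    qed
    then have disj: "pairwise disjnt \<U>"
      unfolding pairwise_def disjnt_def \<U>_def by blast
    have hom: "homeomorphic_map (subtopology N U) (subtopology ?Y V) p" if U: "U \<in> \<U>" for U
    proof (rule bijective_open_imp_homeomorphic_map)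
      obtain g where g: "g \<in> D" "U = f ` g ` B"
        using U unfolding \<U>_def by blast
      have sub: "U \<subseteq> topspace N" "V \<subseteq> topspace ?Y"
        using Uopen[OF U] V openin_subset by blast+
      have pU: "p ` U = V"
        using g by (auto simp: image_image pf qg V_def)
      show "continuous_map (subtopology N U) (subtopology ?Y V) p"
        using pc pU by (auto simp: continuous_map_in_subtopology continuous_map_from_subtopology)
      show "open_map (subtopology N U) (subtopology ?Y V) p"
        unfolding open_map_def
      proof (intro allI impI)
        fix S assume S: "openin (subtopology N U) S"
        then have "openin N S" "S \<subseteq> U"
          using Uopen[OF U] openin_trans_full openin_subset by fastforce+
        then show "openin (subtopology ?Y V) (p ` S)"
          using popen[of S] pU by (metis image_mono inf.absorb1 openin_subtopology_Int)
      qed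
      show "p ` topspace (subtopology N U) = topspace (subtopology ?Y V)"
        using pU sub by (simp add: inf.absorb2)
      have "inj_on p U"
      proof (rule inj_onI)
        fix x x' assume x: "x \<in> U" "x' \<in> U" "p x = p x'"
        then obtain u u' where u: "u \<in> B" "x = f (g u)" "u' \<in> B" "x' = f (g u')"
          using g(2) by blast
        then have "?q u = ?q u'"
          using x(3) by (simp add: pf qg[OF g(1)])
        then obtain h where "h \<in> D" "u' = h u"
          using orbit_map_eq_iff[OF D] by blast
        then show "x = x'"
          using small[of h u] u by auto
      qed
      then show "inj_on p (topspace (subtopology N U))"
        using sub by (simp add: inf.absorb2)
    qed
    show ?thesis
      using V yV UU Uopen disj hom by (intro exI[of _ V] conjI exI[of _ \<U>]) auto
  qed
  then show ?thesis
    unfolding covering_map_def using pc ps by blast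
qed

text \<open>The points over the orbit of \<open>v0\<close> are the \<open>f (g v0)\<close>. By
  freeness, \<open>g\<close> and \<open>h\<close> give the same point iff
  \<open>h = k \<circ> g\<close> for some \<open>k\<close> in \<open>K\<close>, that is, iff they
  lie in the same right coset.\<close>

lemma uniformizes_fibre:
  assumes D: "deck D" and K: "subgroup K (deck_group D)" and f: "uniformizes f K D N p"
    and y: "y \<in> topspace (orbit_space D)"
  shows "card {x \<in> topspace N. p x = y} = card (rcosets\<^bsub>deck_group D\<^esub> K)"
    and "finite {x \<in> topspace N. p x = y} \<longleftrightarrow> finite (rcosets\<^bsub>deck_group D\<^esub> K)"
proof -
  let ?q = "orbit_map D"
  interpret group "deck_group D" by (rule group_deck_group[OF D])
  have pf: "\<And>v. p (f v) = ?q v" and ker: "\<And>v w. f v = f w \<longleftrightarrow> (\<exists>k\<in>K. w = k v)"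
    using f by (auto simp: uniformizes_def)
  have N: "topspace N = range f"
    using f quotient_imp_surjective_map[of euclidean N f] by (simp add: uniformizes_def)
  have sub: "K \<subseteq> D" and deckK: "deck K"
    using subgroup_deck[OF D K] by auto
  obtain v0 where v0: "y = ?q v0"
    using y topspace_orbit_space_image[OF D] by blast
  have "{x \<in> topspace N. p x = y} = (\<lambda>g. f (g v0)) ` D"
  proof (intro equalityI subsetI)
    fix x assume "x \<in> {x \<in> topspace N. p x = y}"
    then obtain w where w: "x = f w" "?q v0 = ?q w"
      by (auto simp: N pf v0)
    then show "x \<in> (\<lambda>g. f (g v0)) ` D"
      using orbit_map_eq_iff[OF D, of v0 w] by blast
  next
    fix x assume "x \<in> (\<lambda>g. f (g v0)) ` D"
    then obtain g where g: "g \<in> D" "x = f (g v0)" by blast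
    then have "?q (g v0) = y"
      unfolding v0 by (intro orbit_map_apply[OF D])
    then show "x \<in> {x \<in> topspace N. p x = y}"
      using g by (simp add: N pf)
  qed
  moreover have "rcosets\<^bsub>deck_group D\<^esub> K = (\<lambda>g. K #>\<^bsub>deck_group D\<^esub> g) ` D"
    by (auto simp: RCOSETS_def)
  moreover have "f (g v0) = f (h v0) \<longleftrightarrow> K #>\<^bsub>deck_group D\<^esub> g = K #>\<^bsub>deck_group D\<^esub> h"
    if g: "g \<in> D" and h: "h \<in> D" for g h
  proof -
    have "f (g v0) = f (h v0) \<longleftrightarrow> (\<exists>k\<in>K. h v0 = (k \<circ> g) v0)"
      by (simp add: ker)
    also have "\<dots> \<longleftrightarrow> (\<exists>k\<in>K. h = k \<circ> g)"
      using deck_free2[OF D h deck_comp[OF D _ g]] sub by (metis subsetD)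
    also have "\<dots> \<longleftrightarrow> h \<in> K #>\<^bsub>deck_group D\<^esub> g"
      by (auto simp: r_coset_def)
    also have "\<dots> \<longleftrightarrow> K #>\<^bsub>deck_group D\<^esub> g = K #>\<^bsub>deck_group D\<^esub> h"
      using repr_independence[of h K g] rcos_self[of h K] g h K by auto
    finally show ?thesis .
  qed
  ultimately show "card {x \<in> topspace N. p x = y} = card (rcosets\<^bsub>deck_group D\<^esub> K)"
    and "finite {x \<in> topspace N. p x = y} \<longleftrightarrow> finite (rcosets\<^bsub>deck_group D\<^esub> K)"
    using card_image_same_kernel[of D "\<lambda>g. f (g v0)" "\<lambda>g. K #>\<^bsub>deck_group D\<^esub> g"] by simp_all
qed

text \<open>Connectedness of \<open>N\<close> is inherited from Euclidean space, so only the size of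
  the fibres is left. The base is nonempty, which gives the direction from fibres to index.\<close>

lemma uniformizes_fold_covering_iff:
  fixes D :: "(R3 \<Rightarrow> R3) set"
  assumes D: "deck D" and K: "subgroup K (deck_group D)" and f: "uniformizes f K D N p"
  shows "fold_covering n N (orbit_space D) p \<longleftrightarrow>
    finite (rcosets\<^bsub>deck_group D\<^esub> K) \<and> card (rcosets\<^bsub>deck_group D\<^esub> K) = n"
proof -
  have "connected_space (euclidean :: R3 topology)"
    using connected_UNIV[where 'a = R3] by (metis connectedin_iff_connected connectedin_topspace topspace_euclidean)
  then have "connected_space N"
    using connected_space_quotient_map_image[of euclidean N f] f by (simp add: uniformizes_def)
  moreover have "topspace (orbit_space D) \<noteq> {}"
    by (simp add: topspace_orbit_space_image[OF D])
  ultimately show ?thesis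
    unfolding fold_covering_def
    using uniformizes_covering_map[OF D subgroup_deck[OF D K] f] uniformizes_fibre[OF D K f]
    by (auto simp del: topspace_orbit_space)
qed

lemma covering_map_section_at:
  assumes cov: "covering_map N Y p" and x: "x \<in> topspace N"
  shows "\<exists>V s. openin Y V \<and> p x \<in> V \<and> continuous_map (subtopology Y V) N s \<and> (\<forall>z\<in>V. p (s z) = z)
    \<and> s (p x) = x \<and> (\<forall>W\<subseteq>V. openin Y W \<longrightarrow> openin N (s ` W))"
proof -
  have "p x \<in> topspace Y"
    using cov x unfolding covering_map_def by blast
  then show ?thesis
    using covering_map_local_section[OF cov] x by metis
qed

text \<open>\<open>f\<close> is a lift of the orbit map and \<open>K\<close> consists of the deck
  transformations that \<open>f\<close> does not see. The main point is that \<open>f\<close> is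
  open and onto: its range is open and closed in a connected space.\<close>

lemma fold_covering_uniformizes:
  fixes D :: "(R3 \<Rightarrow> R3) set"
  assumes D: "deck D" and N: "fold_covering n N (orbit_space D) p" and n: "n > 0"
  obtains K f where "subgroup K (deck_group D)" "uniformizes f K D N p"
proof -
  let ?q = "orbit_map D" and ?Y = "orbit_space D"
  interpret group "deck_group D" by (rule group_deck_group[OF D])
  have cov: "covering_map N ?Y p" and con: "connected_space N"
    using N by (auto simp: fold_covering_def)
  have qc: "continuous_map euclidean ?Y ?q"
    by (rule continuous_map_orbit_map[OF D])
  have qY: "?q v \<in> topspace ?Y" for v
    by (rule orbit_map_in_topspace[OF D])
  have qg: "?q (g u) = ?q u" if "g \<in> D" for g u
    by (rule orbit_map_apply[OF D that])
  have "card {x \<in> topspace N. p x = ?q 0} = n"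
    using N qY by (simp add: fold_covering_def)
  then have "{x \<in> topspace N. p x = ?q 0} \<noteq> {}"
    using n by (metis card.empty less_numeral_extra(3))
  then obtain x0 where "x0 \<in> topspace N" "p x0 = ?q 0" by blast
  then obtain f where f: "continuous_map euclidean N f" and pf: "\<And>v. p (f v) = ?q v"
    using covering_map_lift_R3[OF cov qc] by blast
  define K where "K = {g \<in> D. \<forall>v. f (g v) = f v}"
  have KD: "K \<subseteq> D"
    unfolding K_def by blast
  have Kf: "f (k v) = f v" if "k \<in> K" for k v
    using that unfolding K_def by blast
  have KI: "k \<in> K" if "k \<in> D" "\<And>v. f (k v) = f v" for k
    using that unfolding K_def by blast
  have fg: "continuous_map euclidean N (\<lambda>v. f (g v))" if "g \<in> D" for g
    using continuous_map_compose[OF _ f, of euclidean g] deck_continuous[OF D that] by (simp add: comp_def)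
  have ker: "f v = f w \<longleftrightarrow> (\<exists>k\<in>K. w = k v)" for v w
  proof
    assume eq: "f v = f w"
    then have "?q v = ?q w" by (metis pf)
    then obtain g where g: "g \<in> D" "w = g v"
      using orbit_map_eq_iff[OF D] by blast
    \<comment> \<open>Both sides lift the orbit map, which is unchanged by \<open>g\<close>, and
      they agree at \<open>v\<close>.\<close>
    have "(\<lambda>v. f (g v)) = f"
      by (rule covering_map_lift_unique_R3[OF cov fg[OF g(1)] f, where s = v])
        (use eq g qg in \<open>auto simp: pf\<close>)
    then show "\<exists>k\<in>K. w = k v"
      using g KI[OF g(1)] by (metis (no_types))
  next
    assume "\<exists>k\<in>K. w = k v"
    then obtain k where "k \<in> K" "w = k v" by blast
    then show "f v = f w" using Kf[of k v] by simp
  qed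
  have K: "subgroup K (deck_group D)"
  proof (rule subgroupI)
    fix g assume g: "g \<in> K"
    have inv: "inv\<^bsub>deck_group D\<^esub> g \<in> D" "g \<circ> inv\<^bsub>deck_group D\<^esub> g = id"
      using inv_closed[of g] r_inv[of g] g KD by auto
    have "f ((inv\<^bsub>deck_group D\<^esub> g) v) = f v" for v
    proof -
      have "f (g ((inv\<^bsub>deck_group D\<^esub> g) v)) = f ((inv\<^bsub>deck_group D\<^esub> g) v)"
        by (rule Kf[OF g])
      then show ?thesis
        using inv(2) by (metis comp_apply id_apply)
    qed
    then show "inv\<^bsub>deck_group D\<^esub> g \<in> K"
      using inv(1) by (intro KI)
  next
    have "id \<in> K"
      using deck_id[OF D] by (intro KI) simp_all
    then show "K \<noteq> {}" by blast
  next
    fix g h assume gh: "g \<in> K" "h \<in> K"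
    have "g \<circ> h \<in> K"
    proof (rule KI)
      show "g \<circ> h \<in> D" using gh KD deck_comp[OF D] by blast
      show "f ((g \<circ> h) v) = f v" for v
        using Kf[OF gh(1), of "h v"] Kf[OF gh(2), of v] by simp
    qed
    then show "g \<otimes>\<^bsub>deck_group D\<^esub> h \<in> K" by simp
  qed (use KD in simp)
  \<comment> \<open>One sheet around \<open>x\<close> serves twice: for \<open>x = f v\<close> it
    shows that \<open>f\<close> is open, and if it meets the range of \<open>f\<close> then
    \<open>x\<close> itself lies in the range, which is therefore closed.\<close>
  have nbhd: "\<exists>W. openin N W \<and> x \<in> W \<and> (x = f v \<longrightarrow> W \<subseteq> f ` S) \<and> (W \<inter> range f \<noteq> {} \<longrightarrow> x \<in> range f)"
    if x: "x \<in> topspace N" "p x = ?q v" and S: "open S" "v \<in> S" for x v S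
  proof -
    obtain V s where V: "openin ?Y V" "?q v \<in> V"
      and s: "continuous_map (subtopology ?Y V) N s" "\<forall>z\<in>V. p (s z) = z" "s (?q v) = x"
        "\<forall>W\<subseteq>V. openin ?Y W \<longrightarrow> openin N (s ` W)"
      using covering_map_section_at[OF cov x(1)] unfolding x(2) by blast
    have "open ({u. ?q u \<in> V} \<inter> S)"
      using openin_continuous_map_preimage[OF qc V(1)] S(1) by (intro open_Int) simp_all
    then obtain e where e: "e > 0" "ball v e \<subseteq> {u. ?q u \<in> V} \<inter> S"
      using S(2) V(2) by (metis IntI mem_Collect_eq openE)
    have ps: "p ((s \<circ> ?q) t) = ?q t" if "t \<in> ball v e" for t
    proof -
      have "?q t \<in> V" using that e(2) by blast
      then show ?thesis using s(2) unfolding comp_apply by blast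
    qed
    have sq: "continuous_map (top_of_set (ball v e)) N (s \<circ> ?q)"
    proof (rule continuous_map_compose[OF _ s(1)])
      show "continuous_map (top_of_set (ball v e)) (subtopology ?Y V) ?q"
        using e(2) continuous_map_from_subtopology[OF qc]
        unfolding continuous_map_in_subtopology topspace_euclidean_subtopology by blast
    qed
    \<comment> \<open>A translate \<open>f \<circ> g\<close> that meets the section over the ball
      once follows it over the whole ball, by uniqueness of lifts.\<close>
    have agree: "f (g t) = (s \<circ> ?q) t"
      if g: "g \<in> D" and u: "u \<in> ball v e" "f (g u) = (s \<circ> ?q) u" and t: "t \<in> ball v e" for g u t
    proof (rule covering_map_lift_unique[OF cov, of "top_of_set (ball v e)" "\<lambda>v. f (g v)" "s \<circ> ?q" u])
      show "connected_space (top_of_set (ball v e))"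
        by (simp add: connected_space_subtopology)
      show "continuous_map (top_of_set (ball v e)) N (\<lambda>v. f (g v))"
        using fg[OF g] continuous_map_from_subtopology by blast
      show "continuous_map (top_of_set (ball v e)) N (s \<circ> ?q)" by (rule sq)
      show "p (f (g t)) = p ((s \<circ> ?q) t)" if "t \<in> topspace (top_of_set (ball v e))" for t
        using ps[of t] that by (simp only: pf qg[OF g] topspace_euclidean_subtopology)
    qed (use u t in auto)
    have v: "v \<in> ball v e" using e(1) by simp
    have "openin ?Y (?q ` ball v e)"
      using open_map_orbit_map[OF D] by (simp add: open_map_def)
    moreover have "?q ` ball v e \<subseteq> V"
      using e(2) by blast
    ultimately have "openin N (s ` ?q ` ball v e)"
      using s(4) by blast
    moreover have "x \<in> s ` ?q ` ball v e"
      using s(3) v by (metis image_eqI)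
    moreover have "s ` ?q ` ball v e \<subseteq> f ` S" if "x = f v"
    proof -
      have "f t = (s \<circ> ?q) t" if "t \<in> ball v e" for t
        using agree[OF deck_id[OF D] v _ that] s(3) \<open>x = f v\<close> by simp
      then have "s ` ?q ` ball v e = f ` ball v e"
        unfolding image_comp by (intro image_cong) simp_all
      then show ?thesis using e(2) by blast
    qed
    moreover have "x \<in> range f" if meet: "s ` ?q ` ball v e \<inter> range f \<noteq> {}"
    proof -
      obtain u w where u: "u \<in> ball v e" "s (?q u) = f w"
        using meet by blast
      then have "?q u = ?q w"
        using ps[OF u(1)] pf[of w] by simp
      then obtain g where g: "g \<in> D" "w = g u"
        using orbit_map_eq_iff[OF D] by blast
      then have "f (g v) = (s \<circ> ?q) v"
        using agree[OF g(1) u(1) _ v] u(2) by simp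
      then show ?thesis
        using s(3) by (metis comp_apply rangeI)
    qed
    ultimately show ?thesis
      by (intro exI[of _ "s ` ?q ` ball v e"] conjI impI)
  qed
  have fN: "f v \<in> topspace N" for v
    using continuous_map_image_subset_topspace[OF f] by auto
  have fopen: "openin N (f ` S)" if S: "open S" for S
  proof (subst openin_subopen, intro ballI)
    fix x assume "x \<in> f ` S"
    then obtain v where v: "v \<in> S" "x = f v" by blast
    then show "\<exists>T. openin N T \<and> x \<in> T \<and> T \<subseteq> f ` S"
      using nbhd[OF fN[of v] pf[of v] S v(1)] by blast
  qed
  have "closedin N (range f)"
    unfolding closedin_def
  proof
    show "range f \<subseteq> topspace N"
      using fN by blast
    show "openin N (topspace N - range f)"
    proof (subst openin_subopen, intro ballI)
      fix x assume x: "x \<in> topspace N - range f"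
      then have "p x \<in> topspace ?Y"
        using cov unfolding covering_map_def by blast
      then obtain v where "p x = ?q v"
        using topspace_orbit_space_image[OF D] by blast
      then obtain W where W: "openin N W" "x \<in> W" "W \<inter> range f = {}"
        using nbhd[of x v UNIV] x by auto
      moreover have "W \<subseteq> topspace N - range f"
        using W(3) openin_subset[OF W(1)] by blast
      ultimately show "\<exists>T. openin N T \<and> x \<in> T \<and> T \<subseteq> topspace N - range f"
        by blast
    qed
  qed
  then have "range f = topspace N"
    using con fopen[OF open_UNIV] unfolding connected_space_clopen_in by (metis UNIV_I empty_iff rangeI)
  then have "quotient_map euclidean N f"
    using f fopen by (simp add: continuous_open_quotient_map open_map_def)
  then have "uniformizes f K D N p"
    using ker pf by (simp add: uniformizes_def)
  then show thesis
    using K that by blast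
qed

text \<open>To have the quotient by \<open>K\<close> with points in \<open>'a\<close>, each orbit is
  replaced by the image under \<open>e\<close> of a chosen member. This is the place where
  \<open>'a\<close> has to be large enough.\<close>

lemma uniformizes_exists:
  fixes D :: "('v::metric_space \<Rightarrow> 'v) set" and e :: "'v \<Rightarrow> 'a"
  assumes D: "deck D" and K: "subgroup K (deck_group D)" and e: "inj e"
  shows "\<exists>(N :: 'a topology) p f. uniformizes f K D N p"
proof -
  have deckK: "deck K" "K \<subseteq> D"
    using subgroup_deck[OF D K] by auto
  define f where "f v = e (SOME w. w \<in> orbit_map K v)" for v
  have ker: "f v = f w \<longleftrightarrow> (\<exists>k\<in>K. w = k v)" for v w
  proof -
    have some: "(SOME w. w \<in> orbit_map K v) \<in> orbit_map K v" for v
      by (rule someI[of _ v]) (rule equiv_class_self[OF equiv_orbit_rel], simp)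
    have "f v = f w \<longleftrightarrow> (SOME u. u \<in> orbit_map K v) = (SOME u. u \<in> orbit_map K w)"
      using e by (simp add: f_def inj_eq)
    also have "\<dots> \<longleftrightarrow> orbit_map K v = orbit_map K w"
      using some[of v] some[of w] equiv_class_eq[OF equiv_orbit_rel] by (metis Image_singleton_iff)
    finally show ?thesis
      by (simp add: orbit_map_eq_iff[OF deckK(1)])
  qed
  define N where "N = topology (\<lambda>U. U \<subseteq> range f \<and> open (f -` U))"
  have "istopology (\<lambda>U. U \<subseteq> range f \<and> open (f -` U))"
    unfolding istopology_def by (auto simp: vimage_Union)
  then have openN: "openin N U \<longleftrightarrow> U \<subseteq> range f \<and> open (f -` U)" for U
    unfolding N_def by (simp add: topology_inverse')
  have topN: "topspace N = range f"
  proof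
    show "topspace N \<subseteq> range f"
      using openN openin_topspace by blast
    have "f -` range f = UNIV" by auto
    then show "range f \<subseteq> topspace N"
      using openN[of "range f"] openin_subset[of N "range f"] by simp
  qed
  have "quotient_map euclidean N f"
    by (auto simp: quotient_map_def topN openN vimage_def)
  moreover define p where "p x = orbit_map D (SOME v. f v = x)" for x
  have "p (f v) = orbit_map D v" for v
  proof -
    have "f (SOME w. f w = f v) = f v" by (rule someI) simp
    then obtain k where "k \<in> K" "v = k (SOME w. f w = f v)"
      using ker by blast
    then show ?thesis
      unfolding p_def using orbit_map_eq_iff[OF D] deckK(2) by blast
  qed
  ultimately have "uniformizes f K D N p"
    using ker by (simp add: uniformizes_def)
  then show ?thesis by blast
qed

lemma uniformizes_orbit_space:
  assumes D: "deck D" and K: "deck K" "K \<subseteq> D" and f: "uniformizes f K D N p"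
  shows "N homeomorphic_space orbit_space K"
proof -
  have "quotient_map euclidean N f" "\<And>v w. f v = f w \<longleftrightarrow> orbit_map K v = orbit_map K w"
    using f by (auto simp: uniformizes_def orbit_map_eq_iff[OF K(1)])
  then obtain \<eta> where "homeomorphic_map N (orbit_space K) \<eta>"
    using quotient_map_same_kernel[of euclidean N f "orbit_space K" "orbit_map K"]
      quotient_map_orbit_space[of K] by metis
  then show ?thesis
    using homeomorphic_map_imp_homeomorphic_space by blast
qed

lemma in_subgroup_conj_deck_iff:
  assumes D: "deck D"
  shows "(K, K') \<in> subgroup_conj (deck_group D) \<longleftrightarrow>
    (\<exists>g\<in>D. K' = {g \<circ> k \<circ> inv\<^bsub>deck_group D\<^esub> g | k. k \<in> K})"
  unfolding subgroup_conj_def l_coset_def r_coset_def by auto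

text \<open>An equivalence of coverings composed with \<open>f\<close> is a lift of the orbit map
  through \<open>p'\<close>, hence equals \<open>f' \<circ> g\<close> for some deck transformation
  \<open>g\<close>; comparing fibres shows that \<open>g\<close> conjugates \<open>K\<close> to
  \<open>K'\<close>. Conversely such a \<open>g\<close> descends to the quotients.\<close>

lemma uniformizes_equiv_iff:
  fixes D :: "(R3 \<Rightarrow> R3) set"
  assumes D: "deck D" and K: "subgroup K (deck_group D)" and f: "uniformizes f K D N p"
    and K': "subgroup K' (deck_group D)" and f': "uniformizes f' K' D N' p'"
  shows "((N, p), (N', p')) \<in> covering_equiv \<longleftrightarrow> (K, K') \<in> subgroup_conj (deck_group D)"
proof
  let ?q = "orbit_map D"
  interpret group "deck_group D" by (rule group_deck_group[OF D])
  have sub: "K \<subseteq> D" "K' \<subseteq> D"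
    using subgroup_deck[OF D] K K' by auto
  have fq: "quotient_map euclidean N f" "quotient_map euclidean N' f'"
    and pf: "\<And>v. p (f v) = ?q v" "\<And>v. p' (f' v) = ?q v"
    and ker: "\<And>v w. f v = f w \<longleftrightarrow> (\<exists>k\<in>K. w = k v)" "\<And>v w. f' v = f' w \<longleftrightarrow> (\<exists>k\<in>K'. w = k v)"
    using f f' unfolding uniformizes_def by blast+
  have fc: "continuous_map euclidean N f" "continuous_map euclidean N' f'"
    using fq quotient_imp_continuous_map by auto
  have N: "topspace N = range f" "topspace N' = range f'"
    using fq quotient_imp_surjective_map by fastforce+
  have cov': "covering_map N' (orbit_space D) p'"
    using uniformizes_covering_map[OF D subgroup_deck[OF D K'] f'] .
  have inv: "g \<circ> inv\<^bsub>deck_group D\<^esub> g = id" "inv\<^bsub>deck_group D\<^esub> g \<circ> g = id" "inv\<^bsub>deck_group D\<^esub> g \<in> D" if "g \<in> D" for g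
    using l_inv[of g] r_inv[of g] inv_closed[of g] that by auto
  have inv': "g ((inv\<^bsub>deck_group D\<^esub> g) v) = v" "(inv\<^bsub>deck_group D\<^esub> g) (g v) = v" if "g \<in> D" for g v
    using inv(1,2)[OF that] by (metis comp_apply id_apply)+
  {
    assume "((N, p), (N', p')) \<in> covering_equiv"
    then obtain \<eta> where \<eta>: "homeomorphic_map N N' \<eta>" "\<And>x. x \<in> topspace N \<Longrightarrow> p x = p' (\<eta> x)"
      by (auto simp: covering_equiv_def)
    have \<eta>p: "p' (\<eta> (f v)) = ?q v" for v
      using \<eta>(2)[of "f v"] pf(1)[of v] N(1) by simp
    have \<eta>inj: "\<eta> (f v) = \<eta> (f w) \<longleftrightarrow> f v = f w" for v w
      using \<eta>(1) N(1) unfolding homeomorphic_map_def by (metis inj_on_eq_iff rangeI)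
    have "\<eta> (f 0) \<in> topspace N'"
      using \<eta>(1) N(1) homeomorphic_imp_surjective_map by blast
    then obtain w where w: "\<eta> (f 0) = f' w"
      using N(2) by blast
    then have "?q 0 = ?q w"
      using \<eta>p[of 0] pf(2)[of w] by simp
    then obtain g where g: "g \<in> D" "w = g 0"
      using orbit_map_eq_iff[OF D] by blast
    have "(\<lambda>v. \<eta> (f v)) = (\<lambda>v. f' (g v))"
    proof (rule covering_map_lift_unique_R3[OF cov', where s = 0])
      show "continuous_map euclidean N' (\<lambda>v. \<eta> (f v))"
        using continuous_map_compose[OF fc(1) homeomorphic_imp_continuous_map[OF \<eta>(1)]] by (simp add: comp_def)
      show "continuous_map euclidean N' (\<lambda>v. f' (g v))"
        using continuous_map_compose[OF _ fc(2), of euclidean g] deck_continuous[OF D g(1)]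
        by (simp add: comp_def)
      show "p' (\<eta> (f v)) = p' (f' (g v))" for v
        using \<eta>p pf(2) orbit_map_apply[OF D g(1)] by metis
      show "\<eta> (f 0) = f' (g 0)" using w g by simp
    qed
    then have eq: "\<eta> (f v) = f' (g v)" for v by metis
    have K_iff: "k \<in> K \<longleftrightarrow> (\<forall>v. f (k v) = f v)" if "k \<in> D" for k
      using ker(1) deck_free2[OF D] that sub(1) by (metis subsetD)
    have K'_iff: "k \<in> K' \<longleftrightarrow> (\<forall>v. f' (k v) = f' v)" if "k \<in> D" for k
      using ker(2) deck_free2[OF D] that sub(2) by (metis subsetD)
    have K_conj: "k \<in> K \<longleftrightarrow> g \<circ> k \<circ> inv\<^bsub>deck_group D\<^esub> g \<in> K'" if k: "k \<in> D" for k
    proof -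
      have "k \<in> K \<longleftrightarrow> (\<forall>v. f' (g (k v)) = f' (g v))"
        by (simp add: K_iff[OF k] eq[symmetric] \<eta>inj)
      also have "\<dots> \<longleftrightarrow> (\<forall>v. f' (g (k ((inv\<^bsub>deck_group D\<^esub> g) v))) = f' v)"
        using inv'[OF g(1)] by metis
      also have "\<dots> \<longleftrightarrow> g \<circ> k \<circ> inv\<^bsub>deck_group D\<^esub> g \<in> K'"
        using K'_iff[OF deck_comp[OF D deck_comp[OF D g(1) k] inv(3)[OF g(1)]]] by simp
      finally show ?thesis .
    qed
    have "K' = {g \<circ> k \<circ> inv\<^bsub>deck_group D\<^esub> g | k. k \<in> K}"
    proof (intro equalityI subsetI)
      fix k' assume k': "k' \<in> K'"
      have "inv\<^bsub>deck_group D\<^esub> g \<circ> k' \<circ> g \<in> D"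
        using subsetD[OF sub(2) k'] g(1) inv(3)[OF g(1)] by (intro deck_comp[OF D])
      moreover have eq: "g \<circ> (inv\<^bsub>deck_group D\<^esub> g \<circ> k' \<circ> g) \<circ> inv\<^bsub>deck_group D\<^esub> g = k'"
        by (intro ext) (simp add: inv'[OF g(1)])
      ultimately have "inv\<^bsub>deck_group D\<^esub> g \<circ> k' \<circ> g \<in> K"
        using K_conj[of "inv\<^bsub>deck_group D\<^esub> g \<circ> k' \<circ> g"] k' by simp
      then show "k' \<in> {g \<circ> k \<circ> inv\<^bsub>deck_group D\<^esub> g | k. k \<in> K}"
        using eq by (intro CollectI exI[of _ "inv\<^bsub>deck_group D\<^esub> g \<circ> k' \<circ> g"]) simp
    next
      fix k' assume "k' \<in> {g \<circ> k \<circ> inv\<^bsub>deck_group D\<^esub> g | k. k \<in> K}"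
      then show "k' \<in> K'"
        using K_conj sub(1) by blast
    qed
    then show "(K, K') \<in> subgroup_conj (deck_group D)"
      using g(1) in_subgroup_conj_deck_iff[OF D] by blast
  }
  {
    assume "(K, K') \<in> subgroup_conj (deck_group D)"
    then obtain g where g: "g \<in> D" and K'g: "K' = {g \<circ> k \<circ> inv\<^bsub>deck_group D\<^esub> g | k. k \<in> K}"
      using in_subgroup_conj_deck_iff[OF D] by blast
    have "homeomorphic_map euclidean euclidean g"
      unfolding homeomorphic_map_maps homeomorphic_maps_def
      using deck_continuous[OF D] g inv(3)[OF g] inv'[OF g]
      by (intro exI[of _ "inv\<^bsub>deck_group D\<^esub> g"]) auto
    then have "quotient_map euclidean N' (f' \<circ> g)"
      using quotient_map_compose[OF _ fq(2)] homeomorphic_map_def by blast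
    moreover have "f v = f w \<longleftrightarrow> (f' \<circ> g) v = (f' \<circ> g) w" for v w
    proof -
      have "(f' \<circ> g) v = (f' \<circ> g) w \<longleftrightarrow> (\<exists>k\<in>K. g w = (g \<circ> k \<circ> inv\<^bsub>deck_group D\<^esub> g) (g v))"
        unfolding comp_apply[of f' g] ker(2) K'g by blast
      also have "\<dots> \<longleftrightarrow> (\<exists>k\<in>K. g w = g (k v))"
        by (simp only: comp_apply inv'[OF g])
      also have "\<dots> \<longleftrightarrow> (\<exists>k\<in>K. w = k v)"
        using inv'(2)[OF g] by (metis (no_types))
      finally show ?thesis by (simp add: ker(1))
    qed
    ultimately obtain \<eta> where \<eta>: "homeomorphic_map N N' \<eta>" "\<And>v. \<eta> (f v) = f' (g v)"
      using quotient_map_same_kernel[OF fq(1), of N' "f' \<circ> g"] by (metis (no_types) UNIV_I comp_apply topspace_euclidean)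
    have "?q (g v) = ?q v" for v
      using orbit_map_apply[OF D g] .
    then have "p x = p' (\<eta> x)" if "x \<in> topspace N" for x
      using that \<eta>(2) unfolding N(1) by (metis pf imageE)
    then show "((N, p), (N', p')) \<in> covering_equiv"
      using \<eta>(1) by (auto simp: covering_equiv_def)
  }
qed

text \<open>Let \<open>\<phi>\<close> and \<open>\<psi>\<close> lift the homeomorphism and its
  inverse. Their composites lift identity maps, hence are deck transformations; so
  \<open>\<phi>\<close> is bijective, and conjugation by it is the isomorphism.\<close>

lemma homeomorphic_orbit_spaces_iso:
  fixes K E :: "(R3 \<Rightarrow> R3) set"
  assumes K: "deck K" and E: "deck E" and h: "orbit_space K homeomorphic_space orbit_space E"
  shows "deck_group K \<cong> deck_group E"
proof -
  obtain h h' where hh: "homeomorphic_maps (orbit_space K) (orbit_space E) h h'"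
    using h by (auto simp: homeomorphic_space_def)
  then have hc: "continuous_map (orbit_space K) (orbit_space E) h"
      "continuous_map (orbit_space E) (orbit_space K) h'"
    by (auto simp: homeomorphic_maps_def)
  have inv: "h' (h (orbit_map K v)) = orbit_map K v" "h (h' (orbit_map E v)) = orbit_map E v" for v
  proof -
    have *: "\<forall>x\<in>topspace (orbit_space K). h' (h x) = x" "\<forall>x\<in>topspace (orbit_space E). h (h' x) = x"
      using hh by (simp_all add: homeomorphic_maps_def)
    show "h' (h (orbit_map K v)) = orbit_map K v"
      by (rule bspec[OF *(1) orbit_map_in_topspace[OF K]])
    show "h (h' (orbit_map E v)) = orbit_map E v"
      by (rule bspec[OF *(2) orbit_map_in_topspace[OF E]])
  qed
  \<comment> \<open>The orbit map is itself a covering: the case of the trivial subgroup.\<close>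
  have cov: "covering_map euclidean (orbit_space D) (orbit_map D)" if D: "deck D" for D :: "(R3 \<Rightarrow> R3) set"
  proof (rule uniformizes_covering_map[OF D])
    show "deck {id :: R3 \<Rightarrow> R3}"
      unfolding deck_def by (simp add: exI[of _ 1])
    show "{id} \<subseteq> D"
      using deck_id[OF D] by simp
    show "uniformizes id {id} D euclidean (orbit_map D)"
      using homeomorphic_map_id[of "euclidean :: R3 topology" euclidean]
      by (simp add: uniformizes_def homeomorphic_map_def id_def eq_commute)
  qed
  have lift: "\<exists>f. continuous_map euclidean euclidean f \<and> (\<forall>v. orbit_map D (f v) = h (orbit_map C v))"
    if D: "deck D" and C: "deck C" and h: "continuous_map (orbit_space C) (orbit_space D) h"
    for C D :: "(R3 \<Rightarrow> R3) set" and h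
  proof -
    have c: "continuous_map euclidean (orbit_space D) (h \<circ> orbit_map C)"
      using continuous_map_compose[OF continuous_map_orbit_map[OF C] h] .
    have "(h \<circ> orbit_map C) 0 \<in> range (orbit_map D)"
      using subsetD[OF continuous_map_image_subset_topspace[OF h] imageI[OF orbit_map_in_topspace[OF C]]]
      unfolding topspace_orbit_space_image[OF D] comp_apply .
    then obtain x where "orbit_map D x = (h \<circ> orbit_map C) 0"
      by (elim imageE) simp
    then show ?thesis
      using covering_map_lift_R3[OF cov[OF D] c, of x] unfolding comp_apply by simp
  qed
  obtain \<phi> where \<phi>: "continuous_map euclidean euclidean \<phi>" "\<And>v. orbit_map E (\<phi> v) = h (orbit_map K v)"
    using lift[OF E K hc(1)] by blast
  obtain \<psi> where \<psi>: "continuous_map euclidean euclidean \<psi>" "\<And>v. orbit_map K (\<psi> v) = h' (orbit_map E v)"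
    using lift[OF K E hc(2)] by blast
  have deckcont: "continuous_map euclidean euclidean g" if "g \<in> D" "deck D" for g and D :: "(R3 \<Rightarrow> R3) set"
    using deck_continuous that by auto
  have self: "f \<in> D" if D: "deck D" and f: "continuous_map euclidean euclidean f"
      "\<And>v. orbit_map D (f v) = orbit_map D v" for f and D :: "(R3 \<Rightarrow> R3) set"
  proof -
    obtain g where g: "g \<in> D" "f 0 = g 0"
      using f(2)[of 0] orbit_map_eq_iff[OF D] by metis
    have "orbit_map D (g v) = orbit_map D v" for v
      by (rule orbit_map_apply[OF D g(1)])
    then have "f = g"
      using covering_map_lift_unique_R3[OF cov[OF D] f(1) deckcont[OF g(1) D], of 0] f(2) g(2) by simp
    then show ?thesis using g by simp
  qed
  have "(\<lambda>v. \<psi> (\<phi> v)) \<in> K"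
    using self[OF K, of "\<lambda>v. \<psi> (\<phi> v)"] continuous_map_compose[OF \<phi>(1) \<psi>(1)]
    by (simp add: comp_def \<psi>(2) \<phi>(2) inv)
  then have "inj \<phi>"
    using deck_inverse_apply[OF K] by (metis (no_types, lifting) injI)
  moreover have "(\<lambda>v. \<phi> (\<psi> v)) \<in> E"
    using self[OF E, of "\<lambda>v. \<phi> (\<psi> v)"] continuous_map_compose[OF \<psi>(1) \<phi>(1)]
    by (simp add: comp_def \<psi>(2) \<phi>(2) inv)
  then have "surj \<phi>"
    using deck_inverse_apply[OF E] by (metis surjI)
  moreover define \<iota> where "\<iota> = inv_into UNIV \<phi>"
  ultimately have \<phi>inv: "\<iota> (\<phi> v) = v" "\<phi> (\<iota> v) = v" for v
    by (simp_all add: surj_f_inv_f)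
  have push: "\<exists>e\<in>E. \<forall>v. \<phi> (g v) = e (\<phi> v)" if g: "g \<in> K" for g
  proof -
    have qg: "orbit_map E (\<phi> (g v)) = orbit_map E (\<phi> v)" for v
      by (simp add: \<phi>(2) orbit_map_apply[OF K g])
    then obtain e where e: "e \<in> E" "\<phi> (g 0) = e (\<phi> 0)"
      using orbit_map_eq_iff[OF E] by metis
    have "orbit_map E (e v) = orbit_map E v" for v
      by (rule orbit_map_apply[OF E e(1)])
    then have "\<phi> \<circ> g = e \<circ> \<phi>"
      using covering_map_lift_unique_R3[OF cov[OF E] continuous_map_compose[OF deckcont[OF g K] \<phi>(1)]
          continuous_map_compose[OF \<phi>(1) deckcont[OF e(1) E]], of 0] qg e(2) by simp
    then show ?thesis
      using e(1) by (metis comp_apply)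
  qed
  have pull: "\<exists>g\<in>K. \<forall>v. \<phi> (g v) = e (\<phi> v)" if e: "e \<in> E" for e
  proof -
    have qe: "orbit_map E (e v) = orbit_map E v" for v
      by (rule orbit_map_apply[OF E e])
    have "h (orbit_map K (\<iota> (e (\<phi> 0)))) = h (orbit_map K 0)"
      by (simp add: \<phi>(2)[symmetric] \<phi>inv qe)
    then have "orbit_map K 0 = orbit_map K (\<iota> (e (\<phi> 0)))"
      by (metis inv(1))
    then obtain g where g: "g \<in> K" "\<iota> (e (\<phi> 0)) = g 0"
      using orbit_map_eq_iff[OF K] by blast
    have g0: "\<phi> (g 0) = e (\<phi> 0)"
      using g(2) by (metis \<phi>inv(2))
    have "orbit_map E (\<phi> (g v)) = orbit_map E (\<phi> v)" for v
      by (simp add: \<phi>(2) orbit_map_apply[OF K g(1)])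
    then have "\<phi> \<circ> g = e \<circ> \<phi>"
      using covering_map_lift_unique_R3[OF cov[OF E] continuous_map_compose[OF deckcont[OF g(1) K] \<phi>(1)]
          continuous_map_compose[OF \<phi>(1) deckcont[OF e E]], of 0] qe g0 by simp
    then show ?thesis
      using g(1) by (metis comp_apply)
  qed
  define \<theta> where "\<theta> g = (\<lambda>v. \<phi> (g (\<iota> v)))" for g
  have "\<theta> \<in> iso (deck_group K) (deck_group E)"
    unfolding iso_def hom_def bij_betw_def
  proof (intro CollectI conjI)
    show "\<theta> \<in> carrier (deck_group K) \<rightarrow> carrier (deck_group E)"
    proof
      fix g assume "g \<in> carrier (deck_group K)"
      then obtain e where "e \<in> E" "\<And>v. \<phi> (g v) = e (\<phi> v)"
        using push[of g] unfolding deck_group_simps by blast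
      then have "\<theta> g = e" by (intro ext) (simp add: \<theta>_def \<phi>inv)
      then show "\<theta> g \<in> carrier (deck_group E)" using \<open>e \<in> E\<close> by simp
    qed
    show "\<forall>x\<in>carrier (deck_group K). \<forall>y\<in>carrier (deck_group K).
       \<theta> (x \<otimes>\<^bsub>deck_group K\<^esub> y) = \<theta> x \<otimes>\<^bsub>deck_group E\<^esub> \<theta> y"
      by (intro ballI ext) (simp add: \<theta>_def \<phi>inv)
    show "inj_on \<theta> (carrier (deck_group K))"
    proof (rule inj_onI)
      fix x y assume "\<theta> x = \<theta> y"
      then have "\<theta> x (\<phi> v) = \<theta> y (\<phi> v)" for v by simp
      then have "\<phi> (x v) = \<phi> (y v)" for v by (simp add: \<theta>_def \<phi>inv)
      then have "x v = y v" for v by (metis \<phi>inv(1))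
      then show "x = y" by blast
    qed
    show "\<theta> ` carrier (deck_group K) = carrier (deck_group E)"
    proof
      show "carrier (deck_group E) \<subseteq> \<theta> ` carrier (deck_group K)"
      proof
        fix e assume "e \<in> carrier (deck_group E)"
        then obtain g where "g \<in> K" "\<And>v. \<phi> (g v) = e (\<phi> v)"
          using pull[of e] unfolding deck_group_simps by blast
        then have "\<theta> g = e" by (intro ext) (simp add: \<theta>_def \<phi>inv)
        then show "e \<in> \<theta> ` carrier (deck_group K)" using \<open>g \<in> K\<close> by auto
      qed
    next
      show "\<theta> ` carrier (deck_group K) \<subseteq> carrier (deck_group E)"
        using \<open>\<theta> \<in> carrier (deck_group K) \<rightarrow> carrier (deck_group E)\<close> by blast
    qed
  qed
  then show ?thesis
    by (auto simp: is_iso_def)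
qed

section \<open>Conjugacy classes of subgroups and equivalence classes of coverings\<close>

text \<open>Conjugacy is declared between arbitrary sets but is an equivalence only among subsets of
  the carrier, outside of which multiplication is unconstrained.\<close>

lemma subgroup_conj_class_eq_iff:
  assumes G: "group G" and K: "K \<subseteq> carrier G" and K': "K' \<subseteq> carrier G"
  shows "subgroup_conj G `` {K} = subgroup_conj G `` {K'} \<longleftrightarrow> (K, K') \<in> subgroup_conj G"
proof -
  interpret group G by (rule G)
  have refl: "(A, A) \<in> subgroup_conj G" if A: "A \<subseteq> carrier G" for A
  proof -
    have "A = (\<one>\<^bsub>G\<^esub> <#\<^bsub>G\<^esub> A) #>\<^bsub>G\<^esub> inv\<^bsub>G\<^esub> \<one>\<^bsub>G\<^esub>"
      using A by (simp add: lcos_mult_one)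
    then show ?thesis unfolding subgroup_conj_def by blast
  qed
  have trans: "(A, C) \<in> subgroup_conj G"
    if A: "A \<subseteq> carrier G" and AB: "(A, B) \<in> subgroup_conj G" and BC: "(B, C) \<in> subgroup_conj G" for A B C
  proof -
    obtain g where g: "g \<in> carrier G" "B = (g <#\<^bsub>G\<^esub> A) #>\<^bsub>G\<^esub> inv\<^bsub>G\<^esub> g"
      using AB by (auto simp: subgroup_conj_def)
    obtain h where h: "h \<in> carrier G" "C = (h <#\<^bsub>G\<^esub> B) #>\<^bsub>G\<^esub> inv\<^bsub>G\<^esub> h"
      using BC by (auto simp: subgroup_conj_def)
    have gA: "g <#\<^bsub>G\<^esub> A \<subseteq> carrier G"
      using A g(1) by (simp add: l_coset_subset_G)
    have "C = ((h <#\<^bsub>G\<^esub> (g <#\<^bsub>G\<^esub> A)) #>\<^bsub>G\<^esub> inv\<^bsub>G\<^esub> g) #>\<^bsub>G\<^esub> inv\<^bsub>G\<^esub> h"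
      using g h gA by (simp add: coset_assoc)
    also have "\<dots> = ((h \<otimes>\<^bsub>G\<^esub> g) <#\<^bsub>G\<^esub> A) #>\<^bsub>G\<^esub> inv\<^bsub>G\<^esub> (h \<otimes>\<^bsub>G\<^esub> g)"
      using g h A gA by (simp add: lcos_m_assoc coset_mult_assoc l_coset_subset_G inv_mult_group)
    finally show ?thesis
      using g(1) h(1) unfolding subgroup_conj_def by blast
  qed
  have sym: "(B, A) \<in> subgroup_conj G" if A: "A \<subseteq> carrier G" and AB: "(A, B) \<in> subgroup_conj G" for A B
  proof -
    obtain g where g: "g \<in> carrier G" "B = (g <#\<^bsub>G\<^esub> A) #>\<^bsub>G\<^esub> inv\<^bsub>G\<^esub> g"
      using AB by (auto simp: subgroup_conj_def)
    have gA: "g <#\<^bsub>G\<^esub> A \<subseteq> carrier G"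
      using A g(1) by (simp add: l_coset_subset_G)
    have "A = (inv\<^bsub>G\<^esub> g <#\<^bsub>G\<^esub> B) #>\<^bsub>G\<^esub> inv\<^bsub>G\<^esub> (inv\<^bsub>G\<^esub> g)"
      using g gA A by (simp add: coset_assoc coset_mult_assoc lcos_m_assoc lcos_mult_one l_coset_subset_G)
    then show ?thesis
      using inv_closed[OF g(1)] unfolding subgroup_conj_def by blast
  qed
  have sub: "B \<subseteq> carrier G" if "A \<subseteq> carrier G" "(A, B) \<in> subgroup_conj G" for A B
    using that r_coset_subset_G l_coset_subset_G inv_closed unfolding subgroup_conj_def by blast
  show ?thesis
  proof
    assume "subgroup_conj G `` {K} = subgroup_conj G `` {K'}"
    then show "(K, K') \<in> subgroup_conj G"
      using refl[OF K'] by blast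
  next
    assume *: "(K, K') \<in> subgroup_conj G"
    show "subgroup_conj G `` {K} = subgroup_conj G `` {K'}"
      using trans[OF K *] trans[OF K' sym[OF K *]] by blast
  qed
qed

lemma subgroup_classes_image:
  "subgroup_classes H G n = (\<lambda>K. subgroup_conj G `` {K}) `
     {K. subgroup K G \<and> finite (rcosets\<^bsub>G\<^esub> K) \<and> card (rcosets\<^bsub>G\<^esub> K) = n \<and> (G\<lparr>carrier := K\<rparr>) \<cong> H}"
  unfolding subgroup_classes_def quotient_def by blast

lemma subgroup_classes_iso_left:
  assumes "group H" "H \<cong> H'"
  shows "subgroup_classes H G n = subgroup_classes H' G n"
proof -
  have "(G\<lparr>carrier := K\<rparr>) \<cong> H \<longleftrightarrow> (G\<lparr>carrier := K\<rparr>) \<cong> H'" for K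
    using iso_trans[OF _ assms(2), of "G\<lparr>carrier := K\<rparr>"]
      iso_trans[OF _ group.iso_sym[OF assms], of "G\<lparr>carrier := K\<rparr>"] by argo
  then show ?thesis
    unfolding subgroup_classes_image by simp
qed

lemma iso_subgroup_image:
  assumes G: "group G" and G': "group G'" and \<phi>: "\<phi> \<in> iso G G'" and K: "subgroup K G"
  shows "subgroup (\<phi> ` K) G'"
    and "card (rcosets\<^bsub>G'\<^esub> (\<phi> ` K)) = card (rcosets\<^bsub>G\<^esub> K)"
    and "finite (rcosets\<^bsub>G'\<^esub> (\<phi> ` K)) \<longleftrightarrow> finite (rcosets\<^bsub>G\<^esub> K)"
    and "(G\<lparr>carrier := K\<rparr>) \<cong> (G'\<lparr>carrier := \<phi> ` K\<rparr>)"
proof -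
  interpret group_hom G G' \<phi>
    using G G' \<phi> by (simp add: group_hom_def group_hom_axioms_def iso_imp_homomorphism)
  have inj: "inj_on \<phi> (carrier G)" and surj: "\<phi> ` carrier G = carrier G'"
    using \<phi> by (auto simp: iso_def bij_betw_def)
  have KG: "K \<subseteq> carrier G"
    by (rule subgroup.subset[OF K])
  show "subgroup (\<phi> ` K) G'"
    by (rule subgroup_img_is_subgroup[OF K])
  have rc: "\<phi> ` (K #>\<^bsub>G\<^esub> x) = (\<phi> ` K) #>\<^bsub>G'\<^esub> \<phi> x" if "x \<in> carrier G" for x
    using that KG by (force simp: r_coset_def)
  have "rcosets\<^bsub>G'\<^esub> (\<phi> ` K) = (\<lambda>X. \<phi> ` X) ` (rcosets\<^bsub>G\<^esub> K)"
    unfolding RCOSETS_def surj[symmetric] using rc by (auto simp: image_iff)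
  moreover have "inj_on (\<lambda>X. \<phi> ` X) (rcosets\<^bsub>G\<^esub> K)"
  proof (rule inj_onI)
    fix X Y assume "X \<in> rcosets\<^bsub>G\<^esub> K" "Y \<in> rcosets\<^bsub>G\<^esub> K" "\<phi> ` X = \<phi> ` Y"
    moreover have "X \<subseteq> carrier G" "Y \<subseteq> carrier G"
      using calculation(1,2) subgroup.rcosets_carrier[OF K G] by blast+
    ultimately show "X = Y"
      using inj_on_image_eq_iff[OF inj] by blast
  qed
  ultimately show "card (rcosets\<^bsub>G'\<^esub> (\<phi> ` K)) = card (rcosets\<^bsub>G\<^esub> K)"
    and "finite (rcosets\<^bsub>G'\<^esub> (\<phi> ` K)) \<longleftrightarrow> finite (rcosets\<^bsub>G\<^esub> K)"
    by (simp_all add: card_image finite_image_iff)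
  have "\<phi> \<in> iso (G\<lparr>carrier := K\<rparr>) (G'\<lparr>carrier := \<phi> ` K\<rparr>)"
    using KG inj by (auto simp: iso_def hom_def bij_betw_def subsetD intro: inj_on_subset)
  then show "(G\<lparr>carrier := K\<rparr>) \<cong> (G'\<lparr>carrier := \<phi> ` K\<rparr>)"
    by (auto simp: is_iso_def)
qed

lemma subgroup_conj_iso_image:
  assumes G: "group G" and G': "group G'" and \<phi>: "\<phi> \<in> iso G G'"
    and K: "K \<subseteq> carrier G" "K' \<subseteq> carrier G"
  shows "(\<phi> ` K, \<phi> ` K') \<in> subgroup_conj G' \<longleftrightarrow> (K, K') \<in> subgroup_conj G"
proof -
  interpret group_hom G G' \<phi>
    using G G' \<phi> by (simp add: group_hom_def group_hom_axioms_def iso_imp_homomorphism)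
  have inj: "inj_on \<phi> (carrier G)" and surj: "\<phi> ` carrier G = carrier G'"
    using \<phi> by (auto simp: iso_def bij_betw_def)
  have eq: "(\<phi> g <#\<^bsub>G'\<^esub> \<phi> ` K) #>\<^bsub>G'\<^esub> inv\<^bsub>G'\<^esub> (\<phi> g) = \<phi> ` ((g <#\<^bsub>G\<^esub> K) #>\<^bsub>G\<^esub> inv\<^bsub>G\<^esub> g)"
    if g: "g \<in> carrier G" for g
  proof -
    have "\<phi> g \<otimes>\<^bsub>G'\<^esub> \<phi> k \<otimes>\<^bsub>G'\<^esub> inv\<^bsub>G'\<^esub> (\<phi> g) = \<phi> (g \<otimes>\<^bsub>G\<^esub> k \<otimes>\<^bsub>G\<^esub> inv\<^bsub>G\<^esub> g)" if "k \<in> K" for k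
      using that g K(1) by (auto simp: subsetD)
    then show ?thesis
      by (simp add: l_coset_def r_coset_def image_UN UNION_singleton_eq_range image_image)
  qed
  have sub: "(g <#\<^bsub>G\<^esub> K) #>\<^bsub>G\<^esub> inv\<^bsub>G\<^esub> g \<subseteq> carrier G" if "g \<in> carrier G" for g
    using that K(1) by (simp add: G.r_coset_subset_G G.l_coset_subset_G)
  have "(\<phi> ` K, \<phi> ` K') \<in> subgroup_conj G' \<longleftrightarrow>
      (\<exists>g\<in>carrier G. \<phi> ` K' = (\<phi> g <#\<^bsub>G'\<^esub> \<phi> ` K) #>\<^bsub>G'\<^esub> inv\<^bsub>G'\<^esub> (\<phi> g))"
    unfolding subgroup_conj_def surj[symmetric] by blast
  also have "\<dots> \<longleftrightarrow> (\<exists>g\<in>carrier G. K' = (g <#\<^bsub>G\<^esub> K) #>\<^bsub>G\<^esub> inv\<^bsub>G\<^esub> g)"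
    using inj_on_image_eq_iff[OF inj K(2) sub] eq by (intro bex_cong) auto
  finally show ?thesis
    by (simp add: subgroup_conj_def)
qed

text \<open>Index, isomorphism type and conjugacy are all carried along by an isomorphism of the
  ambient groups. This links the presented group, the group of triples and the group of
  isometries.\<close>

lemma subgroup_classes_iso_right:
  assumes G: "group G" and G': "group G'" and iso: "G \<cong> G'" and H: "group H"
  shows "card (subgroup_classes H G n) = card (subgroup_classes H G' n)"
    and "finite (subgroup_classes H G n) \<longleftrightarrow> finite (subgroup_classes H G' n)"
proof -
  obtain \<phi> where \<phi>: "\<phi> \<in> iso G G'"
    using iso by (auto simp: is_iso_def)
  define \<psi> where "\<psi> = inv_into (carrier G) \<phi>"
  have \<psi>: "\<psi> \<in> iso G' G"
    unfolding \<psi>_def by (rule group.iso_set_sym[OF G \<phi>])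
  define A where "A = {K. subgroup K G \<and> finite (rcosets\<^bsub>G\<^esub> K) \<and>
    card (rcosets\<^bsub>G\<^esub> K) = n \<and> (G\<lparr>carrier := K\<rparr>) \<cong> H}"
  define A' where "A' = {K. subgroup K G' \<and> finite (rcosets\<^bsub>G'\<^esub> K) \<and>
    card (rcosets\<^bsub>G'\<^esub> K) = n \<and> (G'\<lparr>carrier := K\<rparr>) \<cong> H}"
  have grp: "group (G\<lparr>carrier := K\<rparr>)" if "subgroup K G" for K
    using subgroup.subgroup_is_group[OF that G] .
  have grp': "group (G'\<lparr>carrier := K\<rparr>)" if "subgroup K G'" for K
    using subgroup.subgroup_is_group[OF that G'] .
  have im: "\<phi> ` K \<in> A'" if "K \<in> A" for K
    using that iso_subgroup_image[OF G G' \<phi>, of K] group.iso_sym[OF grp, of K] iso_trans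
    unfolding A_def A'_def by blast
  have im': "\<psi> ` K \<in> A" if "K \<in> A'" for K
    using that iso_subgroup_image[OF G' G \<psi>, of K] group.iso_sym[OF grp', of K] iso_trans
    unfolding A_def A'_def by blast
  have inv_im: "\<phi> ` \<psi> ` K = K" if "K \<in> A'" for K
  proof -
    have "K \<subseteq> \<phi> ` carrier G"
      using that \<phi> subgroup.subset by (force simp: A'_def iso_def bij_betw_def)
    then show ?thesis
      unfolding \<psi>_def by (rule image_inv_into_cancel[OF HOL.refl])
  qed
  have "A' = (\<lambda>K. \<phi> ` K) ` A"
    using im im' inv_im by blast
  then have cl': "subgroup_classes H G' n = (\<lambda>K. subgroup_conj G' `` {\<phi> ` K}) ` A"
    unfolding subgroup_classes_image A'_def[symmetric] by (simp add: image_image)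
  have cl: "subgroup_classes H G n = (\<lambda>K. subgroup_conj G `` {K}) ` A"
    unfolding subgroup_classes_image A_def ..
  have "subgroup_conj G `` {K} = subgroup_conj G `` {L} \<longleftrightarrow>
      subgroup_conj G' `` {\<phi> ` K} = subgroup_conj G' `` {\<phi> ` L}" if "K \<in> A" "L \<in> A" for K L
  proof -
    have "K \<subseteq> carrier G" "L \<subseteq> carrier G"
      using that subgroup.subset by (auto simp: A_def)
    moreover then have "\<phi> ` K \<subseteq> carrier G'" "\<phi> ` L \<subseteq> carrier G'"
      using \<phi> by (auto simp: iso_def bij_betw_def)
    ultimately show ?thesis
      using subgroup_conj_class_eq_iff[OF G] subgroup_conj_class_eq_iff[OF G']
        subgroup_conj_iso_image[OF G G' \<phi>] by simp
  qed
  then show "card (subgroup_classes H G n) = card (subgroup_classes H G' n)"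
    and "finite (subgroup_classes H G n) \<longleftrightarrow> finite (subgroup_classes H G' n)"
    unfolding cl cl' by (rule card_image_same_kernel; blast)+
qed

lemma covering_equiv_class_eq_iff:
  fixes x y :: "'a topology \<times> ('a \<Rightarrow> 'b)"
  shows "covering_equiv `` {x} = covering_equiv `` {y} \<longleftrightarrow> (x, y) \<in> covering_equiv"
proof -
  have refl: "((X, p), (X, p)) \<in> covering_equiv" for X and p :: "'a \<Rightarrow> 'b"
    unfolding covering_equiv_def using homeomorphic_map_id[of X X] by (auto simp: id_def)
  have sym: "((Y, q), (X, p)) \<in> covering_equiv" if xy: "((X, p), (Y, q)) \<in> covering_equiv"
    for X Y and p q :: "'a \<Rightarrow> 'b"
  proof -
    obtain \<eta> \<theta> where \<eta>: "homeomorphic_maps X Y \<eta> \<theta>" "\<forall>x\<in>topspace X. p x = q (\<eta> x)"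
      using xy by (auto simp: covering_equiv_def homeomorphic_map_maps)
    then have "homeomorphic_map Y X \<theta>"
      using homeomorphic_map_maps homeomorphic_maps_sym by blast
    moreover have "q y = p (\<theta> y)" if "y \<in> topspace Y" for y
    proof -
      have "\<theta> y \<in> topspace X" "\<eta> (\<theta> y) = y"
        using \<eta>(1) that continuous_map_image_subset_topspace[of Y X \<theta>]
        by (auto simp: homeomorphic_maps_def)
      then show ?thesis using \<eta>(2) by metis
    qed
    ultimately show ?thesis by (auto simp: covering_equiv_def)
  qed
  have trans: "((X, p), (Z, r)) \<in> covering_equiv"
    if xy: "((X, p), (Y, q)) \<in> covering_equiv" and yz: "((Y, q), (Z, r)) \<in> covering_equiv"
    for X Y Z and p q r :: "'a \<Rightarrow> 'b"
  proof -
    obtain \<eta> where \<eta>: "homeomorphic_map X Y \<eta>" "\<forall>x\<in>topspace X. p x = q (\<eta> x)"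
      using xy by (auto simp: covering_equiv_def)
    obtain \<theta> where \<theta>: "homeomorphic_map Y Z \<theta>" "\<forall>x\<in>topspace Y. q x = r (\<theta> x)"
      using yz by (auto simp: covering_equiv_def)
    have "\<eta> x \<in> topspace Y" if "x \<in> topspace X" for x
      using \<eta>(1) that homeomorphic_imp_surjective_map by blast
    then have "\<forall>x\<in>topspace X. p x = r ((\<theta> \<circ> \<eta>) x)"
      using \<eta>(2) \<theta>(2) by simp
    then show ?thesis
      using homeomorphic_map_compose[OF \<eta>(1) \<theta>(1)] by (auto simp: covering_equiv_def)
  qed
  have r1: "(x, x) \<in> covering_equiv" for x :: "'a topology \<times> ('a \<Rightarrow> 'b)"
    using refl by (cases x) simp
  have r2: "(y, x) \<in> covering_equiv" if "(x, y) \<in> covering_equiv" for x y :: "'a topology \<times> ('a \<Rightarrow> 'b)"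
    using that sym by (cases x, cases y) simp
  have r3: "(x, z) \<in> covering_equiv" if "(x, y) \<in> covering_equiv" "(y, z) \<in> covering_equiv"
    for x y z :: "'a topology \<times> ('a \<Rightarrow> 'b)"
    using that trans by (cases x, cases y, cases z) blast
  have "equiv UNIV (covering_equiv :: (('a topology \<times> ('a \<Rightarrow> 'b)) \<times> ('a topology \<times> ('a \<Rightarrow> 'b))) set)"
  proof (rule equivI)
    show "refl (covering_equiv :: (('a topology \<times> ('a \<Rightarrow> 'b)) \<times> _) set)"
      by (rule reflI) (rule r1)
    show "sym (covering_equiv :: (('a topology \<times> ('a \<Rightarrow> 'b)) \<times> _) set)"
      by (rule symI) (rule r2)
    show "trans (covering_equiv :: (('a topology \<times> ('a \<Rightarrow> 'b)) \<times> _) set)"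
      by (rule transI) (rule r3)
  qed simp
  then show ?thesis
    by (rule eq_equiv_class_iff) simp_all
qed

text \<open>\<open>rigid\<close> is the converse of \<open>homeomorphic_orbit_spaces_iso\<close>. It
  stays a hypothesis here because it is later obtained from the classification of the subgroups of
  one particular group.\<close>

theorem covering_classes_deck:
  fixes D E :: "(R3 \<Rightarrow> R3) set" and e :: "R3 \<Rightarrow> 'a"
  assumes D: "deck D" and E: "deck E" and n: "n > 0" and e: "inj e"
    and rigid: "\<And>K. subgroup K (deck_group D) \<Longrightarrow> finite (rcosets\<^bsub>deck_group D\<^esub> K) \<Longrightarrow>
      card (rcosets\<^bsub>deck_group D\<^esub> K) = n \<Longrightarrow> deck_group K \<cong> deck_group E \<Longrightarrow>
      orbit_space K homeomorphic_space orbit_space E"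
  shows "card (covering_classes n (orbit_space E) (orbit_space D) :: ('a topology \<times> ('a \<Rightarrow> R3 set)) set set)
      = card (subgroup_classes (deck_group E) (deck_group D) n)" (is ?thesis1)
    and "finite (covering_classes n (orbit_space E) (orbit_space D) :: ('a topology \<times> ('a \<Rightarrow> R3 set)) set set)
      \<longleftrightarrow> finite (subgroup_classes (deck_group E) (deck_group D) n)" (is ?thesis2)
proof -
  let ?G = "deck_group D"
  have G: "group ?G" by (rule group_deck_group[OF D])
  define A :: "('a topology \<times> ('a \<Rightarrow> R3 set)) set"
    where "A = {(X, p). fold_covering n X (orbit_space D) p \<and> X homeomorphic_space orbit_space E}"
  define B where "B = {K. subgroup K ?G \<and> finite (rcosets\<^bsub>?G\<^esub> K) \<and> card (rcosets\<^bsub>?G\<^esub> K) = n \<and>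
    (?G\<lparr>carrier := K\<rparr>) \<cong> deck_group E}"
  have "\<exists>K. subgroup K ?G \<and> (\<exists>f. uniformizes f K D (fst x) (snd x))" if "x \<in> A" for x
    using that fold_covering_uniformizes[OF D _ n, of "fst x" "snd x"] unfolding A_def by (metis (no_types, lifting) case_prod_unfold mem_Collect_eq)
  \<comment> \<open>The subgroup belonging to a covering is unique only up to conjugacy;
    \<open>\<kappa>\<close> fixes one choice for each covering.\<close>
  then obtain \<kappa> where \<kappa>: "\<And>x. x \<in> A \<Longrightarrow> subgroup (\<kappa> x) ?G"
    "\<And>x. x \<in> A \<Longrightarrow> \<exists>f. uniformizes f (\<kappa> x) D (fst x) (snd x)"
    by metis
  have equiv: "covering_equiv `` {x} = covering_equiv `` {y} \<longleftrightarrow>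
      subgroup_conj ?G `` {\<kappa> x} = subgroup_conj ?G `` {\<kappa> y}" if x: "x \<in> A" and y: "y \<in> A" for x y
  proof -
    obtain f where f: "uniformizes f (\<kappa> x) D (fst x) (snd x)"
      using \<kappa>(2)[OF x] by blast
    obtain g where g: "uniformizes g (\<kappa> y) D (fst y) (snd y)"
      using \<kappa>(2)[OF y] by blast
    have "(x, y) \<in> covering_equiv \<longleftrightarrow> (\<kappa> x, \<kappa> y) \<in> subgroup_conj ?G"
      using uniformizes_equiv_iff[OF D \<kappa>(1)[OF x] f \<kappa>(1)[OF y] g] by simp
    then show ?thesis
      using subgroup_conj_class_eq_iff[OF G subgroup.subset[OF \<kappa>(1)[OF x]] subgroup.subset[OF \<kappa>(1)[OF y]]]
      by (simp only: covering_equiv_class_eq_iff)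
  qed
  have \<kappa>B: "\<kappa> x \<in> B" if x: "x \<in> A" for x
  proof -
    obtain f where f: "uniformizes f (\<kappa> x) D (fst x) (snd x)"
      using \<kappa>(2)[OF x] by blast
    have fc: "fold_covering n (fst x) (orbit_space D) (snd x)" and hE: "fst x homeomorphic_space orbit_space E"
      using x by (auto simp: A_def)
    have dk: "deck (\<kappa> x)" "\<kappa> x \<subseteq> D"
      using subgroup_deck[OF D \<kappa>(1)[OF x]] by auto
    have "orbit_space (\<kappa> x) homeomorphic_space orbit_space E"
      using uniformizes_orbit_space[OF D dk f] hE homeomorphic_space_sym homeomorphic_space_trans by blast
    then have "deck_group (\<kappa> x) \<cong> deck_group E"
      by (rule homeomorphic_orbit_spaces_iso[OF dk(1) E])
    then show ?thesis
      using uniformizes_fold_covering_iff[OF D \<kappa>(1)[OF x] f, of n] fc \<kappa>(1)[OF x] by (simp add: B_def)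
  qed
  \<comment> \<open>\<open>K\<close> is realised by some covering. The subgroup that
    \<open>\<kappa>\<close> picks for it need not be \<open>K\<close>, but is conjugate to
    \<open>K\<close> because the covering is equivalent to itself.\<close>
  have surj: "\<exists>x\<in>A. subgroup_conj ?G `` {K} = subgroup_conj ?G `` {\<kappa> x}" if K: "K \<in> B" for K
  proof -
    have K': "subgroup K ?G" "finite (rcosets\<^bsub>?G\<^esub> K)" "card (rcosets\<^bsub>?G\<^esub> K) = n" "deck_group K \<cong> deck_group E"
      using K by (auto simp: B_def)
    have dk: "deck K" "K \<subseteq> D"
      using subgroup_deck[OF D K'(1)] by auto
    obtain N :: "'a topology" and p f where f: "uniformizes f K D N p"
      using uniformizes_exists[OF D K'(1) e] by blast
    have fc: "fold_covering n N (orbit_space D) p"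
      using uniformizes_fold_covering_iff[OF D K'(1) f] K'(2,3) by blast
    have "N homeomorphic_space orbit_space E"
      using uniformizes_orbit_space[OF D dk f] rigid[OF K'] homeomorphic_space_trans by blast
    then have x: "(N, p) \<in> A"
      using fc by (simp add: A_def)
    obtain g where g: "uniformizes g (\<kappa> (N, p)) D N p"
      using \<kappa>(2)[OF x] by auto
    have "((N, p), (N, p)) \<in> covering_equiv"
      using covering_equiv_class_eq_iff by blast
    then have "(K, \<kappa> (N, p)) \<in> subgroup_conj ?G"
      using uniformizes_equiv_iff[OF D K'(1) f \<kappa>(1)[OF x] g] by simp
    then show ?thesis
      using subgroup_conj_class_eq_iff[OF G subgroup.subset[OF K'(1)] subgroup.subset[OF \<kappa>(1)[OF x]]] x
      by blast
  qed
  have cov: "covering_classes n (orbit_space E) (orbit_space D) = (\<lambda>x. covering_equiv `` {x}) ` A"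
    unfolding covering_classes_def A_def[symmetric] quotient_def by blast
  have sub: "subgroup_classes (deck_group E) ?G n = (\<lambda>x. subgroup_conj ?G `` {\<kappa> x}) ` A"
  proof -
    have "(\<lambda>K. subgroup_conj ?G `` {K}) ` B = (\<lambda>x. subgroup_conj ?G `` {\<kappa> x}) ` A"
    proof
      show "(\<lambda>K. subgroup_conj ?G `` {K}) ` B \<subseteq> (\<lambda>x. subgroup_conj ?G `` {\<kappa> x}) ` A"
        using surj by (intro image_subsetI) (auto intro: rev_image_eqI)
      show "(\<lambda>x. subgroup_conj ?G `` {\<kappa> x}) ` A \<subseteq> (\<lambda>K. subgroup_conj ?G `` {K}) ` B"
        using \<kappa>B by (intro image_subsetI imageI)
    qed
    then show ?thesis
      unfolding subgroup_classes_image B_def .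
  qed
  show ?thesis1 ?thesis2
    unfolding cov sub by (rule card_image_same_kernel; rule equiv; assumption)+
qed

text \<open>A homeomorphism of the space that conjugates one deck group to the other descends to the
  quotients; this turns explicit charts into homeomorphisms of orbit spaces.\<close>

lemma homeomorphic_orbit_spaces_conj:
  fixes K E :: "('v::metric_space \<Rightarrow> 'v) set"
  assumes K: "deck K" and E: "deck E"
    and h: "homeomorphic_map (euclidean :: 'v topology) euclidean h"
    and EK: "\<And>e. e \<in> E \<Longrightarrow> \<exists>k\<in>K. \<forall>v. h (e v) = k (h v)"
    and KE: "\<And>k. k \<in> K \<Longrightarrow> \<exists>e\<in>E. \<forall>v. h (e v) = k (h v)"
  shows "orbit_space K homeomorphic_space orbit_space E"
proof -
  have inj: "h v = h w \<longleftrightarrow> v = w" for v w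
    using h by (auto simp: homeomorphic_map_def inj_on_def)
  have q: "quotient_map euclidean (orbit_space K) (orbit_map K \<circ> h)"
    using quotient_map_compose[OF _ quotient_map_orbit_space, of euclidean h K] h by (simp add: homeomorphic_map_def)
  have "orbit_map E v = orbit_map E w \<longleftrightarrow> (orbit_map K \<circ> h) v = (orbit_map K \<circ> h) w" for v w
    unfolding comp_apply orbit_map_eq_iff[OF K] orbit_map_eq_iff[OF E] using EK KE inj by metis
  then obtain \<eta> where "homeomorphic_map (orbit_space E) (orbit_space K) \<eta>"
    using quotient_map_same_kernel[OF quotient_map_orbit_space q] by metis
  then show ?thesis
    using homeomorphic_map_imp_homeomorphic_space homeomorphic_space_sym by blast
qed

section \<open>The amphicosm groups\<close>

text \<open>The triple \<open>(i, j, k)\<close> stands for \<open>b\<^sup>j c\<^sup>k a\<^sup>i\<close>, where \<open>a\<close> inverts \<open>b\<close> under conjugation and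
  takes \<open>c\<close> to \<open>b\<^sup>\<epsilon> c\<close>; \<open>\<epsilon> = 0\<close> gives the group of \<open>B1\<close> and \<open>\<epsilon> = 1\<close> that of \<open>B2\<close>.\<close>

definition amphi :: "int \<Rightarrow> (int \<times> int \<times> int) monoid" where
  "amphi \<epsilon> = \<lparr>carrier = UNIV,
     monoid.mult = (\<lambda>(i, j, k) (i', j', k'). (i + i', j + (if even i then j' else \<epsilon> * k' - j'), k + k')),
     one = (0, 0, 0)\<rparr>"

lemma amphi_simps [simp]:
  "carrier (amphi \<epsilon>) = UNIV" "\<one>\<^bsub>amphi \<epsilon>\<^esub> = (0, 0, 0)"
  "(i, j, k) \<otimes>\<^bsub>amphi \<epsilon>\<^esub> (i', j', k') = (i + i', j + (if even i then j' else \<epsilon> * k' - j'), k + k')"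
  by (simp_all add: amphi_def)

lemma group_amphi: "group (amphi \<epsilon>)"
proof (rule groupI)
  fix x y z assume "x \<in> carrier (amphi \<epsilon>)" "y \<in> carrier (amphi \<epsilon>)" "z \<in> carrier (amphi \<epsilon>)"
  obtain i j k i' j' k' i'' j'' k'' where "x = (i, j, k)" "y = (i', j', k')" "z = (i'', j'', k'')"
    by (cases x, cases y, cases z)
  then show "x \<otimes>\<^bsub>amphi \<epsilon>\<^esub> y \<otimes>\<^bsub>amphi \<epsilon>\<^esub> z = x \<otimes>\<^bsub>amphi \<epsilon>\<^esub> (y \<otimes>\<^bsub>amphi \<epsilon>\<^esub> z)"
    by (auto simp: algebra_simps)
next
  fix x assume "x \<in> carrier (amphi \<epsilon>)"
  obtain i j k where x: "x = (i, j, k)" by (cases x)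
  show "\<one>\<^bsub>amphi \<epsilon>\<^esub> \<otimes>\<^bsub>amphi \<epsilon>\<^esub> x = x"
    by (simp add: x)
  show "\<exists>y\<in>carrier (amphi \<epsilon>). y \<otimes>\<^bsub>amphi \<epsilon>\<^esub> x = \<one>\<^bsub>amphi \<epsilon>\<^esub>"
    by (intro bexI[of _ "(- i, if even i then - j else j - \<epsilon> * k, - k)"]) (auto simp: x)
qed simp_all

lemma inv_amphi [simp]:
  "inv\<^bsub>amphi \<epsilon>\<^esub> (i, j, k) = (- i, if even i then - j else j - \<epsilon> * k, - k)"
  by (rule group.inv_equality[OF group_amphi]) auto

lemma pi1_G1_simps [simp]:
  "carrier pi1_G1 = UNIV" "\<one>\<^bsub>pi1_G1\<^esub> = (0, 0, 0)"
  "(i, j, k) \<otimes>\<^bsub>pi1_G1\<^esub> (i', j', k') = (i + i', j + j', k + k')"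
  by (auto simp: pi1_G1_def)

lemma group_pi1_G1: "group pi1_G1"
  unfolding pi1_G1_def by (intro DirProd_group group_integer_group)

text \<open>Only the few products that build a triple from the generators are assumed of
  \<open>m\<close>, so that both \<open>amphi \<epsilon>\<close> and \<open>pi1_G1\<close> are
  covered, for generating groups as well as orbit relations.\<close>

lemma int_triples_generated:
  fixes m :: "int \<times> int \<times> int \<Rightarrow> int \<times> int \<times> int \<Rightarrow> int \<times> int \<times> int"
  assumes gen: "{(1, 0, 0), (-1, 0, 0), (0, 1, 0), (0, -1, 0), (0, 0, 1), (0, 0, -1)} \<subseteq> S"
    and m: "\<And>g h. g \<in> S \<Longrightarrow> h \<in> S \<Longrightarrow> m g h \<in> S"
    and step: "\<And>i d. m (i, 0, 0) (d, 0, 0) = (i + d, 0, 0)"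
      "\<And>i d. m (0, i, 0) (0, d, 0) = (0, i + d, 0)" "\<And>i d. m (0, 0, i) (0, 0, d) = (0, 0, i + d)"
    and normal: "\<And>i j k. m (m (0, j, 0) (0, 0, k)) (i, 0, 0) = (i, j, k)"
  shows "S = UNIV"
proof -
  have "(0, 0, 0) \<in> S"
    using m[of "(1, 0, 0)" "(-1, 0, 0)"] gen step(1)[of 1 "-1"] by simp
  then have "(i, 0, 0) \<in> S" "(0, i, 0) \<in> S" "(0, 0, i) \<in> S" for i
  proof (induction i rule: int_induct[where k = 0])
    case (step1 i)
    { case 1 then show ?case using step1 m[of "(i, 0, 0)" "(1, 0, 0)"] gen step(1) by simp }
    { case 2 then show ?case using step1 m[of "(0, i, 0)" "(0, 1, 0)"] gen step(2) by simp }
    { case 3 then show ?case using step1 m[of "(0, 0, i)" "(0, 0, 1)"] gen step(3) by simp }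
  next
    case (step2 i)
    { case 1 then show ?case using step2 m[of "(i, 0, 0)" "(-1, 0, 0)"] gen step(1)[of i "-1"] by simp }
    { case 2 then show ?case using step2 m[of "(0, i, 0)" "(0, -1, 0)"] gen step(2)[of i "-1"] by simp }
    { case 3 then show ?case using step2 m[of "(0, 0, i)" "(0, 0, -1)"] gen step(3)[of i "-1"] by simp }
  qed
  then have "(i, j, k) \<in> S" for i j k
    using m normal by metis
  then show ?thesis by auto
qed

text \<open>The work lies in moving \<open>a [^] i\<close> past a normal form in \<open>b\<close>
  and \<open>c\<close>. Conjugation by \<open>a\<close> is a homomorphism, hence respects powers,
  and so it takes \<open>b [^] j \<otimes> c [^] k\<close> to
  \<open>b [^] (\<epsilon> * k - j) \<otimes> c [^] k\<close>.\<close>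

lemma (in group) amphi_relations_hom:
  assumes abc: "a \<in> carrier G" "b \<in> carrier G" "c \<in> carrier G"
    and bc: "b \<otimes> c = c \<otimes> b" and ab: "a \<otimes> b = inv b \<otimes> a"
    and ac: "a \<otimes> c = b [^] (\<epsilon>::int) \<otimes> c \<otimes> a"
  shows "(\<lambda>(i, j, k). b [^] j \<otimes> c [^] k \<otimes> a [^] i) \<in> hom (amphi \<epsilon>) G"
proof -
  define N where "N j k = b [^] (j::int) \<otimes> c [^] (k::int)" for j k
  have N [simp]: "N j k \<in> carrier G" for j k
    using abc by (simp add: N_def)
  have conj_pow: "z \<otimes> x [^] (n::int) \<otimes> inv z = (z \<otimes> x \<otimes> inv z) [^] n"
    if "x \<in> carrier G" "z \<in> carrier G" for x z n
  proof -
    have "group_hom G G (\<lambda>x. z \<otimes> x \<otimes> inv z)"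
    proof (unfold group_hom_def group_hom_axioms_def, intro conjI)
      show "(\<lambda>x. z \<otimes> x \<otimes> inv z) \<in> hom G G"
        unfolding hom_def using that(2) by (auto simp: m_assoc inv_solve_left)
    qed (rule group_axioms)+
    from group_hom.hom_int_pow[OF this that(1)] show ?thesis .
  qed
  have comm_pow: "x [^] (n::int) \<otimes> y = y \<otimes> x [^] n"
    if "x \<in> carrier G" "y \<in> carrier G" "x \<otimes> y = y \<otimes> x" for x y n
  proof -
    have "y \<otimes> x \<otimes> inv y = x"
      using that by (metis inv_solve_right m_closed)
    then have "y \<otimes> x [^] n \<otimes> inv y = x [^] n"
      using conj_pow[OF that(1,2), of n] by simp
    then show ?thesis
      using that by (metis int_pow_closed inv_solve_right m_closed)
  qed
  have bc_pow: "b [^] (j::int) \<otimes> c [^] (k::int) = c [^] k \<otimes> b [^] j" for j k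
    using comm_pow[OF abc(3) _ comm_pow[OF abc(2,3) bc, symmetric]] abc by simp
  have NN: "N j k \<otimes> N j' k' = N (j + j') (k + k')" for j k j' k'
  proof -
    have "N j k \<otimes> N j' k' = b [^] j \<otimes> (c [^] k \<otimes> b [^] j') \<otimes> c [^] k'"
      using abc by (simp add: N_def m_assoc)
    also have "\<dots> = b [^] j \<otimes> (b [^] j' \<otimes> c [^] k) \<otimes> c [^] k'"
      by (simp add: bc_pow)
    also have "\<dots> = N (j + j') (k + k')"
      using abc by (simp add: N_def m_assoc int_pow_mult)
    finally show ?thesis .
  qed
  have aN: "a \<otimes> N j k = N (\<epsilon> * k - j) k \<otimes> a" for j k
  proof -
    have "a \<otimes> b \<otimes> inv a = inv b"
      using ab abc by (metis inv_closed inv_solve_right m_closed)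
    then have "a \<otimes> b [^] j \<otimes> inv a = inv b [^] j"
      using conj_pow[OF abc(2,1), of j] by simp
    then have b: "a \<otimes> b [^] j = b [^] (- j) \<otimes> a"
      using abc by (metis int_pow_closed int_pow_inv int_pow_neg inv_closed inv_solve_right m_closed)
    have "a \<otimes> c \<otimes> inv a = b [^] \<epsilon> \<otimes> c"
      using ac abc by (metis int_pow_closed inv_solve_right m_closed)
    then have "a \<otimes> c [^] k \<otimes> inv a = (b [^] \<epsilon> \<otimes> c) [^] k"
      using conj_pow[OF abc(3,1), of k] by simp
    also have "\<dots> = b [^] (\<epsilon> * k) \<otimes> c [^] k"
      using int_pow_mult_distrib[of "b [^] \<epsilon>" c k] comm_pow[OF abc(2,3) bc] abc
      by (simp add: int_pow_pow)
    finally have c: "a \<otimes> c [^] k = b [^] (\<epsilon> * k) \<otimes> c [^] k \<otimes> a"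
      using abc by (metis int_pow_closed inv_solve_right m_closed)
    have "a \<otimes> N j k = b [^] (- j) \<otimes> (a \<otimes> c [^] k)"
      using abc b by (simp add: N_def m_assoc[symmetric])
    also have "\<dots> = (b [^] (- j) \<otimes> b [^] (\<epsilon> * k)) \<otimes> c [^] k \<otimes> a"
      using abc by (simp only: c) (simp add: m_assoc)
    also have "b [^] (- j) \<otimes> b [^] (\<epsilon> * k) = b [^] (\<epsilon> * k - j)"
      using abc by (simp add: int_pow_mult[symmetric])
    finally show ?thesis by (simp add: N_def)
  qed
  \<comment> \<open>The substitution \<open>j \<mapsto> \<epsilon> * k - j\<close> is an involution,
    so \<open>inv a\<close> acts by the same formula as \<open>a\<close>, and for powers of
    \<open>a\<close> only the parity of the exponent counts.\<close>
  have aN': "inv a \<otimes> N j k = N (\<epsilon> * k - j) k \<otimes> inv a" for j k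
  proof -
    have "a \<otimes> N (\<epsilon> * k - j) k = N j k \<otimes> a"
      using aN[of "\<epsilon> * k - j" k] by simp
    then have "N (\<epsilon> * k - j) k = inv a \<otimes> (N j k \<otimes> a)"
      using abc N by (metis inv_solve_left m_closed)
    then have "N (\<epsilon> * k - j) k \<otimes> inv a = inv a \<otimes> N j k \<otimes> (a \<otimes> inv a)"
      using abc N by (simp add: m_assoc del: r_inv)
    then show ?thesis
      using abc N by simp
  qed
  have pow_a: "a [^] i \<otimes> N j k = N (if even i then j else \<epsilon> * k - j) k \<otimes> a [^] i" for i :: int and j k
  proof (induction i rule: int_induct[where k = 0])
    case base
    show ?case using abc by simp
  next
    case (step1 i)
    have "a [^] (i + 1) \<otimes> N j k = a \<otimes> (a [^] i \<otimes> N j k)"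
      using abc int_pow_mult[of a 1 i] by (simp add: add.commute m_assoc)
    also have "\<dots> = a \<otimes> N (if even i then j else \<epsilon> * k - j) k \<otimes> a [^] i"
      using abc by (simp add: step1.IH m_assoc)
    also have "\<dots> = N (if even (i + 1) then j else \<epsilon> * k - j) k \<otimes> (a \<otimes> a [^] i)"
      using abc by (simp add: aN m_assoc)
    also have "a \<otimes> a [^] i = a [^] (i + 1)"
      using abc int_pow_mult[of a 1 i] by (simp add: add.commute)
    finally show ?case .
  next
    case (step2 i)
    have a1: "a [^] (-1 :: int) = inv a"
      using abc int_pow_neg[of a 1] by simp
    have "a [^] (i - 1) \<otimes> N j k = inv a \<otimes> (a [^] i \<otimes> N j k)"
      using abc int_pow_mult[of a "-1" i] by (simp add: a1 m_assoc)
    also have "\<dots> = inv a \<otimes> N (if even i then j else \<epsilon> * k - j) k \<otimes> a [^] i"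
      using abc by (simp add: step2.IH m_assoc)
    also have "\<dots> = N (if even (i - 1) then j else \<epsilon> * k - j) k \<otimes> (inv a \<otimes> a [^] i)"
      using abc by (simp add: aN' m_assoc)
    also have "inv a \<otimes> a [^] i = a [^] (i - 1)"
      using abc int_pow_mult[of a "-1" i] by (simp add: a1)
    finally show ?case .
  qed
  have "N (j + (if even i then j' else \<epsilon> * k' - j')) (k + k') \<otimes> a [^] (i + i') =
      N j k \<otimes> a [^] i \<otimes> (N j' k' \<otimes> a [^] i')" for i j k i' j' k' :: int
  proof -
    have "N j k \<otimes> a [^] i \<otimes> (N j' k' \<otimes> a [^] i') = N j k \<otimes> (a [^] i \<otimes> N j' k') \<otimes> a [^] i'"
      using abc by (simp add: m_assoc)
    also have "\<dots> = (N j k \<otimes> N (if even i then j' else \<epsilon> * k' - j') k') \<otimes> (a [^] i \<otimes> a [^] i')"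
      using abc by (simp only: pow_a) (simp add: m_assoc)
    finally show ?thesis
      using abc by (simp add: NN int_pow_mult)
  qed
  then show ?thesis
    unfolding hom_def using abc by (auto simp: N_def[symmetric])
qed

section \<open>Evaluation of words and the two presentations\<close>

fun letter_value :: "('a, 'm) monoid_scheme \<Rightarrow> ('g \<Rightarrow> 'a) \<Rightarrow> 'g letter \<Rightarrow> 'a" where
  "letter_value G g (Gen x) = g x"
| "letter_value G g (Inv x) = inv\<^bsub>G\<^esub> (g x)"

definition word_value :: "('a, 'm) monoid_scheme \<Rightarrow> ('g \<Rightarrow> 'a) \<Rightarrow> 'g letter list \<Rightarrow> 'a" where
  "word_value G g w = foldr (\<lambda>l x. letter_value G g l \<otimes>\<^bsub>G\<^esub> x) w \<one>\<^bsub>G\<^esub>"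

lemma word_value_simps [simp]:
  "word_value G g [] = \<one>\<^bsub>G\<^esub>"
  "word_value G g (l # w) = letter_value G g l \<otimes>\<^bsub>G\<^esub> word_value G g w"
  by (simp_all add: word_value_def)

text \<open>No word has to be brought to normal form. Evaluation is well defined by
  \<open>rel\<close>, and \<open>\<phi>\<close>, going the other way, undoes it on every word, which
  makes evaluation injective. \<open>gen\<close> says in the form of an induction principle that the
  values of the generators generate \<open>G\<close>.\<close>

lemma presented_group_iso:
  fixes G :: "('a, 'm) monoid_scheme" and g :: "'g \<Rightarrow> 'a"
  assumes G: "group G" and g: "range g \<subseteq> carrier G"
    and rel: "\<And>l r. (l, r) \<in> R \<Longrightarrow> word_value G g l = word_value G g r"
    and \<phi>: "\<phi> \<in> hom G (presented_group R)" "\<And>x. \<phi> (g x) = pres_class R [Gen x]"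
    and gen: "\<And>S. range g \<subseteq> S \<Longrightarrow> (\<And>x. inv\<^bsub>G\<^esub> (g x) \<in> S) \<Longrightarrow>
      (\<And>x y. x \<in> S \<Longrightarrow> y \<in> S \<Longrightarrow> x \<otimes>\<^bsub>G\<^esub> y \<in> S) \<Longrightarrow> carrier G \<subseteq> S"
  shows "presented_group R \<cong> G"
proof -
  let ?P = "presented_group R" and ?v = "word_value G g"
  interpret group G by (rule G)
  interpret P: group ?P by (rule group_presented_group)
  interpret h: group_hom G ?P \<phi>
    using \<phi>(1) by unfold_locales
  have lv [simp]: "letter_value G g l \<in> carrier G" for l
    using g by (cases l) auto
  have v [simp]: "?v w \<in> carrier G" for w
    by (induction w) auto
  have append: "?v (u @ w) = ?v u \<otimes>\<^bsub>G\<^esub> ?v w" for u w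
    by (induction u) (auto simp: m_assoc)
  have cancel: "letter_value G g l \<otimes>\<^bsub>G\<^esub> letter_value G g (letter_inv l) = \<one>\<^bsub>G\<^esub>" for l
    using g by (cases l) (auto intro!: r_inv l_inv)
  have eq: "?v u = ?v w" if "pres_eq R u w" for u w
    using that
  proof (induction rule: pres_eq.induct)
    case (cancel u x w)
    then show ?case
      using \<open>\<And>l. letter_value G g l \<otimes>\<^bsub>G\<^esub> letter_value G g (letter_inv l) = \<one>\<^bsub>G\<^esub>\<close>[of x]
      by (simp add: append m_assoc[symmetric])
  next
    case (relation l r u w)
    then show ?case by (simp add: append rel)
  qed auto
  have one: "\<one>\<^bsub>?P\<^esub> = pres_class R []"
    by (simp add: presented_group_def)
  have letter: "\<phi> (letter_value G g l) = pres_class R [l]" for l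
  proof (cases l)
    case (Gen x)
    then show ?thesis by (simp add: \<phi>(2))
  next
    case (Inv x)
    have "pres_class R [Inv x] \<otimes>\<^bsub>?P\<^esub> pres_class R [Gen x] = \<one>\<^bsub>?P\<^esub>"
      unfolding presented_group_mult one pres_class_eq_iff
      using pres_eq.cancel[of R "[]" "Inv x" "[]"] by simp
    then have "inv\<^bsub>?P\<^esub> (pres_class R [Gen x]) = pres_class R [Inv x]"
      by (rule P.inv_equality) (auto simp: presented_group_def)
    then show ?thesis
      using subsetD[OF g rangeI, of x] by (simp add: Inv \<phi>(2))
  qed
  have right_inv: "\<phi> (?v w) = pres_class R w" for w
    by (induction w) (simp_all add: one letter presented_group_mult)
  define \<psi> where "\<psi> X = ?v (SOME w. w \<in> X)" for X
  have \<psi>: "\<psi> (pres_class R w) = ?v w" for w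
  proof -
    have "(SOME u. u \<in> pres_class R w) \<in> pres_class R w"
      by (rule someI[of _ w]) (simp add: pres_class_def pres_eq.refl)
    then show ?thesis
      unfolding \<psi>_def using eq by (simp add: pres_class_def)
  qed
  have carrier: "carrier ?P = range (pres_class R)"
    by (simp add: presented_group_def)
  have "\<psi> \<in> iso ?P G"
    unfolding iso_def hom_def bij_betw_def
  proof (intro CollectI conjI)
    show "\<psi> \<in> carrier ?P \<rightarrow> carrier G"
      by (auto simp: carrier \<psi>)
    show "\<forall>x\<in>carrier ?P. \<forall>y\<in>carrier ?P. \<psi> (x \<otimes>\<^bsub>?P\<^esub> y) = \<psi> x \<otimes>\<^bsub>G\<^esub> \<psi> y"
      by (auto simp: carrier presented_group_mult \<psi> append)
    show "inj_on \<psi> (carrier ?P)"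
      by (rule inj_on_inverseI[of _ \<phi>]) (auto simp: carrier \<psi> right_inv)
    have "carrier G \<subseteq> range ?v"
    proof (rule gen)
      have gx: "g x \<in> carrier G" for x
        using g by blast
      have "?v [Gen x] = g x" for x
        by (simp add: gx)
      then show "range g \<subseteq> range ?v"
        by (metis image_subsetI rangeI)
      have "?v [Inv x] = inv\<^bsub>G\<^esub> (g x)" for x
        by (simp add: gx)
      then show "inv\<^bsub>G\<^esub> (g x) \<in> range ?v" for x
        by (metis rangeI)
      show "x \<otimes>\<^bsub>G\<^esub> y \<in> range ?v" if xy: "x \<in> range ?v" "y \<in> range ?v" for x y
      proof -
        obtain u w where "x = ?v u" "y = ?v w"
          using xy by blast
        then show ?thesis
          using append[of u w] by (intro image_eqI[of _ _ "u @ w"]) simp_all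
      qed
    qed
    then show "\<psi> ` carrier ?P = carrier G"
      by (auto simp: carrier image_image \<psi>)
  qed
  then show ?thesis
    by (auto simp: is_iso_def)
qed

fun amphi_gen :: "gen \<Rightarrow> int \<times> int \<times> int" where
  "amphi_gen Ga = (1, 0, 0)" | "amphi_gen Gb = (0, 1, 0)" | "amphi_gen Gc = (0, 0, 1)"

context
  fixes R :: "('g letter list \<times> 'g letter list) set"
begin

lemma pres_class_closed: "pres_class R w \<in> carrier (presented_group R)"
  by (simp add: presented_group_def)

lemma pres_class_inv: "inv\<^bsub>presented_group R\<^esub> (pres_class R [Gen x]) = pres_class R [Inv x]"
proof (rule group.inv_equality[OF group_presented_group])
  show "pres_class R [Inv x] \<otimes>\<^bsub>presented_group R\<^esub> pres_class R [Gen x] = \<one>\<^bsub>presented_group R\<^esub>"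
    unfolding presented_group_mult using pres_eq.cancel[of R "[]" "Inv x" "[]"]
    by (simp add: presented_group_def pres_class_eq_iff)
qed (rule pres_class_closed)+

lemma pres_class_relation: "(l, r) \<in> R \<Longrightarrow> pres_class R l = pres_class R r"
  unfolding pres_class_eq_iff using pres_eq.relation[of l r R "[]" "[]"] by simp

end

lemma (in group) conj_eq_iff:
  assumes "x \<in> carrier G" "y \<in> carrier G" "z \<in> carrier G"
  shows "x \<otimes> y \<otimes> inv x = z \<longleftrightarrow> x \<otimes> y = z \<otimes> x"
  using assms by (metis inv_closed inv_solve_right m_closed)

lemma presented_amphi_iso:
  fixes R :: "(gen letter list \<times> gen letter list) set" and \<epsilon> :: int
  defines "P \<equiv> presented_group R" and "c \<equiv> \<lambda>x. pres_class R [Gen x]"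
  assumes rel: "\<And>l r. (l, r) \<in> R \<Longrightarrow> word_value (amphi \<epsilon>) amphi_gen l = word_value (amphi \<epsilon>) amphi_gen r"
    and bc: "c Gc \<otimes>\<^bsub>P\<^esub> c Gb = c Gb \<otimes>\<^bsub>P\<^esub> c Gc" and ab: "c Ga \<otimes>\<^bsub>P\<^esub> c Gb = inv\<^bsub>P\<^esub> (c Gb) \<otimes>\<^bsub>P\<^esub> c Ga"
    and ac: "c Ga \<otimes>\<^bsub>P\<^esub> c Gc = c Gb [^]\<^bsub>P\<^esub> \<epsilon> \<otimes>\<^bsub>P\<^esub> c Gc \<otimes>\<^bsub>P\<^esub> c Ga"
  shows "P \<cong> amphi \<epsilon>"
  unfolding P_def
proof (rule presented_group_iso[OF group_amphi, of amphi_gen])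
  interpret P: group P unfolding P_def by (rule group_presented_group)
  have cl: "c x \<in> carrier P" for x
    unfolding c_def P_def by (rule pres_class_closed)
  show "(\<lambda>(i, j, k). c Gb [^]\<^bsub>P\<^esub> j \<otimes>\<^bsub>P\<^esub> c Gc [^]\<^bsub>P\<^esub> k \<otimes>\<^bsub>P\<^esub> c Ga [^]\<^bsub>P\<^esub> i) \<in> hom (amphi \<epsilon>) (presented_group R)"
    using P.amphi_relations_hom[OF cl cl cl bc[symmetric] ab ac] by (simp add: P_def)
  show "(case amphi_gen x of (i, j, k) \<Rightarrow> c Gb [^]\<^bsub>P\<^esub> j \<otimes>\<^bsub>P\<^esub> c Gc [^]\<^bsub>P\<^esub> k \<otimes>\<^bsub>P\<^esub> c Ga [^]\<^bsub>P\<^esub> i) = pres_class R [Gen x]" for x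
    using cl by (cases x) (simp_all add: c_def)
  show "carrier (amphi \<epsilon>) \<subseteq> S" if S: "range amphi_gen \<subseteq> S" "\<And>x. inv\<^bsub>amphi \<epsilon>\<^esub> (amphi_gen x) \<in> S"
    "\<And>x y. x \<in> S \<Longrightarrow> y \<in> S \<Longrightarrow> x \<otimes>\<^bsub>amphi \<epsilon>\<^esub> y \<in> S" for S
  proof -
    have "amphi_gen Ga \<in> S" "amphi_gen Gb \<in> S" "amphi_gen Gc \<in> S"
      using S(1) by blast+
    then have "S = UNIV"
      using S(2)[of Ga] S(2)[of Gb] S(2)[of Gc]
      by (intro int_triples_generated[of S "\<lambda>x y. x \<otimes>\<^bsub>amphi \<epsilon>\<^esub> y"] S(3)) simp_all
    then show ?thesis by simp
  qed
qed (use rel in simp_all)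

lemma pi1_B1_iso: "pi1_B1 \<cong> amphi 0"
proof -
  let ?R = "{([gc, ga, gc', ga'], []), ([gc, gb, gc', gb'], []), ([ga, gb, ga', gb], [])}"
  let ?P = "presented_group ?R" and ?c = "\<lambda>x. pres_class ?R [Gen x]"
  interpret P: group ?P by (rule group_presented_group)
  note cl = pres_class_closed[of ?R]
  have one: "\<one>\<^bsub>?P\<^esub> = pres_class ?R []"
    by (simp add: presented_group_def)
  have comm: "x \<otimes>\<^bsub>?P\<^esub> y = y \<otimes>\<^bsub>?P\<^esub> x"
    if "x \<otimes>\<^bsub>?P\<^esub> y \<otimes>\<^bsub>?P\<^esub> inv\<^bsub>?P\<^esub> x \<otimes>\<^bsub>?P\<^esub> inv\<^bsub>?P\<^esub> y = \<one>\<^bsub>?P\<^esub>" "x \<in> carrier ?P" "y \<in> carrier ?P" for x y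
    using that by (metis P.inv_closed P.inv_equality P.inv_inv P.inv_solve_right P.m_closed)
  have ca: "?c Gc \<otimes>\<^bsub>?P\<^esub> ?c Ga = ?c Ga \<otimes>\<^bsub>?P\<^esub> ?c Gc" and cb: "?c Gc \<otimes>\<^bsub>?P\<^esub> ?c Gb = ?c Gb \<otimes>\<^bsub>?P\<^esub> ?c Gc"
    by (rule comm[OF _ cl cl]; unfold pres_class_inv presented_group_mult one; simp; rule pres_class_relation; simp)+
  have "?c Ga \<otimes>\<^bsub>?P\<^esub> ?c Gb \<otimes>\<^bsub>?P\<^esub> inv\<^bsub>?P\<^esub> (?c Ga) \<otimes>\<^bsub>?P\<^esub> ?c Gb = \<one>\<^bsub>?P\<^esub>"
    unfolding pres_class_inv presented_group_mult one by (simp, rule pres_class_relation, simp)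
  then have "?c Ga \<otimes>\<^bsub>?P\<^esub> ?c Gb \<otimes>\<^bsub>?P\<^esub> inv\<^bsub>?P\<^esub> (?c Ga) = inv\<^bsub>?P\<^esub> (?c Gb)"
    using P.inv_equality cl by simp
  then have "?c Ga \<otimes>\<^bsub>?P\<^esub> ?c Gb = inv\<^bsub>?P\<^esub> (?c Gb) \<otimes>\<^bsub>?P\<^esub> ?c Ga"
    using P.conj_eq_iff cl by simp
  then show ?thesis
    unfolding pi1_B1_def using cl ca cb by (intro presented_amphi_iso) auto
qed

text \<open>The relation \<open>\<alpha>\<gamma>\<alpha>\<inverse>\<gamma>\<inverse> =
  \<beta>\<close> reads \<open>\<alpha>\<gamma> = \<beta>\<gamma>\<alpha>\<close>, which is the
  exponent \<open>\<epsilon> = 1\<close>.\<close>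

lemma pi1_B2_iso: "pi1_B2 \<cong> amphi 1"
proof -
  let ?R = "{([gc, gb, gc'], [gb]), ([ga, gc, ga', gc'], [gb]), ([ga, gb, ga'], [gb'])}"
  let ?P = "presented_group ?R" and ?c = "\<lambda>x. pres_class ?R [Gen x]"
  interpret P: group ?P by (rule group_presented_group)
  note cl = pres_class_closed[of ?R]
  have cb: "?c Gc \<otimes>\<^bsub>?P\<^esub> ?c Gb \<otimes>\<^bsub>?P\<^esub> inv\<^bsub>?P\<^esub> (?c Gc) = ?c Gb"
    and ac: "?c Ga \<otimes>\<^bsub>?P\<^esub> ?c Gc \<otimes>\<^bsub>?P\<^esub> inv\<^bsub>?P\<^esub> (?c Ga) \<otimes>\<^bsub>?P\<^esub> inv\<^bsub>?P\<^esub> (?c Gc) = ?c Gb"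
    and ab: "?c Ga \<otimes>\<^bsub>?P\<^esub> ?c Gb \<otimes>\<^bsub>?P\<^esub> inv\<^bsub>?P\<^esub> (?c Ga) = inv\<^bsub>?P\<^esub> (?c Gb)"
    unfolding pres_class_inv presented_group_mult by (simp, rule pres_class_relation, simp)+
  have "?c Ga \<otimes>\<^bsub>?P\<^esub> ?c Gc \<otimes>\<^bsub>?P\<^esub> inv\<^bsub>?P\<^esub> (?c Ga) = ?c Gb \<otimes>\<^bsub>?P\<^esub> ?c Gc"
    using ac P.inv_solve_right cl by (metis P.inv_closed P.m_closed)
  then have "?c Ga \<otimes>\<^bsub>?P\<^esub> ?c Gc = ?c Gb \<otimes>\<^bsub>?P\<^esub> ?c Gc \<otimes>\<^bsub>?P\<^esub> ?c Ga"
    using P.conj_eq_iff cl by simp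
  then show ?thesis
    unfolding pi1_B2_def using cl P.conj_eq_iff[OF cl cl cl, THEN iffD1, OF cb] P.conj_eq_iff[OF cl cl P.inv_closed[OF cl], THEN iffD1, OF ab]
    by (intro presented_amphi_iso) auto
qed

text \<open>In \<open>amphi 0\<close> every commutator is a square, but the commutator \<open>(0, 1, 0)\<close> of \<open>amphi 1\<close> is not.\<close>

lemma amphi_not_iso: "\<not> amphi 0 \<cong> amphi 1"
proof
  assume "amphi 0 \<cong> amphi 1"
  then have "amphi 1 \<cong> amphi 0"
    by (rule group.iso_sym[OF group_amphi])
  then obtain \<phi> where \<phi>: "\<phi> \<in> iso (amphi 1) (amphi 0)"
    by (auto simp: is_iso_def)
  then interpret group_hom "amphi 1" "amphi 0" \<phi>
    by (simp add: group_hom_def group_hom_axioms_def iso_imp_homomorphism group_amphi)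
  have inj: "inj \<phi>" and surj: "surj \<phi>"
    using \<phi> by (auto simp: iso_def bij_betw_def)
  obtain i j k where a: "\<phi> (1, 0, 0) = (i, j, k)" by (cases "\<phi> (1, 0, 0)")
  obtain i' j' k' where c: "\<phi> (0, 0, 1) = (i', j', k')" by (cases "\<phi> (0, 0, 1)")
  have mult: "\<phi> (x \<otimes>\<^bsub>amphi 1\<^esub> y) = \<phi> x \<otimes>\<^bsub>amphi 0\<^esub> \<phi> y" for x y
    by simp
  have inv: "\<phi> (inv\<^bsub>amphi 1\<^esub> x) = inv\<^bsub>amphi 0\<^esub> \<phi> x" for x
    by simp
  have b: "(0, 1, 0) = (1, 0, 0) \<otimes>\<^bsub>amphi 1\<^esub> (0, 0, 1) \<otimes>\<^bsub>amphi 1\<^esub> inv\<^bsub>amphi 1\<^esub> (1, 0, 0) \<otimes>\<^bsub>amphi 1\<^esub> inv\<^bsub>amphi 1\<^esub> (0, 0, 1)"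
    by simp
  have "\<phi> (0, 1, 0) = \<phi> (1, 0, 0) \<otimes>\<^bsub>amphi 0\<^esub> \<phi> (0, 0, 1) \<otimes>\<^bsub>amphi 0\<^esub> inv\<^bsub>amphi 0\<^esub> \<phi> (1, 0, 0)
      \<otimes>\<^bsub>amphi 0\<^esub> inv\<^bsub>amphi 0\<^esub> \<phi> (0, 0, 1)"
    unfolding b mult inv ..
  then have "\<exists>m. \<phi> (0, 1, 0) = (0, 2 * m, 0)"
    unfolding a c by (auto simp: ac_simps) presburger+
  then obtain m where m: "\<phi> (0, 1, 0) = (0, 2 * m, 0)" by blast
  obtain x y z where xyz: "\<phi> (x, y, z) = (0, m, 0)"
    using surj by (metis prod_cases3 surjD)
  have "\<phi> ((x, y, z) \<otimes>\<^bsub>amphi 1\<^esub> (x, y, z)) = \<phi> (0, 1, 0)"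
    unfolding mult xyz m by simp
  then have "(x, y, z) \<otimes>\<^bsub>amphi 1\<^esub> (x, y, z) = (0, 1, 0)"
    using inj by (simp only: inj_eq)
  \<comment> \<open>A square whose outer coordinates vanish has the form
    \<open>(0, 2 * y, 0)\<close>, and \<open>2 * y = 1\<close> is impossible.\<close>
  then show False
    by (auto split: if_splits) presburger
qed

text \<open>\<open>(1, 0, 0)\<close> and \<open>(0, 1, 0)\<close> do not commute in
  \<open>amphi \<epsilon>\<close>, whereas \<open>pi1_G1\<close> is abelian.\<close>

lemma pi1_G1_not_iso_amphi: "\<not> pi1_G1 \<cong> amphi \<epsilon>"
proof
  assume "pi1_G1 \<cong> amphi \<epsilon>"
  then obtain \<phi> where \<phi>: "\<phi> \<in> iso pi1_G1 (amphi \<epsilon>)"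
    by (auto simp: is_iso_def)
  then have surj: "surj \<phi>"
    by (auto simp: iso_def bij_betw_def)
  obtain g h where gh: "\<phi> g = (1, 0, 0)" "\<phi> h = (0, 1, 0)"
    using surj by (metis surjD)
  have "g \<otimes>\<^bsub>pi1_G1\<^esub> h = h \<otimes>\<^bsub>pi1_G1\<^esub> g"
    by (cases g, cases h) (simp add: add.commute)
  then have "\<phi> g \<otimes>\<^bsub>amphi \<epsilon>\<^esub> \<phi> h = \<phi> h \<otimes>\<^bsub>amphi \<epsilon>\<^esub> \<phi> g"
    using \<phi> by (metis UNIV_I hom_mult iso_imp_homomorphism pi1_G1_simps(1))
  then show False
    by (simp add: gh)
qed

section \<open>Isometric actions\<close>

text \<open>Elements that act alike differ by one that moves nothing, which the displacement bound
  forces to be the unit. So the bound yields faithfulness as well.\<close>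

lemma deck_range:
  fixes G :: "('g, 'm) monoid_scheme" and act :: "'g \<Rightarrow> 'v::metric_space \<Rightarrow> 'v"
  assumes G: "group G" "carrier G = UNIV"
    and act: "\<And>g h v. act (g \<otimes>\<^bsub>G\<^esub> h) v = act g (act h v)" "act \<one>\<^bsub>G\<^esub> = id"
    and cont: "\<And>g. continuous_on UNIV (act g)"
    and \<delta>: "\<delta> > 0" "\<And>g v. dist v (act g v) < \<delta> \<Longrightarrow> g = \<one>\<^bsub>G\<^esub>"
  shows "deck (range act)" and "act \<in> iso G (deck_group (range act))" and "inj act"
proof -
  interpret group G by (rule G(1))
  have comp: "act g \<circ> act h = act (g \<otimes>\<^bsub>G\<^esub> h)" for g h
    by (rule ext) (simp add: act(1))
  have inv: "act (inv\<^bsub>G\<^esub> g) \<circ> act g = id" "act g \<circ> act (inv\<^bsub>G\<^esub> g) = id" for g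
    using G(2) by (simp_all add: comp act(2))
  show inj: "inj act"
  proof (rule injI)
    fix g h assume "act g = act h"
    then have "act (inv\<^bsub>G\<^esub> h) \<circ> act g = id"
      using inv by metis
    then have "dist v (act (inv\<^bsub>G\<^esub> h \<otimes>\<^bsub>G\<^esub> g) v) < \<delta>" for v
      using \<delta>(1) by (simp add: comp)
    then have "inv\<^bsub>G\<^esub> h \<otimes>\<^bsub>G\<^esub> g = \<one>\<^bsub>G\<^esub>"
      by (rule \<delta>(2))
    then show "g = h"
      using G(2) by (metis UNIV_I inv_closed inv_equality inv_inv)
  qed
  show deck: "deck (range act)"
    unfolding deck_def
  proof (intro conjI)
    show "id \<in> range act"
      using act(2) by (metis rangeI)
    show "\<forall>g\<in>range act. continuous_on UNIV g"
      using cont by blast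
    show "\<forall>g\<in>range act. \<forall>h\<in>range act. g \<circ> h \<in> range act"
      using comp by (metis (no_types, lifting) imageE rangeI)
    show "\<forall>g\<in>range act. \<exists>h\<in>range act. h \<circ> g = id \<and> g \<circ> h = id"
      using inv by blast
    show "\<exists>\<delta>>0. \<forall>g\<in>range act. \<forall>v. dist v (g v) < \<delta> \<longrightarrow> g = id"
      using \<delta> act(2) by blast
  qed
  show "act \<in> iso G (deck_group (range act))"
    using inj G(2) by (auto simp: iso_def hom_def bij_betw_def comp)
qed

lemma orbit_rel_mono:
  assumes "F \<subseteq> F'"
  shows "orbit_rel F \<subseteq> orbit_rel F'"
proof (rule subrelI)
  fix v w assume "(v, w) \<in> orbit_rel F"
  then have "equivclp (\<lambda>u v. \<exists>f\<in>F. v = f u) v w"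
    by (simp add: orbit_rel_def)
  then have "equivclp (\<lambda>u v. \<exists>f\<in>F'. v = f u) v w"
  proof (induction rule: equivclp_induct)
    case (step y z)
    then have "(\<exists>f\<in>F'. z = f y) \<or> (\<exists>f\<in>F'. y = f z)"
      using assms by blast
    then have "equivclp (\<lambda>u v. \<exists>f\<in>F'. v = f u) y z"
    proof
      assume "\<exists>f\<in>F'. z = f y"
      then show ?thesis by (rule r_into_equivclp)
    next
      assume "\<exists>f\<in>F'. y = f z"
      then show ?thesis by (intro equivclp_sym[OF r_into_equivclp])
    qed
    with step.IH show ?case
      by (rule equivclp_trans)
  qed simp
  then show "(v, w) \<in> orbit_rel F'"
    by (simp add: orbit_rel_def)
qed

text \<open>The spaces are defined by three maps, while the covering theory needs the whole group.
  The elements that keep every point in its orbit under the three maps are closed under products and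
  contain the generators and their inverses.\<close>

lemma orbit_space_generators:
  fixes act :: "int \<times> int \<times> int \<Rightarrow> 'v::metric_space \<Rightarrow> 'v"
  assumes m: "\<And>g h v. act (m g h) v = act g (act h v)" and one: "act (0, 0, 0) = id"
    and step: "\<And>i d. m (i, 0, 0) (d, 0, 0) = (i + d, 0, 0)"
      "\<And>i d. m (0, i, 0) (0, d, 0) = (0, i + d, 0)" "\<And>i d. m (0, 0, i) (0, 0, d) = (0, 0, i + d)"
    and normal: "\<And>i j k. m (m (0, j, 0) (0, 0, k)) (i, 0, 0) = (i, j, k)"
  shows "orbit_space {act (1, 0, 0), act (0, 1, 0), act (0, 0, 1)} = orbit_space (range act)"
proof -
  let ?F = "{act (1, 0, 0), act (0, 1, 0), act (0, 0, 1)}"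
  let ?r = "orbit_rel ?F"
  define S where "S = {g. \<forall>v. (v, act g v) \<in> ?r}"
  have sym: "(w, v) \<in> ?r" if "(v, w) \<in> ?r" for v w
    using that equiv_orbit_rel[of ?F] by (meson equivE symE)
  have trans: "(u, w) \<in> ?r" if "(u, v) \<in> ?r" "(v, w) \<in> ?r" for u v w
    using that equiv_orbit_rel[of ?F] by (meson equivE transE)
  have gen: "(v, act g v) \<in> ?r" if "g \<in> {(1, 0, 0), (0, 1, 0), (0, 0, 1)}" for g v
    using that by (auto simp: orbit_rel_def intro!: r_into_equivclp)
  have inv: "g' \<in> S" if "g \<in> {(1, 0, 0), (0, 1, 0), (0, 0, 1)}" "m g g' = (0, 0, 0)" for g g'
  proof -
    have "act g (act g' v) = v" for v
      using m[of g g' v] by (simp add: that(2) one)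
    then have "(act g' v, v) \<in> ?r" for v
      using gen[OF that(1), of "act g' v"] by simp
    then show ?thesis
      unfolding S_def using sym by blast
  qed
  have "S = UNIV"
  proof (rule int_triples_generated[OF _ _ step normal])
    have "(1, 0, 0) \<in> S" "(0, 1, 0) \<in> S" "(0, 0, 1) \<in> S"
      unfolding S_def using gen by simp_all
    moreover have "(-1, 0, 0) \<in> S" "(0, -1, 0) \<in> S" "(0, 0, -1) \<in> S"
      using inv[of "(1, 0, 0)" "(-1, 0, 0)"] inv[of "(0, 1, 0)" "(0, -1, 0)"] inv[of "(0, 0, 1)" "(0, 0, -1)"]
        step(1)[of 1 "-1"] step(2)[of 1 "-1"] step(3)[of 1 "-1"] by simp_all
    ultimately show "{(1, 0, 0), (-1, 0, 0), (0, 1, 0), (0, -1, 0), (0, 0, 1), (0, 0, -1)} \<subseteq> S"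
      by blast
    show "m g h \<in> S" if gh: "g \<in> S" "h \<in> S" for g h
    proof -
      have "(v, act h v) \<in> ?r" "(act h v, act g (act h v)) \<in> ?r" for v
        using gh unfolding S_def by blast+
      then have "(v, act g (act h v)) \<in> ?r" for v
        by (rule trans)
      then show ?thesis
        unfolding S_def by (simp add: m)
    qed
  qed
  then have act: "(v, act g v) \<in> ?r" for g v
    unfolding S_def by blast
  have "orbit_rel (range act) = ?r"
  proof
    show "?r \<subseteq> orbit_rel (range act)"
      by (rule orbit_rel_mono) blast
    show "orbit_rel (range act) \<subseteq> ?r"
    proof (rule subrelI)
      fix v w assume "(v, w) \<in> orbit_rel (range act)"
      then have "equivclp (\<lambda>u v. \<exists>f\<in>range act. v = f u) v w"
        by (simp add: orbit_rel_def)
      then show "(v, w) \<in> ?r"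
      proof (induction rule: equivclp_induct)
        case base
        show ?case using act[of v "(0, 0, 0)"] by (simp add: one)
      next
        case (step y z)
        have "(y, z) \<in> ?r"
          using step(2) act sym by blast
        then show ?case
          using step.IH trans by blast
      qed
    qed
  qed
  then show ?thesis
    by (simp add: orbit_space_def)
qed

text \<open>The reflection in \<open>a\<close> reverses the shift of \<open>c\<close> by
  \<open>- \<epsilon> / 2\<close>, so conjugating \<open>c\<close> by \<open>a\<close> adds
  \<open>\<epsilon>\<close> to its shift, which is the effect of
  \<open>b\<^sup>\<epsilon>\<close>.\<close>

definition amphi_act :: "int \<Rightarrow> int \<times> int \<times> int \<Rightarrow> R3 \<Rightarrow> R3" where
  "amphi_act \<epsilon> = (\<lambda>(i, j, k) (x, y, z).
     (x + of_int i, (if even i then y else - y) + of_int j - of_int \<epsilon> * of_int k / 2, z + of_int k))"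

definition translation_act :: "int \<times> int \<times> int \<Rightarrow> R3 \<Rightarrow> R3" where
  "translation_act = (\<lambda>(i, j, k) (x, y, z). (x + of_int i, y + of_int j, z + of_int k))"

lemma amphi_act_simp [simp]: "amphi_act \<epsilon> (i, j, k) (x, y, z) =
    (x + of_int i, (if even i then y else - y) + of_int j - of_int \<epsilon> * of_int k / 2, z + of_int k)"
  by (simp add: amphi_act_def)

lemma translation_act_simp [simp]: "translation_act (i, j, k) (x, y, z) = (x + of_int i, y + of_int j, z + of_int k)"
  by (simp add: translation_act_def)

lemma dist_R3_less:
  fixes x y z x' y' z' :: real
  assumes "dist (x, y, z) (x', y', z') < d"
  shows "\<bar>x - x'\<bar> < d" "\<bar>y - y'\<bar> < d" "\<bar>z - z'\<bar> < d"
proof -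
  have "dist x x' < d" "dist (y, z) (y', z') < d"
    using assms dist_fst_le[of "(x, y, z)" "(x', y', z')"] dist_snd_le[of "(x, y, z)" "(x', y', z')"] by auto
  moreover then have "dist y y' < d" "dist z z' < d"
    using dist_fst_le[of "(y, z)" "(y', z')"] dist_snd_le[of "(y, z)" "(y', z')"] by auto
  ultimately show "\<bar>x - x'\<bar> < d" "\<bar>y - y'\<bar> < d" "\<bar>z - z'\<bar> < d"
    by (simp_all add: dist_real_def)
qed

lemma of_int_abs_less_half:
  assumes "\<bar>of_int i :: real\<bar> < 1/2"
  shows "i = 0"
proof -
  have "of_int \<bar>i\<bar> < (of_int 1 :: real)"
    using assms by simp
  then show ?thesis
    unfolding of_int_less_iff by simp
qed

lemma amphi_act_mult: "amphi_act \<epsilon> (g \<otimes>\<^bsub>amphi \<epsilon>\<^esub> h) v = amphi_act \<epsilon> g (amphi_act \<epsilon> h v)"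
  by (cases g, cases h, cases v) (auto simp: field_simps)

lemma amphi_act_deck:
  "deck (range (amphi_act \<epsilon>))" "amphi_act \<epsilon> \<in> iso (amphi \<epsilon>) (deck_group (range (amphi_act \<epsilon>)))" "inj (amphi_act \<epsilon>)"
proof -
  have 1: "amphi_act \<epsilon> \<one>\<^bsub>amphi \<epsilon>\<^esub> = id"
    by (auto simp: fun_eq_iff)
  have 2: "continuous_on UNIV (amphi_act \<epsilon> g)" for g
  proof (cases g)
    case (fields i j k)
    have "amphi_act \<epsilon> g = (\<lambda>v. (fst v + of_int i, (if even i then fst (snd v) else - fst (snd v)) + of_int j
        - of_int \<epsilon> * of_int k / 2, snd (snd v) + of_int k))"
      by (rule ext) (simp add: fields split_beta amphi_act_def)
    then show ?thesis
      by (cases "even i") (auto intro!: continuous_intros)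
  qed
  have 3: "g = \<one>\<^bsub>amphi \<epsilon>\<^esub>" if "dist v (amphi_act \<epsilon> g v) < 1/2" for g v
  proof -
    obtain i j k where g: "g = (i, j, k)" by (cases g)
    obtain x y z where v: "v = (x, y, z)" by (cases v)
    note d = dist_R3_less[OF that[unfolded g v amphi_act_simp]]
    have ik: "i = 0" "k = 0"
      using d(1,3) by (auto intro!: of_int_abs_less_half)
    \<comment> \<open>With \<open>i\<close> and \<open>k\<close> gone, neither reflection nor half
      shift is left, and the displacement in \<open>y\<close> is the integer
      \<open>j\<close>.\<close>
    then have "j = 0"
      using d(2) by (auto intro!: of_int_abs_less_half)
    then show ?thesis
      using ik by (simp add: g)
  qed
  show "deck (range (amphi_act \<epsilon>))" "amphi_act \<epsilon> \<in> iso (amphi \<epsilon>) (deck_group (range (amphi_act \<epsilon>)))" "inj (amphi_act \<epsilon>)"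
    using deck_range[OF group_amphi amphi_simps(1), of "amphi_act \<epsilon>" \<epsilon> "1/2", OF amphi_act_mult 1 2 _ 3] by simp_all
qed

lemma translation_act_mult: "translation_act (g \<otimes>\<^bsub>pi1_G1\<^esub> h) v = translation_act g (translation_act h v)"
  by (cases g, cases h, cases v) (simp add: add.assoc add.commute)

lemma translation_act_deck:
  "deck (range translation_act)" "translation_act \<in> iso pi1_G1 (deck_group (range translation_act))"
proof -
  have 1: "translation_act \<one>\<^bsub>pi1_G1\<^esub> = id"
    by (auto simp: fun_eq_iff)
  have 2: "continuous_on UNIV (translation_act g)" for g
  proof (cases g)
    case (fields i j k)
    have "translation_act g = (\<lambda>v. (fst v + of_int i, fst (snd v) + of_int j, snd (snd v) + of_int k))"
      by (rule ext) (simp add: fields split_beta translation_act_def)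
    then show ?thesis
      by (auto intro!: continuous_intros)
  qed
  have 3: "g = \<one>\<^bsub>pi1_G1\<^esub>" if "dist v (translation_act g v) < 1/2" for g v
  proof -
    obtain i j k where g: "g = (i, j, k)" by (cases g)
    obtain x y z where v: "v = (x, y, z)" by (cases v)
    note d = dist_R3_less[OF that[unfolded g v translation_act_simp]]
    show ?thesis
      using d by (auto simp: g intro!: of_int_abs_less_half)
  qed
  show "deck (range translation_act)" "translation_act \<in> iso pi1_G1 (deck_group (range translation_act))"
    using deck_range[OF group_pi1_G1 pi1_G1_simps(1), of translation_act "1/2", OF translation_act_mult 1 2 _ 3] by simp_all
qed

lemma translation_orbit_space:
  "orbit_space {translation_act (1, 0, 0), translation_act (0, 1, 0), translation_act (0, 0, 1)} =
    orbit_space (range translation_act)"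
  by (rule orbit_space_generators[of _ "\<lambda>g h. g \<otimes>\<^bsub>pi1_G1\<^esub> h", OF translation_act_mult]) (auto simp: fun_eq_iff)

lemma G1_eq: "G1 = orbit_space (range translation_act)"
  unfolding G1_def translation_orbit_space[symmetric] by (simp add: translation_act_def)

lemma amphi_orbit_space:
  "orbit_space {amphi_act \<epsilon> (1, 0, 0), amphi_act \<epsilon> (0, 1, 0), amphi_act \<epsilon> (0, 0, 1)} = orbit_space (range (amphi_act \<epsilon>))"
  by (rule orbit_space_generators[of _ "\<lambda>g h. g \<otimes>\<^bsub>amphi \<epsilon>\<^esub> h", OF amphi_act_mult]) (auto simp: fun_eq_iff)

lemma B1_eq: "B1 = orbit_space (range (amphi_act 0))"
  unfolding B1_def amphi_orbit_space[symmetric] by (simp add: amphi_act_def)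

lemma B2_eq: "B2 = orbit_space (range (amphi_act 1))"
  unfolding B2_def amphi_orbit_space[symmetric] by (simp add: amphi_act_def)

section \<open>Subgroups of finite index\<close>

text \<open>\<open>shear p s x\<close> is the \<open>j\<close>-coordinate of the \<open>x\<close>-th power of \<open>(p, s, r)\<close> in \<open>amphi 0\<close>.\<close>

definition shear :: "int \<Rightarrow> int \<Rightarrow> int \<Rightarrow> int" where
  "shear p s x = (if even p then s * x else s * (x mod 2))"

text \<open>For odd \<open>p\<close> the square of \<open>(p, s, r)\<close> is
  \<open>(2 * p, 0, 2 * r)\<close>; this is why the multiple \<open>x\<close> of the first basis
  vector then contributes to \<open>j\<close> through its parity alone.\<close>

definition lat :: "int \<Rightarrow> int \<Rightarrow> int \<Rightarrow> int \<Rightarrow> int \<Rightarrow> int \<Rightarrow> (int \<times> int \<times> int) set" where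
  "lat p q r b s t = {(i, j, k). \<exists>x y. i = p * x \<and> k = r * x + q * y \<and> b dvd j - shear p s x - t * y}"

text \<open>For odd \<open>p\<close>, conjugation by \<open>(p, s, r)\<close> turns
  \<open>(0, t, q)\<close> into \<open>(0, - t, q)\<close>. The quotient of the two is
  \<open>(0, 2 * t, 0)\<close>, whence the divisibility.\<close>

definition lat_params :: "int \<Rightarrow> int \<Rightarrow> int \<Rightarrow> int \<Rightarrow> bool" where
  "lat_params p q b t \<longleftrightarrow> p > 0 \<and> q > 0 \<and> b > 0 \<and> (odd p \<longrightarrow> b dvd 2 * t)"

lemma latI: "b dvd j - shear p s x - t * y \<Longrightarrow> i = p * x \<Longrightarrow> k = r * x + q * y \<Longrightarrow> (i, j, k) \<in> lat p q r b s t"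
  by (auto simp: lat_def)

lemma latE:
  assumes "g \<in> lat p q r b s t"
  obtains x y j where "g = (p * x, j, r * x + q * y)" "b dvd j - shear p s x - t * y"
  using assms by (auto simp: lat_def)

lemma lat_subgroup:
  assumes "lat_params p q b t"
  shows "subgroup (lat p q r b s t) (amphi 0)"
proof (rule group.subgroupI[OF group_amphi])
  show "lat p q r b s t \<noteq> {}"
  proof -
    have "shear p s 0 = 0" by (simp add: shear_def)
    then show ?thesis
      using latI[of b 0 p s 0 t 0 "p * 0" "r * 0 + q * 0" r q] by auto
  qed
next
  have b2: "odd p \<Longrightarrow> b dvd 2 * t * y" for y
    using assms by (auto simp: lat_params_def)
  fix g assume "g \<in> lat p q r b s t"
  then obtain x y j where g: "g = (p * x, j, r * x + q * y)" and d: "b dvd j - shear p s x - t * y"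
    by (rule latE)
  {
    have "b dvd (if even (p * x) then - j else j) - shear p s (- x) - t * (- y)"
    proof (cases "even (p * x)")
      case True
      have "shear p s (- x) = - shear p s x"
        using True by (auto simp: shear_def mod2_eq_if)
      then have "- j - shear p s (- x) - t * (- y) = - (j - shear p s x - t * y)"
        by simp
      then show ?thesis
        using d True by (metis dvd_minus_iff)
    next
      case False
      have "shear p s (- x) = shear p s x"
        using False by (auto simp: shear_def mod2_eq_if)
      then have "j - shear p s (- x) - t * (- y) = (j - shear p s x - t * y) + 2 * t * y"
        by simp
      then show ?thesis
        using d b2[of y] False by (metis dvd_add even_mult_iff)
    qed
    then show "inv\<^bsub>amphi 0\<^esub> g \<in> lat p q r b s t"
      unfolding g inv_amphi
      by (intro latI[where x = "- x" and y = "- y"]) (auto simp: algebra_simps split: if_splits)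
  }
  fix h assume "h \<in> lat p q r b s t"
  then obtain x' y' j' where h: "h = (p * x', j', r * x' + q * y')" and d': "b dvd j' - shear p s x' - t * y'"
    by (rule latE)
  have "b dvd (j + (if even (p * x) then j' else - j')) - shear p s (x + x') - t * (y + y')"
  proof (cases "even (p * x)")
    case True
    have "shear p s (x + x') = shear p s x + shear p s x'"
      using True by (auto simp: shear_def algebra_simps mod2_eq_if)
    then have "(j + j') - shear p s (x + x') - t * (y + y') = (j - shear p s x - t * y) + (j' - shear p s x' - t * y')"
      by (simp add: algebra_simps)
    then show ?thesis
      using d d' True by (metis dvd_add)
  next
    case False
    have "shear p s (x + x') = shear p s x - shear p s x'"
      using False by (auto simp: shear_def algebra_simps mod2_eq_if)
    \<comment> \<open>A left factor with odd first coordinate reverses the sign of the second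
      factor's contribution; the excess \<open>2 * t * y'\<close> is a multiple of
      \<open>b\<close>.\<close>
    then have eq: "(j - j') - shear p s (x + x') - t * (y + y') =
        (j - shear p s x - t * y) - (j' - shear p s x' - t * y') - 2 * t * y'"
      by (simp add: algebra_simps)
    have "odd p" using False by simp
    then have "b dvd (j - j') - shear p s (x + x') - t * (y + y')"
      unfolding eq by (intro dvd_diff d d' b2)
    then show ?thesis
      using False by simp
  qed
  then show "g \<otimes>\<^bsub>amphi 0\<^esub> h \<in> lat p q r b s t"
    unfolding g h amphi_simps
    by (intro latI[where x = "x + x'" and y = "y + y'"]) (auto simp: algebra_simps split: if_splits)
qed simp

section \<open>Normal form and index of the subgroups of finite index\<close>

lemma int_subgroup_multiples:
  fixes H :: "int set"
  assumes add: "\<And>x y. x \<in> H \<Longrightarrow> y \<in> H \<Longrightarrow> x + y \<in> H" and neg: "\<And>x. x \<in> H \<Longrightarrow> - x \<in> H"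
    and pos: "x \<in> H" "x > 0"
  shows "\<exists>d>0. \<forall>y. y \<in> H \<longleftrightarrow> d dvd y"
proof -
  define n where "n = (LEAST n. n > 0 \<and> int n \<in> H)"
  have ex: "\<exists>n>0. int n \<in> H"
    using pos by (intro exI[of _ "nat x"]) simp
  have n: "n > 0" "int n \<in> H"
    using LeastI_ex[OF ex] by (simp_all add: n_def)
  have min: "n \<le> m" if "m > 0" "int m \<in> H" for m
    unfolding n_def using that by (intro Least_le) simp
  have zero: "0 \<in> H"
    using add[OF pos(1) neg[OF pos(1)]] by simp
  have mult: "int n * k \<in> H" for k
  proof (induction k rule: int_induct[where k = 0])
    case (step1 k)
    then show ?case using add[OF step1.IH n(2)] by (simp add: distrib_left)
  next
    case (step2 k)
    then show ?case using add[OF step2.IH neg[OF n(2)]] by (simp add: right_diff_distrib)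
  qed (simp add: zero)
  have "int n dvd y" if "y \<in> H" for y
  proof -
    have "y + - (int n * (y div int n)) \<in> H"
      using add[OF that neg[OF mult]] .
    then have "y mod int n \<in> H"
      by (simp add: minus_mult_div_eq_mod)
    moreover have "0 \<le> y mod int n" "y mod int n < int n"
      using n(1) by simp_all
    ultimately have "y mod int n = 0"
      using min[of "nat (y mod int n)"] by force
    then show ?thesis by (simp add: mod_0_imp_dvd)
  qed
  moreover have "y \<in> H" if "int n dvd y" for y
    using that mult by (auto elim: dvdE)
  ultimately show ?thesis
    using n(1) by (intro exI[of _ "int n"]) auto
qed

text \<open>By pigeonhole two powers of \<open>x\<close> share a coset. Applied to the generators
  this puts a nonzero element of \<open>K\<close> on each axis, hence positive \<open>p\<close>,
  \<open>q\<close> and \<open>b\<close>.\<close>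

lemma (in group) finite_rcosets_power:
  assumes K: "subgroup K G" "finite (rcosets K)" and x: "x \<in> carrier G"
  shows "\<exists>m>0. x [^] (m::nat) \<in> K"
proof -
  have "(\<lambda>m::nat. K #> x [^] m) ` UNIV \<subseteq> rcosets K"
    using x by (auto simp: RCOSETS_def)
  then have "\<not> inj (\<lambda>m::nat. K #> x [^] m)"
    using K(2) finite_subset infinite_UNIV_nat by (metis finite_image_iff)
  then obtain m n :: nat where "K #> x [^] m = K #> x [^] n" "m < n"
    unfolding inj_def by (metis linorder_neqE_nat)
  then have "x [^] n \<in> K #> x [^] m"
    using rcos_self[of "x [^] n" K] x K(1) by simp
  then obtain k where k: "k \<in> K" "x [^] n = k \<otimes> x [^] m"
    by (auto simp: r_coset_def)
  have "x [^] (n - m) \<otimes> x [^] m = k \<otimes> x [^] m"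
    using k(2) \<open>m < n\<close> x by (simp add: nat_pow_mult)
  then have "x [^] (n - m) = k"
    using x k(1) subgroup.mem_carrier[OF K(1)] by simp
  then show ?thesis
    using k(1) \<open>m < n\<close> by (intro exI[of _ "n - m"]) simp
qed

lemma amphi_pow:
  "(1, 0, 0) [^]\<^bsub>amphi 0\<^esub> (m::nat) = (int m, 0, 0)" "(0, 1, 0) [^]\<^bsub>amphi 0\<^esub> (m::nat) = (0, int m, 0)"
  "(0, 0, 1) [^]\<^bsub>amphi 0\<^esub> (m::nat) = (0, 0, int m)"
proof -
  interpret group "amphi 0" by (rule group_amphi)
  show "(1, 0, 0) [^]\<^bsub>amphi 0\<^esub> (m::nat) = (int m, 0, 0)" "(0, 1, 0) [^]\<^bsub>amphi 0\<^esub> (m::nat) = (0, int m, 0)"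
    "(0, 0, 1) [^]\<^bsub>amphi 0\<^esub> (m::nat) = (0, 0, int m)"
    by (induction m) (simp_all del: nat_pow_mult)
qed

text \<open>Three groups of integers produce the numbers: the part of \<open>K\<close> on the
  \<open>j\<close>-axis gives \<open>b\<close>, the \<open>k\<close>-coordinates of elements with
  \<open>i = 0\<close> give \<open>q\<close>, and all \<open>i\<close>-coordinates give
  \<open>p\<close>. Lifts of the basis vectors are then reduced into range.\<close>

lemma lat_exhaust:
  assumes K: "subgroup K (amphi 0)" and fin: "finite (rcosets\<^bsub>amphi 0\<^esub> K)"
  obtains p q r b s t where "lat_params p q b t" "0 \<le> r" "r < q" "0 \<le> s" "s < b" "0 \<le> t" "t < b"
    "K = lat p q r b s t"
proof -
  interpret group "amphi 0" by (rule group_amphi)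
  have mult: "(i + i', j + (if even i then j' else - j'), k + k') \<in> K"
    if "(i, j, k) \<in> K" "(i', j', k') \<in> K" for i j k i' j' k'
    using subgroup.m_closed[OF K that] by (simp split: if_splits)
  have inv: "(- i, if even i then - j else j, - k) \<in> K" if "(i, j, k) \<in> K" for i j k
    using subgroup.m_inv_closed[OF K that] by (simp split: if_splits)
  have pow: "\<exists>m>0. (int m, 0, 0) \<in> K" "\<exists>m>0. (0, int m, 0) \<in> K" "\<exists>m>0. (0, 0, int m) \<in> K"
    using finite_rcosets_power[OF K fin, of "(1, 0, 0)"] finite_rcosets_power[OF K fin, of "(0, 1, 0)"]
      finite_rcosets_power[OF K fin, of "(0, 0, 1)"] by (simp_all add: amphi_pow)
  obtain b where b: "b > 0" "\<And>j. (0, j, 0) \<in> K \<longleftrightarrow> b dvd j"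
  proof -
    obtain m where "m > 0" "(0, int m, 0) \<in> K" using pow(2) by blast
    then have "\<exists>b>0. \<forall>j. j \<in> {j. (0, j, 0) \<in> K} \<longleftrightarrow> b dvd j"
      using mult[of 0 _ 0 0 _ 0] inv[of 0 _ 0]
      by (intro int_subgroup_multiples[of _ "int m"]) (simp_all only: mem_Collect_eq, simp_all)
    then show thesis using that by auto
  qed
  obtain q where q: "q > 0" "\<And>k. (\<exists>j. (0, j, k) \<in> K) \<longleftrightarrow> q dvd k"
  proof -
    obtain m where "m > 0" "(0, 0, int m) \<in> K" using pow(3) by blast
    moreover have "\<exists>j. (0, j, k + k') \<in> K" if "\<exists>j. (0, j, k) \<in> K" "\<exists>j. (0, j, k') \<in> K" for k k'
      using that mult[of 0 _ k 0 _ k'] by force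
    moreover have "\<exists>j. (0, j, - k) \<in> K" if "\<exists>j. (0, j, k) \<in> K" for k
      using that inv[of 0 _ k] by force
    ultimately have "\<exists>q>0. \<forall>k. k \<in> {k. \<exists>j. (0, j, k) \<in> K} \<longleftrightarrow> q dvd k"
      by (intro int_subgroup_multiples[of _ "int m"]) auto
    then show thesis using that by auto
  qed
  obtain p where p: "p > 0" "\<And>i. (\<exists>j k. (i, j, k) \<in> K) \<longleftrightarrow> p dvd i"
  proof -
    obtain m where "m > 0" "(int m, 0, 0) \<in> K" using pow(1) by blast
    moreover have "\<exists>j k. (i + i', j, k) \<in> K" if "\<exists>j k. (i, j, k) \<in> K" "\<exists>j k. (i', j, k) \<in> K" for i i'
      using that mult[of i _ _ i'] by blast
    moreover have "\<exists>j k. (- i, j, k) \<in> K" if "\<exists>j k. (i, j, k) \<in> K" for i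
      using that inv[of i] by blast
    ultimately have "\<exists>p>0. \<forall>i. i \<in> {i. \<exists>j k. (i, j, k) \<in> K} \<longleftrightarrow> p dvd i"
      by (intro int_subgroup_multiples[of _ "int m"]) (simp_all only: mem_Collect_eq, auto)
    then show thesis using that by auto
  qed
  have vert: "(0, b * w, 0) \<in> K" for w
    by (simp add: b(2))
  obtain t0 where "(0, t0, q) \<in> K"
    using q(2)[of q] by auto
  then have "(0, t0 + b * (- (t0 div b)), q) \<in> K"
    using mult[of 0 t0 q 0 "b * (- (t0 div b))" 0] by (simp add: b(2))
  moreover define t where "t = t0 mod b"
  moreover have "t0 + b * (- (t0 div b)) = t"
    by (simp add: t_def minus_mult_div_eq_mod)
  ultimately have t: "(0, t, q) \<in> K" "0 \<le> t" "t < b"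
    using b(1) by simp_all
  have ty: "(0, t * y, q * y) \<in> K" for y
  proof (induction y rule: int_induct[where k = 0])
    case base
    show ?case using vert[of 0] by simp
  next
    case (step1 y)
    then show ?case using mult[OF step1.IH t(1)] by (simp add: distrib_left)
  next
    case (step2 y)
    then show ?case using mult[OF step2.IH inv[OF t(1)]] by (simp add: right_diff_distrib)
  qed
  obtain s0 r0 where sr0: "(p, s0, r0) \<in> K"
    using p(2)[of p] by auto
  \<comment> \<open>A power of \<open>(0, t, q)\<close> brings \<open>r0\<close> into range. It
    stands to the right of an element with first coordinate \<open>p\<close>, so for odd
    \<open>p\<close> it enters \<open>s1\<close> with reversed sign.\<close>
  define y0 where "y0 = - (r0 div q)"
  have r0: "r0 + q * y0 = r0 mod q"
    by (simp add: y0_def minus_mult_div_eq_mod)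
  define s1 where "s1 = s0 + (if even p then t * y0 else - (t * y0))"
  have "(p, s1, r0 mod q) \<in> K"
    using mult[OF sr0 ty[of y0]] by (simp add: s1_def r0)
  then have "(p, b * (- (s1 div b)) + s1, r0 mod q) \<in> K"
    using mult[OF vert[of "- (s1 div b)"], of p s1 "r0 mod q"] by simp
  moreover define r s where "r = r0 mod q" and "s = s1 mod b"
  moreover have "b * (- (s1 div b)) + s1 = s"
    by (simp add: s_def minus_mult_div_eq_mod)
  ultimately have sr: "(p, s, r) \<in> K" by simp
  have srx: "(p * x, shear p s x, r * x) \<in> K" for x
  proof (induction x rule: int_induct[where k = 0])
    case base
    show ?case using vert[of 0] by (simp add: shear_def)
  next
    case (step1 x)
    have "shear p s x + (if even (p * x) then s else - s) = shear p s (x + 1)"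
      by (auto simp: shear_def algebra_simps mod2_eq_if)
    then show ?case
      using mult[OF step1.IH sr] by (simp add: distrib_left)
  next
    case (step2 x)
    have "shear p s x + (if even (p * x) then (if even p then - s else s) else - (if even p then - s else s)) = shear p s (x - 1)"
      by (auto simp: shear_def algebra_simps mod2_eq_if)
    then show ?case
      using mult[OF step2.IH inv[OF sr]] by (simp add: right_diff_distrib)
  qed
  have odd: "b dvd 2 * t" if "odd p"
  proof -
    have "(0, s - t - s, q) \<in> K"
      using mult[OF mult[OF sr t(1)] inv[OF sr]] that by (simp add: add.commute)
    then have "(0, - t, q) \<in> K" by simp
    then have "(0, t - - t, q - q) \<in> K"
      using mult[OF t(1) inv[of 0 "- t" q]] by simp
    then show ?thesis by (simp add: b(2))
  qed
  have params: "lat_params p q b t"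
    using p(1) q(1) b(1) odd by (simp add: lat_params_def)
  have "K = lat p q r b s t"
  proof (intro equalityI subsetI)
    fix g assume "g \<in> lat p q r b s t"
    then obtain x y j where g: "g = (p * x, j, r * x + q * y)" and d: "b dvd j - shear p s x - t * y"
      by (rule latE)
    from d obtain w where w: "j - shear p s x - t * y = b * w" by (rule dvdE)
    have "(0, b * w + t * y, q * y) \<in> K"
      using mult[OF vert[of w] ty[of y]] by simp
    from mult[OF this srx[of x]] show "g \<in> K"
      using w by (simp add: g algebra_simps)
  next
    fix g assume gK: "g \<in> K"
    obtain i j k where g: "g = (i, j, k)" by (cases g)
    obtain x where x: "i = p * x"
      using gK p(2)[of i] by (auto simp: g elim: dvdE)
    \<comment> \<open>Dividing by the power of \<open>(p, s, r)\<close> with the same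
      \<open>i\<close>, and then by a power of \<open>(0, t, q)\<close>, leaves an element of the
      \<open>j\<close>-axis.\<close>
    have "(0, j - shear p s x, k - r * x) \<in> K"
      using mult[OF gK[unfolded g] inv[OF srx[of x]]] by (simp add: x split: if_splits)
    then obtain y where y: "k - r * x = q * y"
      using q(2)[of "k - r * x"] by (auto elim: dvdE)
    have "(0, j - shear p s x - t * y, 0) \<in> K"
      using mult[OF \<open>(0, j - shear p s x, k - r * x) \<in> K\<close> inv[OF ty[of y]]] by (simp add: y)
    then show "g \<in> lat p q r b s t"
      unfolding g using y x by (intro latI[of _ _ _ _ x _ y]) (simp_all add: b(2))
  qed
  then show thesis
    using params t(2,3) q(1) b(1) by (intro that[of p q b t r s]) (simp_all add: r_def s_def)
qed

lemma lat_mem_iff: "(i, j, k) \<in> lat p q r b s t \<longleftrightarrow> (\<exists>x y. i = p * x \<and> k = r * x + q * y \<and> b dvd j - shear p s x - t * y)"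
  by (auto simp: lat_def)

lemma shear_0 [simp]: "shear p s 0 = 0" and shear_1 [simp]: "shear p s 1 = s"
  by (simp_all add: shear_def)

lemma int_dvd_diff_small: "(b::int) dvd x - y \<Longrightarrow> 0 \<le> x \<Longrightarrow> x < b \<Longrightarrow> 0 \<le> y \<Longrightarrow> y < b \<Longrightarrow> x = y"
  by (metis mod_eq_dvd_iff mod_pos_pos_trivial)

lemma int_dvd_antisym_pos:
  assumes "(a::int) > 0" "b > 0" "\<And>x. a dvd x \<longleftrightarrow> b dvd x"
  shows "a = b"
  using assms by (meson dvd_refl zdvd_antisym_nonneg less_imp_le)

text \<open>\<open>p\<close>, \<open>q\<close> and \<open>b\<close> are recovered from the set by
  the descriptions used in \<open>lat_exhaust\<close>. Lifts of the basis vectors of one set are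
  then located in the other, where the reduced ranges leave no freedom.\<close>

lemma lat_inj:
  assumes l: "lat_params p q b t" "0 \<le> r" "r < q" "0 \<le> s" "s < b" "0 \<le> t" "t < b"
    and l': "lat_params p' q' b' t'" "0 \<le> r'" "r' < q'" "0 \<le> s'" "s' < b'" "0 \<le> t'" "t' < b'"
    and eq: "lat p q r b s t = lat p' q' r' b' s' t'"
  shows "p = p' \<and> q = q' \<and> r = r' \<and> b = b' \<and> s = s' \<and> t = t'"
proof -
  have pos: "p > 0" "q > 0" "b > 0" "p' > 0" "q' > 0" "b' > 0"
    using l(1) l'(1) by (auto simp: lat_params_def)
  have b: "(0, j, 0) \<in> lat p q r b s t \<longleftrightarrow> b dvd j" if "p > 0" "q > 0" for p q r b s t j :: int
    using that by (auto simp: lat_mem_iff)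
  have q: "(\<exists>j. (0, j, k) \<in> lat p q r b s t) \<longleftrightarrow> q dvd k" if "p > 0" for p q r b s t k :: int
  proof
    assume "q dvd k"
    then obtain y where "k = q * y" by (rule dvdE)
    then show "\<exists>j. (0, j, k) \<in> lat p q r b s t"
      by (intro exI[of _ "t * y"] latI[where x = 0 and y = y]) simp_all
  qed (use that in \<open>auto simp: lat_mem_iff\<close>)
  have p: "(\<exists>j k. (i, j, k) \<in> lat p q r b s t) \<longleftrightarrow> p dvd i" for p q r b s t i :: int
  proof
    assume "p dvd i"
    then obtain x where "i = p * x" by (rule dvdE)
    then have "(i, shear p s x, r * x) \<in> lat p q r b s t"
      by (intro latI[where x = x and y = 0]) simp_all
    then show "\<exists>j k. (i, j, k) \<in> lat p q r b s t" by blast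
  qed (auto simp: lat_mem_iff)
  have "b dvd j \<longleftrightarrow> b' dvd j" for j
    using b[OF pos(1,2), of j r b s t] b[OF pos(4,5), of j r' b' s' t'] eq by simp
  then have bb: "b = b'"
    by (rule int_dvd_antisym_pos[OF pos(3,6)])
  have "q dvd k \<longleftrightarrow> q' dvd k" for k
    using q[OF pos(1), of k q r b s t] q[OF pos(4), of k q' r' b' s' t'] eq by simp
  then have qq: "q = q'"
    by (rule int_dvd_antisym_pos[OF pos(2,5)])
  have "p dvd i \<longleftrightarrow> p' dvd i" for i
    using p[of i p q r b s t] p[of i p' q' r' b' s' t'] eq by simp
  then have pp: "p = p'"
    by (rule int_dvd_antisym_pos[OF pos(1,4)])
  have "(p, s, r) \<in> lat p q r b s t"
    by (intro latI[where x = 1 and y = 0]) simp_all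
  \<comment> \<open>Comparison of first coordinates forces the coefficient of the first basis vector
    to be \<open>1\<close>.\<close>
  then obtain y where y: "r = r' + q * y" "b dvd s - s' - t' * y"
    using pos(1) by (auto simp: eq pp[symmetric] qq[symmetric] bb[symmetric] lat_mem_iff)
  then have rr: "r = r'"
    using int_dvd_diff_small[of q r r'] l(2,3) l'(2,3) qq by simp
  then have "y = 0"
    using y(1) pos(2) by simp
  then have ss: "s = s'"
    using y(2) int_dvd_diff_small[of b s s'] l(4,5) l'(4,5) bb by simp
  have "(0, t, q) \<in> lat p q r b s t"
    by (intro latI[where x = 0 and y = 1]) simp_all
  then have "b dvd t - t'"
    using pos(1,2) by (auto simp: eq pp[symmetric] qq[symmetric] bb[symmetric] lat_mem_iff)
  then have "t = t'"
    using int_dvd_diff_small[of b t t'] l(6,7) l'(6,7) bb by simp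
  then show ?thesis
    using pp qq rr bb ss by simp
qed

text \<open>The representatives form a box, found by dividing \<open>i\<close> by \<open>p\<close>,
  then the corrected \<open>k\<close> by \<open>q\<close>, then the corrected \<open>j\<close> by
  \<open>b\<close>.\<close>

lemma lat_index:
  assumes l: "lat_params p q b t"
  shows "finite (rcosets\<^bsub>amphi 0\<^esub> (lat p q r b s t))"
    and "card (rcosets\<^bsub>amphi 0\<^esub> (lat p q r b s t)) = nat p * nat q * nat b"
proof -
  let ?K = "lat p q r b s t" and ?G = "amphi 0"
  interpret group ?G by (rule group_amphi)
  have K: "subgroup ?K ?G" by (rule lat_subgroup[OF l])
  have pos: "p > 0" "q > 0" "b > 0"
    using l by (auto simp: lat_params_def)
  define B where "B = {0..<p} \<times> {0..<b} \<times> {0..<q}"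
  have "rcosets\<^bsub>?G\<^esub> ?K = (\<lambda>h. ?K #>\<^bsub>?G\<^esub> h) ` B"
  proof
    show "rcosets\<^bsub>?G\<^esub> ?K \<subseteq> (\<lambda>h. ?K #>\<^bsub>?G\<^esub> h) ` B"
    proof
      fix X assume "X \<in> rcosets\<^bsub>?G\<^esub> ?K"
      then obtain i j k where X: "X = ?K #>\<^bsub>?G\<^esub> (i, j, k)"
        by (auto simp: RCOSETS_def)
      define x where "x = i div p"
      define y where "y = (k - r * x) div q"
      define u where "u = j - shear p s x - t * y"
      \<comment> \<open>The lattice element multiplies the representative from the left and reverses
        its \<open>j\<close>-coordinate when \<open>p * x\<close> is odd.\<close>
      define j' where "j' = (if even (p * x) then u else - u) mod b"
      define J where "J = j - (if even (p * x) then j' else - j')"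
      have "b dvd u - (if even (p * x) then j' else - j')"
      proof (cases "even (p * x)")
        case True
        then show ?thesis by (simp add: j'_def minus_mod_eq_mult_div)
      next
        case False
        have "u + (- u) mod b = - (- u - (- u) mod b)" by simp
        also have "\<dots> = - (b * (- u div b))" by (simp only: minus_mod_eq_mult_div)
        finally show ?thesis using False by (simp add: j'_def)
      qed
      then have "b dvd J - shear p s x - t * y"
        by (simp add: J_def u_def algebra_simps)
      then have mem: "(p * x, J, r * x + q * y) \<in> ?K"
        by (rule latI) simp_all
      have h: "(i mod p, j', (k - r * x) mod q) \<in> B"
        using pos by (simp add: B_def j'_def)
      have "(i, j, k) = (p * x, J, r * x + q * y) \<otimes>\<^bsub>?G\<^esub> (i mod p, j', (k - r * x) mod q)"
        by (simp add: x_def J_def y_def)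
      then have "(i, j, k) \<in> ?K #>\<^bsub>?G\<^esub> (i mod p, j', (k - r * x) mod q)"
        using mem unfolding r_coset_def by blast
      then have "?K #>\<^bsub>?G\<^esub> (i mod p, j', (k - r * x) mod q) = X"
        unfolding X by (rule repr_independence[OF _ _ K]) simp
      then show "X \<in> (\<lambda>h. ?K #>\<^bsub>?G\<^esub> h) ` B"
        using h by blast
    qed
  qed (auto simp: RCOSETS_def)
  moreover have "inj_on (\<lambda>h. ?K #>\<^bsub>?G\<^esub> h) B"
  proof (rule inj_onI)
    fix h h' assume h: "h \<in> B" "h' \<in> B" and eq: "?K #>\<^bsub>?G\<^esub> h = ?K #>\<^bsub>?G\<^esub> h'"
    obtain i j k where ijk: "h = (i, j, k)" by (cases h)
    obtain i' j' k' where ijk': "h' = (i', j', k')" by (cases h')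
    have "h \<in> ?K #>\<^bsub>?G\<^esub> h'"
      using rcos_self[of h ?K] K eq by simp
    then obtain g where g: "g \<in> ?K" "h = g \<otimes>\<^bsub>?G\<^esub> h'"
      by (auto simp: r_coset_def)
    from g(1) obtain x y J where xyJ: "g = (p * x, J, r * x + q * y)" "b dvd J - shear p s x - t * y"
      by (rule latE)
    have i: "i = p * x + i'" and k: "k = r * x + q * y + k'"
      and j: "j = J + (if even (p * x) then j' else - j')"
      using g(2) by (simp_all add: ijk ijk' xyJ(1))
    have bd: "0 \<le> i" "i < p" "0 \<le> i'" "i' < p" "0 \<le> j" "j < b" "0 \<le> j'" "j' < b" "0 \<le> k" "k < q" "0 \<le> k'" "k' < q"
      using h by (auto simp: B_def ijk ijk')
    have "i = i'"
      using int_dvd_diff_small[of p i i'] bd(1-4) i by simp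
    then have x: "x = 0" using i pos by simp
    have "k = k'"
      using int_dvd_diff_small[of q k k'] bd(9-12) k x by simp
    then have y: "y = 0" using k x pos by simp
    have "j = j'"
      using int_dvd_diff_small[of b j j'] bd(5-8) xyJ(2) j x y by simp
    then show "h = h'"
      using \<open>i = i'\<close> \<open>k = k'\<close> by (simp add: ijk ijk')
  qed
  moreover have "finite B" "card B = nat p * nat q * nat b"
    by (simp_all add: B_def card_cartesian_product)
  ultimately show "finite (rcosets\<^bsub>?G\<^esub> ?K)" "card (rcosets\<^bsub>?G\<^esub> ?K) = nat p * nat q * nat b"
    by (simp_all add: card_image)
qed

lemma lat_cong:
  assumes "b dvd s - s'" "b dvd t - t'"
  shows "lat p q r b s t = lat p q r b s' t'"
proof -
  have "b dvd j - shear p s x - t * y \<longleftrightarrow> b dvd j - shear p s' x - t' * y" for j x y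
  proof -
    have "shear p s x - shear p s' x = (s - s') * (if even p then x else x mod 2)"
      by (simp add: shear_def algebra_simps)
    then have "b dvd (shear p s x - shear p s' x) + (t - t') * y"
      using assms by simp
    moreover have "j - shear p s' x - t' * y = (j - shear p s x - t * y) + ((shear p s x - shear p s' x) + (t - t') * y)"
      by (simp add: algebra_simps)
    ultimately show ?thesis by (metis dvd_add_left_iff)
  qed
  then show ?thesis by (simp add: lat_def)
qed

text \<open>Conjugation fixes \<open>i\<close> and \<open>k\<close>. It multiplies \<open>j\<close>
  by the sign belonging to \<open>i0\<close>, and for odd \<open>i\<close> it adds
  \<open>2 * j0\<close>. Since \<open>i = p * x\<close> is odd only for odd \<open>p\<close> and odd
  \<open>x\<close>, the addition amounts to a change of \<open>s\<close>.\<close>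

lemma lat_conj:
  assumes l: "lat_params p q b t"
  shows "((i0, j0, k0) <#\<^bsub>amphi 0\<^esub> lat p q r b s t) #>\<^bsub>amphi 0\<^esub> inv\<^bsub>amphi 0\<^esub> (i0, j0, k0) =
    lat p q r b ((if even i0 then s else - s) + (if even p then 0 else 2 * j0)) (if even i0 then t else - t)"
    (is "_ = lat p q r b ?s ?t")
proof -
  have b2: "odd p \<Longrightarrow> b dvd 2 * t * y" for y
    using l by (auto simp: lat_params_def)
  define f where "f i j = j0 + (if even i0 then j else - j) - (if even i then j0 else - j0)" for i j :: int
  have conj: "(i0, j0, k0) \<otimes>\<^bsub>amphi 0\<^esub> (i, j, k) \<otimes>\<^bsub>amphi 0\<^esub> inv\<^bsub>amphi 0\<^esub> (i0, j0, k0) = (i, f i j, k)" for i j k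
    by (auto simp: f_def)
  have f: "b dvd j - shear p s x - t * y \<longleftrightarrow> b dvd f (p * x) j - shear p ?s x - ?t * y" for x y j
  proof (cases "even i0")
    case True
    have "f (p * x) j - shear p ?s x = j - shear p s x"
      using True by (auto simp: f_def shear_def mod2_eq_if algebra_simps)
    then show ?thesis using True by simp
  next
    case False
    have "f (p * x) j - shear p ?s x = - (j - shear p s x)"
      using False by (auto simp: f_def shear_def mod2_eq_if algebra_simps)
    then have "f (p * x) j - shear p ?s x - ?t * y = - (j - shear p s x - t * y)"
      using False by simp
    then show ?thesis by (metis dvd_minus_iff)
  qed
  have finj: "\<exists>j. j' = f i j" for i j'
    by (intro exI[of _ "if even i0 then j' - j0 + (if even i then j0 else - j0) else - (j' - j0 + (if even i then j0 else - j0))"])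
      (simp add: f_def)
  show ?thesis
  proof (intro equalityI subsetI)
    fix g assume "g \<in> ((i0, j0, k0) <#\<^bsub>amphi 0\<^esub> lat p q r b s t) #>\<^bsub>amphi 0\<^esub> inv\<^bsub>amphi 0\<^esub> (i0, j0, k0)"
    then obtain h where h: "h \<in> lat p q r b s t" "g = (i0, j0, k0) \<otimes>\<^bsub>amphi 0\<^esub> h \<otimes>\<^bsub>amphi 0\<^esub> inv\<^bsub>amphi 0\<^esub> (i0, j0, k0)"
      unfolding l_coset_def r_coset_def by blast
    from h(1) obtain x y j where "h = (p * x, j, r * x + q * y)" "b dvd j - shear p s x - t * y"
      by (rule latE)
    then show "g \<in> lat p q r b ?s ?t"
      unfolding h(2) using f by (auto simp only: conj intro!: latI)
  next
    fix g assume "g \<in> lat p q r b ?s ?t"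
    then obtain x y j' where g: "g = (p * x, j', r * x + q * y)" "b dvd j' - shear p ?s x - ?t * y"
      by (rule latE)
    obtain j where j: "j' = f (p * x) j"
      using finj by blast
    have "(p * x, j, r * x + q * y) \<in> lat p q r b s t"
      using g(2) f[of j x y] unfolding j by (intro latI[of _ _ _ _ x _ y]) simp_all
    moreover have "g = (i0, j0, k0) \<otimes>\<^bsub>amphi 0\<^esub> (p * x, j, r * x + q * y) \<otimes>\<^bsub>amphi 0\<^esub> inv\<^bsub>amphi 0\<^esub> (i0, j0, k0)"
      unfolding conj g(1) j ..
    ultimately show "g \<in> ((i0, j0, k0) <#\<^bsub>amphi 0\<^esub> lat p q r b s t) #>\<^bsub>amphi 0\<^esub> inv\<^bsub>amphi 0\<^esub> (i0, j0, k0)"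
      unfolding l_coset_def r_coset_def by blast
  qed
qed

text \<open>Affine coordinates in which the lattice group becomes one of the three standard groups.\<close>

definition lat_chart :: "int \<Rightarrow> int \<Rightarrow> int \<Rightarrow> int \<Rightarrow> int \<Rightarrow> int \<Rightarrow> R3 \<Rightarrow> R3" where
  "lat_chart p q r b s t = (\<lambda>(x, y, z). (of_int p * x,
     of_int b * y + (if even p then of_int s * x + of_int t * z else of_int s / 2), of_int r * x + of_int q * z))"

lemma homeomorphic_lat_chart:
  assumes "p > 0" "q > 0" "b > 0"
  shows "homeomorphic_map (euclidean :: R3 topology) euclidean (lat_chart p q r b s t)"
proof -
  define P Q R B S T :: real where "P = of_int p" and "Q = of_int q" and "R = of_int r" and "B = of_int b"
    and "S = of_int s" and "T = of_int t"
  have nz: "P \<noteq> 0" "Q \<noteq> 0" "B \<noteq> 0"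
    using assms by (simp_all add: P_def Q_def B_def)
  define f :: "R3 \<Rightarrow> R3" where "f = (\<lambda>v. (P * fst v,
     B * fst (snd v) + (if even p then S * fst v + T * snd (snd v) else S / 2), R * fst v + Q * snd (snd v)))"
  define g :: "R3 \<Rightarrow> R3" where "g = (\<lambda>v. (fst v / P,
     (fst (snd v) - (if even p then S * (fst v / P) + T * ((snd (snd v) - R * (fst v / P)) / Q) else S / 2)) / B,
     (snd (snd v) - R * (fst v / P)) / Q))"
  have "lat_chart p q r b s t = f"
    by (rule ext) (auto simp: lat_chart_def f_def P_def Q_def R_def B_def S_def T_def split_beta)
  moreover have "continuous_on UNIV f"
    unfolding f_def by (cases "even p") (auto intro!: continuous_intros)
  moreover have "continuous_on UNIV g"
    unfolding g_def using nz by (cases "even p") (auto intro!: continuous_intros)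
  moreover have "g (f v) = v" "f (g v) = v" for v
    using nz by (auto simp: f_def g_def prod_eq_iff)
  ultimately show ?thesis
    unfolding homeomorphic_map_maps homeomorphic_maps_def by (intro exI[of _ g]) simp
qed

text \<open>The element \<open>(p, s, r)\<close> acts by \<open>y \<mapsto> s - y\<close>, so the
  chart is centred at \<open>s / 2\<close>. Measured in units of \<open>b\<close>, the shift
  \<open>t\<close> over \<open>(0, q)\<close> is the half shift \<open>\<epsilon> / 2\<close> of the
  model, up to a sign that is a matter of multiples of \<open>b\<close>.\<close>

lemma lat_chart_amphi:
  assumes p: "odd p" and t: "2 * t = \<epsilon> * b"
  shows "lat_chart p q r b s t (amphi_act \<epsilon> (x, w, y) v) =
    amphi_act 0 (p * x, b * w - t * y + s * (x mod 2), r * x + q * y) (lat_chart p q r b s t v)"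
proof -
  obtain X Y Z where v: "v = (X, Y, Z)" by (cases v)
  have "2 * (of_int t :: real) = of_int \<epsilon> * of_int b"
    using t by (metis of_int_mult of_int_numeral)
  then have T: "(of_int t :: real) = of_int \<epsilon> * of_int b / 2" by simp
  show ?thesis
    using p by (simp add: v lat_chart_def T algebra_simps mod2_eq_if)
qed

text \<open>For even \<open>p\<close> no reflection occurs, and the chart is the linear map taking
  the standard basis to \<open>(p, s, r)\<close>, \<open>(0, b, 0)\<close> and
  \<open>(0, t, q)\<close>.\<close>

lemma lat_chart_translation:
  assumes "even p"
  shows "lat_chart p q r b s t (translation_act (x, w, y) v) =
    amphi_act 0 (p * x, b * w + t * y + s * x, r * x + q * y) (lat_chart p q r b s t v)"
  using assms by (cases v) (simp add: lat_chart_def algebra_simps)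

lemma lat_deck:
  assumes "lat_params p q b t"
  shows "subgroup (amphi_act 0 ` lat p q r b s t) (deck_group (range (amphi_act 0)))"
    and "deck (amphi_act 0 ` lat p q r b s t)"
proof -
  show K: "subgroup (amphi_act 0 ` lat p q r b s t) (deck_group (range (amphi_act 0)))"
    by (rule iso_subgroup_image(1)[OF group_amphi group_deck_group[OF amphi_act_deck(1)] amphi_act_deck(2)
          lat_subgroup[OF assms]])
  show "deck (amphi_act 0 ` lat p q r b s t)"
    by (rule subgroup_deck(1)[OF amphi_act_deck(1) K])
qed

lemma lat_orbit_space_amphi:
  assumes l: "lat_params p q b t" and p: "odd p" and t: "2 * t = \<epsilon> * b"
  shows "orbit_space (amphi_act 0 ` lat p q r b s t) homeomorphic_space orbit_space (range (amphi_act \<epsilon>))"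
proof (rule homeomorphic_orbit_spaces_conj[OF lat_deck(2)[OF l] amphi_act_deck(1)])
  have pos: "p > 0" "q > 0" "b > 0"
    using l by (auto simp: lat_params_def)
  show "homeomorphic_map (euclidean :: R3 topology) euclidean (lat_chart p q r b s t)"
    by (rule homeomorphic_lat_chart[OF pos])
  have tb: "2 * (t * y) = b * (\<epsilon> * y)" for y
    using t by (metis mult.assoc mult.commute)
  {
    fix e assume "e \<in> range (amphi_act \<epsilon>)"
    then obtain x w y where e: "e = amphi_act \<epsilon> (x, w, y)" by auto
    have "b dvd (b * w - t * y + s * (x mod 2)) - shear p s x - t * y"
    proof -
      have "(b * w - t * y + s * (x mod 2)) - shear p s x - t * y = b * w - 2 * (t * y)"
        using p by (simp add: shear_def)
      then show ?thesis by (simp add: tb)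
    qed
    then have "(p * x, b * w - t * y + s * (x mod 2), r * x + q * y) \<in> lat p q r b s t"
      by (rule latI) simp_all
    then show "\<exists>k\<in>amphi_act 0 ` lat p q r b s t. \<forall>v. lat_chart p q r b s t (e v) = k (lat_chart p q r b s t v)"
      unfolding e lat_chart_amphi[OF p t] by blast
  }
  fix k assume "k \<in> amphi_act 0 ` lat p q r b s t"
  then obtain g where g: "g \<in> lat p q r b s t" "k = amphi_act 0 g" by blast
  from g(1) obtain x y j where j: "g = (p * x, j, r * x + q * y)" "b dvd j - shear p s x - t * y"
    by (rule latE)
  from j(2) obtain w where w: "j - shear p s x - t * y = b * w" by (rule dvdE)
  \<comment> \<open>The model produces \<open>- t * y\<close> where the lattice has
    \<open>t * y\<close>; the difference \<open>2 * t * y = b * (\<epsilon> * y)\<close> goes into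
    the coefficient of \<open>b\<close>.\<close>
  have "j = b * (w + \<epsilon> * y) - t * y + s * (x mod 2)"
    using w p tb[of y] by (simp add: shear_def algebra_simps)
  then have "lat_chart p q r b s t (amphi_act \<epsilon> (x, w + \<epsilon> * y, y) v) = k (lat_chart p q r b s t v)" for v
    unfolding lat_chart_amphi[OF p t] g(2) j(1) by simp
  then show "\<exists>e\<in>range (amphi_act \<epsilon>). \<forall>v. lat_chart p q r b s t (e v) = k (lat_chart p q r b s t v)"
    by blast
qed

lemma lat_orbit_space_translation:
  assumes l: "lat_params p q b t" and p: "even p"
  shows "orbit_space (amphi_act 0 ` lat p q r b s t) homeomorphic_space orbit_space (range translation_act)"
proof (rule homeomorphic_orbit_spaces_conj[OF lat_deck(2)[OF l] translation_act_deck(1)])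
  have pos: "p > 0" "q > 0" "b > 0"
    using l by (auto simp: lat_params_def)
  show "homeomorphic_map (euclidean :: R3 topology) euclidean (lat_chart p q r b s t)"
    by (rule homeomorphic_lat_chart[OF pos])
  {
    fix e assume "e \<in> range translation_act"
    then obtain x w y where e: "e = translation_act (x, w, y)" by auto
    have "(p * x, b * w + t * y + s * x, r * x + q * y) \<in> lat p q r b s t"
      using p by (intro latI[where x = x and y = y]) (simp_all add: shear_def)
    then show "\<exists>k\<in>amphi_act 0 ` lat p q r b s t. \<forall>v. lat_chart p q r b s t (e v) = k (lat_chart p q r b s t v)"
      unfolding e lat_chart_translation[OF p] by blast
  }
  fix k assume "k \<in> amphi_act 0 ` lat p q r b s t"
  then obtain g where g: "g \<in> lat p q r b s t" "k = amphi_act 0 g" by blast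
  from g(1) obtain x y j where j: "g = (p * x, j, r * x + q * y)" "b dvd j - shear p s x - t * y"
    by (rule latE)
  from j(2) obtain w where w: "j - shear p s x - t * y = b * w" by (rule dvdE)
  have "j = b * w + t * y + s * x"
    using w p by (simp add: shear_def)
  then have "lat_chart p q r b s t (translation_act (x, w, y) v) = k (lat_chart p q r b s t v)" for v
    unfolding lat_chart_translation[OF p] g(2) j(1) by simp
  then show "\<exists>e\<in>range translation_act. \<forall>v. lat_chart p q r b s t (e v) = k (lat_chart p q r b s t v)"
    by blast
qed

section \<open>The three homeomorphism types\<close>

datatype flat_type = Torus | First_amphicosm | Second_amphicosm

fun type_deck :: "flat_type \<Rightarrow> (R3 \<Rightarrow> R3) set" where
  "type_deck Torus = range translation_act"
| "type_deck First_amphicosm = range (amphi_act 0)"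
| "type_deck Second_amphicosm = range (amphi_act 1)"

definition lat_type :: "int \<Rightarrow> int \<Rightarrow> flat_type" where
  "lat_type p t = (if even p then Torus else if t = 0 then First_amphicosm else Second_amphicosm)"

lemma deck_type_deck: "deck (type_deck T)"
  by (cases T) (simp_all add: translation_act_deck amphi_act_deck)

lemma type_deck_iso:
  "deck_group (type_deck Torus) \<cong> pi1_G1" "deck_group (type_deck First_amphicosm) \<cong> amphi 0"
  "deck_group (type_deck Second_amphicosm) \<cong> amphi 1"
proof -
  have "pi1_G1 \<cong> deck_group (range translation_act)"
    using translation_act_deck(2) by (auto simp: is_iso_def)
  then show "deck_group (type_deck Torus) \<cong> pi1_G1"
    using group.iso_sym[OF group_pi1_G1] by simp
  have "amphi \<epsilon> \<cong> deck_group (range (amphi_act \<epsilon>))" for \<epsilon>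
    using amphi_act_deck(2) by (auto simp: is_iso_def)
  then have "deck_group (range (amphi_act \<epsilon>)) \<cong> amphi \<epsilon>" for \<epsilon>
    by (intro group.iso_sym[OF group_amphi])
  then show "deck_group (type_deck First_amphicosm) \<cong> amphi 0"
    "deck_group (type_deck Second_amphicosm) \<cong> amphi 1"
    by simp_all
qed

text \<open>Rests on the three standard groups being pairwise non-isomorphic. It lets an abstract
  isomorphism type single out one of the three spaces.\<close>

lemma type_deck_iso_iff: "deck_group (type_deck T) \<cong> deck_group (type_deck T') \<longleftrightarrow> T = T'"
proof
  define M :: "flat_type \<Rightarrow> (int \<times> int \<times> int) monoid" where
    "M T = (case T of Torus \<Rightarrow> pi1_G1 | First_amphicosm \<Rightarrow> amphi 0 | Second_amphicosm \<Rightarrow> amphi 1)" for T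
  have M: "deck_group (type_deck T) \<cong> M T" for T
    using type_deck_iso by (cases T) (simp_all add: M_def)
  have grp: "group (M T)" "group (deck_group (type_deck T))" for T
    using group_pi1_G1 group_amphi group_deck_group[OF deck_type_deck] by (auto simp: M_def split: flat_type.split)
  assume "deck_group (type_deck T) \<cong> deck_group (type_deck T')"
  then have MM: "M T \<cong> M T'"
    using iso_trans[OF group.iso_sym[OF grp(2) M] iso_trans[OF _ M]] by blast
  then have "M T' \<cong> M T"
    by (rule group.iso_sym[OF grp(1)])
  then show "T = T'"
    using MM amphi_not_iso pi1_G1_not_iso_amphi by (cases T; cases T') (simp_all add: M_def)
next
  assume "T = T'"
  then show "deck_group (type_deck T) \<cong> deck_group (type_deck T')"
    using iso_refl by (simp add: is_iso_def)
qed

lemma lat_params_second: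
  assumes "lat_params p q b t" "odd p" "0 \<le> t" "t < b" "t \<noteq> 0"
  shows "2 * t = b"
proof -
  obtain c where c: "2 * t = b * c"
    using assms(1,2) by (auto simp: lat_params_def elim: dvdE)
  have "0 < b * c" "b * c < b * 2"
    using assms c by (simp_all add: c[symmetric])
  then have "0 < c" "c < 2"
    using assms(1) by (auto simp: lat_params_def zero_less_mult_iff mult_less_cancel_left_pos)
  then show ?thesis using c by simp
qed

lemma lat_orbit_space:
  assumes l: "lat_params p q b t" and t: "0 \<le> t" "t < b"
  shows "orbit_space (amphi_act 0 ` lat p q r b s t) homeomorphic_space orbit_space (type_deck (lat_type p t))"
proof (cases "even p")
  case True
  then show ?thesis
    using lat_orbit_space_translation[OF l] by (simp add: lat_type_def)
next
  case False
  then show ?thesis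
    using lat_orbit_space_amphi[OF l, of 0] lat_orbit_space_amphi[OF l, of 1] lat_params_second[OF l _ t]
    by (cases "t = 0") (simp_all add: lat_type_def)
qed

text \<open>The isomorphism with a standard group is read off from the homeomorphism of orbit spaces
  and not computed from the parameters.\<close>

lemma lat_deck_iso_iff:
  assumes l: "lat_params p q b t" and t: "0 \<le> t" "t < b"
  shows "deck_group (amphi_act 0 ` lat p q r b s t) \<cong> deck_group (type_deck T) \<longleftrightarrow> lat_type p t = T"
proof -
  let ?K = "amphi_act 0 ` lat p q r b s t"
  have K: "deck_group ?K \<cong> deck_group (type_deck (lat_type p t))"
    by (rule homeomorphic_orbit_spaces_iso[OF lat_deck(2)[OF l] deck_type_deck lat_orbit_space[OF assms]])
  have "group (deck_group ?K)"
    by (rule group_deck_group[OF lat_deck(2)[OF l]])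
  then have K': "deck_group (type_deck (lat_type p t)) \<cong> deck_group ?K"
    using K by (rule group.iso_sym)
  have "deck_group ?K \<cong> deck_group (type_deck T) \<longleftrightarrow> deck_group (type_deck (lat_type p t)) \<cong> deck_group (type_deck T)"
    using iso_trans[OF K, of "deck_group (type_deck T)"] iso_trans[OF K', of "deck_group (type_deck T)"] by argo
  then show ?thesis
    by (simp add: type_deck_iso_iff)
qed

lemma amphi_lat_iso_iff:
  assumes l: "lat_params p q b t" and t: "0 \<le> t" "t < b"
  shows "(amphi 0\<lparr>carrier := lat p q r b s t\<rparr>) \<cong> deck_group (type_deck T) \<longleftrightarrow> lat_type p t = T"
proof -
  let ?L = "amphi 0\<lparr>carrier := lat p q r b s t\<rparr>" and ?K = "deck_group (amphi_act 0 ` lat p q r b s t)"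
  have L: "?L \<cong> ?K"
    using iso_subgroup_image(4)[OF group_amphi group_deck_group[OF amphi_act_deck(1)] amphi_act_deck(2)
      lat_subgroup[OF l], of r s] by simp
  have "group ?L"
    by (rule subgroup.subgroup_is_group[OF lat_subgroup[OF l] group_amphi])
  then have L': "?K \<cong> ?L"
    using L by (rule group.iso_sym)
  show ?thesis
    using iso_trans[OF L, of "deck_group (type_deck T)"] iso_trans[OF L', of "deck_group (type_deck T)"]
      lat_deck_iso_iff[OF assms, of r s T] by argo
qed

lemma deck_subgroup_lat:
  assumes K: "subgroup K (deck_group (range (amphi_act 0)))"
    and fin: "finite (rcosets\<^bsub>deck_group (range (amphi_act 0))\<^esub> K)"
  obtains p q r b s t where "lat_params p q b t" "0 \<le> t" "t < b" "K = amphi_act 0 ` lat p q r b s t"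
    "card (rcosets\<^bsub>deck_group (range (amphi_act 0))\<^esub> K) = nat p * nat q * nat b"
proof -
  let ?G = "deck_group (range (amphi_act 0))"
  have G: "group ?G" by (rule group_deck_group[OF amphi_act_deck(1)])
  define \<psi> where "\<psi> = inv_into (carrier (amphi 0)) (amphi_act 0)"
  have \<psi>: "\<psi> \<in> iso ?G (amphi 0)"
    unfolding \<psi>_def by (rule group.iso_set_sym[OF group_amphi amphi_act_deck(2)])
  note L = iso_subgroup_image[OF G group_amphi \<psi> K]
  obtain p q r b s t where lat: "lat_params p q b t" "0 \<le> t" "t < b" "\<psi> ` K = lat p q r b s t"
    using lat_exhaust[OF L(1)] L(3) fin by metis
  have "K \<subseteq> amphi_act 0 ` UNIV"
    using subgroup.subset[OF K] by simp
  then have "K = amphi_act 0 ` (\<psi> ` K)"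
    unfolding \<psi>_def amphi_simps by (rule image_inv_into_cancel[OF HOL.refl, symmetric])
  moreover have "card (rcosets\<^bsub>?G\<^esub> K) = nat p * nat q * nat b"
    using L(2) lat_index(2)[OF lat(1)] by (simp add: lat(4))
  ultimately show thesis
    using that[OF lat(1-3)] by (simp add: lat(4))
qed

section \<open>Counting conjugacy classes\<close>

lemma lat_mod:
  "lat p q r b s t = lat p q r b (s mod b) (t mod b)"
  by (rule lat_cong) (simp_all add: minus_mod_eq_mult_div)

text \<open>Taken from \<open>lat_conj\<close>: the sign \<open>\<epsilon>\<close> comes from the
  parity of the first coordinate of the conjugating element and acts on \<open>s\<close> and
  \<open>t\<close> together; \<open>j\<close> is its second coordinate.\<close>

definition conj_params :: "int \<Rightarrow> int \<Rightarrow> int \<Rightarrow> int \<Rightarrow> int \<Rightarrow> int \<Rightarrow> bool" where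
  "conj_params p b s t s' t' \<longleftrightarrow>
     (\<exists>\<epsilon>\<in>{1, -1}. (\<exists>j. b dvd s' - (\<epsilon> * s + (if even p then 0 else 2 * j))) \<and> b dvd t' - \<epsilon> * t)"

text \<open>\<open>lat_inj\<close> compares reduced parameters, so those delivered by
  \<open>lat_conj\<close> are first reduced modulo \<open>b\<close>. Conversely, conjugating
  elements \<open>(i0, j, 0)\<close> suffice because \<open>c\<close> is central.\<close>

lemma lat_conj_iff:
  assumes l: "lat_params p q b t" "0 \<le> r" "r < q" "0 \<le> s" "s < b" "0 \<le> t" "t < b"
    and l': "lat_params p' q' b' t'" "0 \<le> r'" "r' < q'" "0 \<le> s'" "s' < b'" "0 \<le> t'" "t' < b'"
  shows "(lat p q r b s t, lat p' q' r' b' s' t') \<in> subgroup_conj (amphi 0) \<longleftrightarrow>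
    p = p' \<and> q = q' \<and> r = r' \<and> b = b' \<and>
    conj_params p b s t s' t'"
    (is "?L \<longleftrightarrow> ?R")
proof
  assume ?L
  then obtain i0 j0 k0 where "lat p' q' r' b' s' t' =
      ((i0, j0, k0) <#\<^bsub>amphi 0\<^esub> lat p q r b s t) #>\<^bsub>amphi 0\<^esub> inv\<^bsub>amphi 0\<^esub> (i0, j0, k0)"
    by (auto simp: subgroup_conj_def)
  moreover define \<epsilon> :: int where "\<epsilon> = (if even i0 then 1 else -1)"
  moreover have "(if even i0 then x else - x) = \<epsilon> * x" for x
    by (simp add: \<epsilon>_def)
  ultimately have "lat p' q' r' b' s' t' = lat p q r b (\<epsilon> * s + (if even p then 0 else 2 * j0)) (\<epsilon> * t)"
    using lat_conj[OF l(1)] by simp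
  then have eq: "lat p q r b ((\<epsilon> * s + (if even p then 0 else 2 * j0)) mod b) (\<epsilon> * t mod b) = lat p' q' r' b' s' t'"
    using lat_mod by metis
  have b: "b > 0"
    using l(1) by (simp add: lat_params_def)
  have "b dvd 2 * (\<epsilon> * t mod b)" if "odd p"
  proof -
    have "2 * (\<epsilon> * t mod b) = \<epsilon> * (2 * t) - b * (2 * (\<epsilon> * t div b))"
      by (simp add: algebra_simps minus_mult_div_eq_mod[symmetric])
    moreover have "b dvd \<epsilon> * (2 * t)"
      using l(1) that by (simp add: lat_params_def)
    ultimately show ?thesis by simp
  qed
  then have "lat_params p q b (\<epsilon> * t mod b)"
    using l(1) by (simp add: lat_params_def)
  then have inj: "p = p' \<and> q = q' \<and> r = r' \<and> b = b' \<and>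
      (\<epsilon> * s + (if even p then 0 else 2 * j0)) mod b = s' \<and> \<epsilon> * t mod b = t'"
    by (rule lat_inj[OF _ l(2,3) _ _ _ _ l' eq]) (use b in simp_all)
  then have s': "(\<epsilon> * s + (if even p then 0 else 2 * j0)) mod b = s'" and t': "\<epsilon> * t mod b = t'"
    by blast+
  have dm: "b dvd x mod b - x" for x
    by (metis dvd_minus_mod dvd_minus_iff minus_diff_eq)
  have "b dvd s' - (\<epsilon> * s + (if even p then 0 else 2 * j0))" "b dvd t' - \<epsilon> * t"
    unfolding s'[symmetric] t'[symmetric] by (rule dm)+
  moreover have "\<epsilon> \<in> {1, -1}"
    by (simp add: \<epsilon>_def)
  ultimately show ?R using inj unfolding conj_params_def by blast
next
  assume ?R
  then obtain \<epsilon> j where eq: "p = p'" "q = q'" "r = r'" "b = b'" and \<epsilon>: "\<epsilon> \<in> {1, -1}"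
    and d: "b dvd s' - (\<epsilon> * s + (if even p then 0 else 2 * j))" "b dvd t' - \<epsilon> * t"
    unfolding conj_params_def by blast
  define i0 :: int where "i0 = (if \<epsilon> = 1 then 0 else 1)"
  have ei: "(if even i0 then x else - x) = \<epsilon> * x" for x
    using \<epsilon> by (auto simp: i0_def)
  have "((i0, j, 0) <#\<^bsub>amphi 0\<^esub> lat p q r b s t) #>\<^bsub>amphi 0\<^esub> inv\<^bsub>amphi 0\<^esub> (i0, j, 0) =
      lat p q r b (\<epsilon> * s + (if even p then 0 else 2 * j)) (\<epsilon> * t)"
    by (simp only: lat_conj[OF l(1)] ei)
  also have "\<dots> = lat p' q' r' b' s' t'"
    unfolding eq[symmetric] by (rule lat_cong[OF d, symmetric])
  finally have "lat p' q' r' b' s' t' = ((i0, j, 0) <#\<^bsub>amphi 0\<^esub> lat p q r b s t) #>\<^bsub>amphi 0\<^esub> inv\<^bsub>amphi 0\<^esub> (i0, j, 0)" ..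
  then show ?L
    unfolding subgroup_conj_def by (intro CollectI case_prodI bexI[of _ "(i0, j, 0)"]) simp_all
qed

type_synonym lat_data = "int \<times> int \<times> int \<times> int \<times> int \<times> int"

definition lat_data :: "nat \<Rightarrow> flat_type \<Rightarrow> lat_data set" where
  "lat_data n T = {(p, q, r, b, s, t). lat_params p q b t \<and> 0 \<le> r \<and> r < q \<and> 0 \<le> s \<and> s < b \<and> 0 \<le> t \<and> t < b \<and>
     nat p * nat q * nat b = n \<and> lat_type p t = T}"

abbreviation type_classes :: "flat_type \<Rightarrow> nat \<Rightarrow> (int \<times> int \<times> int) set set set" where
  "type_classes T n \<equiv> subgroup_classes (deck_group (type_deck T)) (amphi 0) n"

lemma subgroup_classes_lat_data:
  "type_classes T n =
    (\<lambda>(p, q, r, b, s, t). subgroup_conj (amphi 0) `` {lat p q r b s t}) ` lat_data n T"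
proof -
  have "{K. subgroup K (amphi 0) \<and> finite (rcosets\<^bsub>amphi 0\<^esub> K) \<and> card (rcosets\<^bsub>amphi 0\<^esub> K) = n \<and>
      (amphi 0\<lparr>carrier := K\<rparr>) \<cong> deck_group (type_deck T)} = (\<lambda>(p, q, r, b, s, t). lat p q r b s t) ` lat_data n T"
    (is "?A = ?B")
  proof (intro equalityI subsetI)
    fix K assume "K \<in> ?A"
    then have K: "subgroup K (amphi 0)" "finite (rcosets\<^bsub>amphi 0\<^esub> K)" "card (rcosets\<^bsub>amphi 0\<^esub> K) = n"
      "(amphi 0\<lparr>carrier := K\<rparr>) \<cong> deck_group (type_deck T)"
      by auto
    obtain p q r b s t where l: "lat_params p q b t" "0 \<le> r" "r < q" "0 \<le> s" "s < b" "0 \<le> t" "t < b"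
      and Kl: "K = lat p q r b s t"
      by (rule lat_exhaust[OF K(1,2)])
    have "(p, q, r, b, s, t) \<in> lat_data n T"
      using l K(3,4) lat_index(2)[OF l(1)] amphi_lat_iso_iff[OF l(1,6,7)] by (simp add: lat_data_def Kl)
    then show "K \<in> ?B"
      unfolding Kl by (rule rev_image_eqI) simp
  next
    fix K assume "K \<in> ?B"
    then obtain p q r b s t where "(p, q, r, b, s, t) \<in> lat_data n T" "K = lat p q r b s t"
      by auto
    then show "K \<in> ?A"
      using lat_subgroup lat_index amphi_lat_iso_iff by (simp add: lat_data_def)
  qed
  then show ?thesis
    unfolding subgroup_classes_image by (simp add: image_image split_beta)
qed

text \<open>\<open>f\<close> is a complete invariant of conjugacy, so that counting classes becomes
  counting its values.\<close>

lemma subgroup_classes_invariant: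
  assumes "\<And>p q r b s t p' q' r' b' s' t'. (p, q, r, b, s, t) \<in> lat_data n T \<Longrightarrow>
    (p', q', r', b', s', t') \<in> lat_data n T \<Longrightarrow>
    f (p, q, r, b, s, t) = f (p', q', r', b', s', t') \<longleftrightarrow> p = p' \<and> q = q' \<and> r = r' \<and> b = b' \<and>
    conj_params p b s t s' t'"
  shows "card (type_classes T n) = card (f ` lat_data n T)"
    and "finite (type_classes T n) \<longleftrightarrow> finite (f ` lat_data n T)"
proof -
  let ?h = "\<lambda>(p, q, r, b, s, t). subgroup_conj (amphi 0) `` {lat p q r b s t}"
  have "?h x = ?h y \<longleftrightarrow> f x = f y" if "x \<in> lat_data n T" "y \<in> lat_data n T" for x y
  proof -
    obtain p q r b s t where x: "x = (p, q, r, b, s, t)" by (cases x)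
    obtain p' q' r' b' s' t' where y: "y = (p', q', r', b', s', t')" by (cases y)
    have "?h x = ?h y \<longleftrightarrow> (lat p q r b s t, lat p' q' r' b' s' t') \<in> subgroup_conj (amphi 0)"
      unfolding x y by (simp add: subgroup_conj_class_eq_iff[OF group_amphi])
    also have "\<dots> \<longleftrightarrow> p = p' \<and> q = q' \<and> r = r' \<and> b = b' \<and>
      conj_params p b s t s' t'"
      using that unfolding x y by (intro lat_conj_iff) (simp_all add: lat_data_def)
    also have "\<dots> \<longleftrightarrow> f x = f y"
      using assms that unfolding x y by blast
    finally show ?thesis .
  qed
  then show "card (type_classes T n) = card (f ` lat_data n T)"
    and "finite (type_classes T n) \<longleftrightarrow> finite (f ` lat_data n T)"
    unfolding subgroup_classes_lat_data by (rule card_image_same_kernel; blast)+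
qed

section \<open>Orbit counts and divisor sums\<close>

text \<open>Burnside's lemma for a group of order two. An injection \<open>e\<close> into the
  naturals orders \<open>X\<close>; \<open>L\<close> collects the smaller member of each orbit,
  \<open>U\<close> the larger one, and \<open>L \<inter> U\<close> is the set of fixed
  points.\<close>

lemma card_involution_classes:
  assumes fin: "finite X" and \<rho>: "\<And>x. x \<in> X \<Longrightarrow> \<rho> x \<in> X" "\<And>x. x \<in> X \<Longrightarrow> \<rho> (\<rho> x) = x"
  shows "2 * card ((\<lambda>x. {x, \<rho> x}) ` X) = card X + card {x \<in> X. \<rho> x = x}"
proof -
  obtain e :: "'a \<Rightarrow> nat" where e: "inj_on e X"
    using fin finite_imp_inj_to_nat_seg by blast
  define L where "L = {x \<in> X. e x \<le> e (\<rho> x)}"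
  define U where "U = {x \<in> X. e (\<rho> x) \<le> e x}"
  have "bij_betw \<rho> L U"
    by (rule bij_betwI[where g = \<rho>]) (auto simp: L_def U_def \<rho>)
  then have LU: "card L = card U"
    by (rule bij_betw_same_card)
  have "L \<union> U = X" "L \<inter> U = {x \<in> X. \<rho> x = x}"
    using e \<rho>(1) by (auto simp: L_def U_def inj_on_def)
  moreover have "finite L" "finite U"
    using fin by (simp_all add: L_def U_def)
  ultimately have "2 * card L = card X + card {x \<in> X. \<rho> x = x}"
    using card_Un_Int[of L U] LU by simp
  moreover have "bij_betw (\<lambda>x. {x, \<rho> x}) L ((\<lambda>x. {x, \<rho> x}) ` X)"
    unfolding bij_betw_def
  proof
    show "inj_on (\<lambda>x. {x, \<rho> x}) L"
    proof (rule inj_onI)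
      fix x y assume xy: "x \<in> L" "y \<in> L" "{x, \<rho> x} = {y, \<rho> y}"
      then consider "x = y" | "x = \<rho> y" "y = \<rho> x"
        by (auto simp: doubleton_eq_iff)
      then show "x = y"
      proof cases
        case 2
        then have "e x = e y" using xy(1,2) by (auto simp: L_def)
        then show ?thesis using e xy(1,2) by (auto simp: L_def inj_on_def)
      qed
    qed
    have "{x, \<rho> x} \<in> (\<lambda>x. {x, \<rho> x}) ` L" if "x \<in> X" for x
    proof (cases "e x \<le> e (\<rho> x)")
      case True
      then show ?thesis using that by (simp add: L_def)
    next
      case False
      then have "\<rho> x \<in> L" using that \<rho> by (simp add: L_def)
      moreover have "{x, \<rho> x} = {\<rho> x, \<rho> (\<rho> x)}" using that \<rho> by auto
      ultimately show ?thesis by blast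
    qed
    then show "(\<lambda>x. {x, \<rho> x}) ` L = (\<lambda>x. {x, \<rho> x}) ` X"
      by (auto simp: L_def)
  qed
  ultimately show ?thesis
    by (simp add: bij_betw_same_card)
qed

text \<open>The orbits of negation on pairs of residues modulo \<open>b\<close>.\<close>

definition sign_classes :: "nat \<Rightarrow> (int \<times> int) set set" where
  "sign_classes b = (\<lambda>x. {x, (- fst x mod int b, - snd x mod int b)}) ` ({0..<int b} \<times> {0..<int b})"

text \<open>A fixed pair consists of two solutions of \<open>2 * s = 0\<close> modulo
  \<open>b\<close>. There are two solutions for even \<open>b\<close> and one for odd
  \<open>b\<close>, hence 4 or 1 fixed pairs among \<open>b * b\<close>.\<close>

lemma card_sign_classes:
  assumes "b > 0"
  shows "real (card (sign_classes b)) = 1/2 * ((real b)^2 + 5/2 + 3/2 * (-1) ^ b)"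
proof -
  let ?X = "{0..<int b} \<times> {0..<int b}" and ?\<rho> = "\<lambda>x :: int \<times> int. (- fst x mod int b, - snd x mod int b)"
  define F where "F = {s \<in> {0..<int b}. - s mod int b = s}"
  have neg: "- (- s mod int b) mod int b = s" if "0 \<le> s" "s < int b" for s
    using that by (simp add: mod_minus_eq)
  have "2 * card (sign_classes b) = card ?X + card {x \<in> ?X. ?\<rho> x = x}"
    unfolding sign_classes_def by (rule card_involution_classes) (use assms neg in auto)
  moreover have "{x \<in> ?X. ?\<rho> x = x} = F \<times> F"
    by (auto simp: F_def)
  moreover have "card F = (if even b then 2 else 1)"
  proof -
    have "s \<in> F \<longleftrightarrow> s = 0 \<or> 2 * s = int b" for s
    proof
      assume s: "s \<in> F"
      then have s01: "0 \<le> s" "s < int b" "- s mod int b = s" by (auto simp: F_def)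
      then have "- s mod int b = s mod int b" by simp
      then have "int b dvd - s - s"
        by (rule mod_eq_dvd_iff[THEN iffD1])
      then have "int b dvd 2 * s" by (metis diff_conv_add_uminus dvd_minus_iff minus_add_distrib minus_minus mult_2 uminus_add_conv_diff)
      then obtain c where c: "2 * s = int b * c" by (rule dvdE)
      have "int b * c < int b * 2" using s01(2) c by linarith
      then have "c < 2" using assms mult_less_cancel_left_pos[of "int b" c 2] by simp
      moreover have "0 \<le> int b * c" using s01(1) c by linarith
      then have "0 \<le> c" using assms by (simp add: zero_le_mult_iff)
      ultimately have "c = 0 \<or> c = 1" by auto
      then show "s = 0 \<or> 2 * s = int b" using c by auto
    next
      assume "s = 0 \<or> 2 * s = int b"
      then show "s \<in> F"
      proof
        assume s: "2 * s = int b"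
        then have "- s mod int b = (- s + int b) mod int b" by simp
        also have "- s + int b = s" using s by simp
        also have "s mod int b = s" using s assms by simp
        finally show ?thesis using s assms by (auto simp: F_def)
      qed (use assms in \<open>simp add: F_def\<close>)
    qed
    then have F: "F = {s. s = 0 \<or> 2 * s = int b}" by blast
    show ?thesis
    proof (cases "even b")
      case True
      then obtain c where c: "b = 2 * c" by (rule evenE)
      then have "F = {0, int c}" unfolding F by auto
      then show ?thesis using assms c by simp
    next
      case False
      have "2 * s \<noteq> int b" for s
        using False by (metis dvd_triv_left even_of_nat)
      then have "F = {0}" unfolding F by auto
      then show ?thesis using False by simp
    qed
  qed
  ultimately have "2 * card (sign_classes b) = b * b + (if even b then 4 else 1)"
    by (simp add: card_cartesian_product)
  then have "real (2 * card (sign_classes b)) = real (b * b + (if even b then 4 else 1))"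
    by (rule arg_cong)
  then show ?thesis
    by (cases "even b") (simp_all add: power2_eq_square)
qed

text \<open>\<open>M div q\<close> plays the part of \<open>p\<close>. The divisors of
  \<open>M\<close> with even codivisor are exactly the divisors of \<open>M div 2\<close>, whose sum
  is taken away.\<close>

lemma sum_odd_codivisors:
  assumes "M > 0"
  shows "real (\<Sum>q | q dvd M \<and> odd (M div q). q) =
    real (sigma1 M) - (if even M then real (sigma1 (M div 2)) else 0)"
proof -
  have fin: "finite {q. q dvd M}" using assms by simp
  have disj: "{q. q dvd M \<and> odd (M div q)} \<inter> {q. q dvd M \<and> even (M div q)} = {}" by auto
  have "{q. q dvd M} = {q. q dvd M \<and> odd (M div q)} \<union> {q. q dvd M \<and> even (M div q)}" by auto
  then have "sigma1 M = (\<Sum>q | q dvd M \<and> odd (M div q). q) + (\<Sum>q | q dvd M \<and> even (M div q). q)"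
    unfolding sigma1_def
    by (metis (no_types, lifting) sum.union_disjoint[of "{q. q dvd M \<and> odd (M div q)}" "{q. q dvd M \<and> even (M div q)}" "\<lambda>q. q"] fin finite_Un disj)
  moreover have "(\<Sum>q | q dvd M \<and> even (M div q). q) = (if even M then sigma1 (M div 2) else 0)"
  proof (cases "even M")
    case True
    then obtain c where c: "M = 2 * c" by (rule evenE)
    have "{q. q dvd M \<and> even (M div q)} = {q. q dvd M div 2}"
    proof (intro equalityI subsetI)
      fix q assume "q \<in> {q. q dvd M \<and> even (M div q)}"
      then have "q dvd M" "even (M div q)" by auto
      then obtain d where "M div q = 2 * d" by blast
      then have "2 * c = q * (2 * d)" using \<open>q dvd M\<close> c by (metis dvd_mult_div_cancel)
      then show "q \<in> {q. q dvd M div 2}" by (simp add: c)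
    next
      fix q assume "q \<in> {q. q dvd M div 2}"
      then obtain d where d: "c = q * d" by (auto simp: c)
      then have "q > 0" using assms c by (cases q) auto
      then have "M div q = 2 * d" by (simp add: c d)
      then show "q \<in> {q. q dvd M \<and> even (M div q)}" by (simp add: c d)
    qed
    then show ?thesis using True by (simp add: sigma1_def)
  next
    case False
    have "odd (M div q)" if "q dvd M" for q
      using False dvd_mult_div_cancel[OF that] even_mult_iff by metis
    then have "{q. q dvd M \<and> even (M div q)} = {}"
      by blast
    then show ?thesis using False by (simp only: sum.empty if_False)
  qed
  ultimately show ?thesis by simp
qed

lemma lat_data_D:
  assumes "(p, q, r, b, s, t) \<in> lat_data n T"
  shows "p > 0" "q > 0" "b > 0" "0 \<le> r" "r < q" "0 \<le> s" "s < b" "0 \<le> t" "t < b" "odd p \<Longrightarrow> b dvd 2 * t"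
    "nat p * nat q * nat b = n" "lat_type p t = T"
  using assms by (simp_all add: lat_data_def lat_params_def)

text \<open>\<open>n\<close>, \<open>q\<close> and \<open>b\<close> determine \<open>p\<close>,
  which is why the invariants below leave it out.\<close>

lemma lat_data_eq:
  assumes "(p, q, r, b, s, t) \<in> lat_data n T" "(p', q, r', b, s', t') \<in> lat_data n T"
  shows "p = p'"
proof -
  have "nat p * (nat q * nat b) = nat p' * (nat q * nat b)"
    using lat_data_D(11)[OF assms(1)] lat_data_D(11)[OF assms(2)] by (simp add: mult.assoc)
  then have "nat p = nat p'"
    using lat_data_D(2,3)[OF assms(1)] by simp
  then show ?thesis
    using lat_data_D(1)[OF assms(1)] lat_data_D(1)[OF assms(2)] by simp
qed

lemma lat_data_index:
  assumes "(p, q, r, b, s, t) \<in> lat_data n T"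
  shows "nat b dvd n" "nat q dvd n div nat b" "n div nat b div nat q = nat p"
proof -
  have n: "n = nat b * (nat q * nat p)"
    using lat_data_D(11)[OF assms] by (simp add: ac_simps)
  show "nat b dvd n" "nat q dvd n div nat b" "n div nat b div nat q = nat p"
    unfolding n using lat_data_D(2,3)[OF assms] by simp_all
qed

lemma lat_dataI:
  assumes n: "n > 0" and b: "b dvd n" "q dvd n div b"
    and r: "0 \<le> r" "r < int q" and st: "0 \<le> s" "s < int b" "0 \<le> t" "t < int b"
    and odd: "odd (n div b div q) \<Longrightarrow> int b dvd 2 * t"
    and T: "T = (if even (n div b div q) then Torus else if t = 0 then First_amphicosm else Second_amphicosm)"
  shows "(int (n div b div q), int q, r, int b, s, t) \<in> lat_data n T"
proof -
  have "n = b * (q * (n div b div q))"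
    using b by simp
  then have "n div b div q > 0" "q > 0" "b > 0"
    using n by (metis gr0I mult_is_0)+
  then show ?thesis
    using assms \<open>n = _\<close> by (simp add: lat_data_def lat_params_def lat_type_def ac_simps)
qed

text \<open>Modulo an odd \<open>b\<close> the number 2 is invertible, so the shifts reach every
  residue; modulo an even \<open>b\<close> the parity of \<open>s\<close> survives, and nothing
  else.\<close>

lemma ex_half_shift:
  fixes b s s' :: int
  assumes b: "b > 0"
  shows "(\<exists>\<epsilon>\<in>{1, -1}. \<exists>j. b dvd s' - (\<epsilon> * s + 2 * j)) \<longleftrightarrow> s mod gcd 2 b = s' mod gcd 2 b"
proof (cases "even b")
  case True
  then have g: "gcd 2 b = 2" by (simp add: gcd_proj1_iff)
  show ?thesis unfolding g
  proof
    assume "\<exists>\<epsilon>\<in>{1, -1}. \<exists>j. b dvd s' - (\<epsilon> * s + 2 * j)"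
    then obtain \<epsilon> j where \<epsilon>: "\<epsilon> \<in> {1, -1}" and "b dvd s' - (\<epsilon> * s + 2 * j)" by blast
    then have "even (s' - (\<epsilon> * s + 2 * j))"
      using True dvd_trans by blast
    then have "even (s' - s)" using \<epsilon> by auto
    then show "s mod 2 = s' mod 2" by presburger
  next
    assume "s mod 2 = s' mod 2"
    then have "s' - (1 * s + 2 * ((s' - s) div 2)) = 0" by presburger
    then show "\<exists>\<epsilon>\<in>{1, -1}. \<exists>j. b dvd s' - (\<epsilon> * s + 2 * j)"
      by (metis dvd_0_right insertI1)
  qed
next
  case False
  then have "gcd 2 b = 1" by (metis coprime_iff_gcd_eq_1 coprime_left_2_iff_odd)
  \<comment> \<open>\<open>(b + 1) div 2\<close> inverts 2 modulo the odd \<open>b\<close>.\<close>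
  moreover have "b dvd s' - (1 * s + 2 * ((s' - s) * ((b + 1) div 2)))"
  proof -
    have "2 * ((b + 1) div 2) = b + 1" using False by presburger
    then have "s' - (1 * s + 2 * ((s' - s) * ((b + 1) div 2))) = - (b * (s' - s))"
      by (simp add: algebra_simps)
    then show ?thesis by (metis dvd_minus_iff dvd_triv_left)
  qed
  ultimately show ?thesis by auto
qed

text \<open>\<open>2 * t\<close> vanishes modulo \<open>b\<close>, so \<open>t\<close> and
  \<open>- t\<close> have the same residue.\<close>

lemma dvd_sign_change:
  fixes b t t' :: int
  assumes "b dvd 2 * t" "0 \<le> t" "t < b" "0 \<le> t'" "t' < b" "\<epsilon> \<in> {1, -1}"
  shows "b dvd t' - \<epsilon> * t \<longleftrightarrow> t = t'"
proof
  assume d: "b dvd t' - \<epsilon> * t"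
  have "b dvd t' - t"
  proof (cases "\<epsilon> = 1")
    case False
    then have "b dvd (t' + t) - 2 * t" using assms(1,6) d by (intro dvd_diff) auto
    then show ?thesis by simp
  qed (use d in simp)
  then show "t = t'"
    using int_dvd_diff_small[of b t' t] assms by simp
next
  assume "t = t'"
  then show "b dvd t' - \<epsilon> * t"
    using assms(1,6) by auto
qed

text \<open>As the sign leaves the residue of \<open>t\<close> alone, sign and shift are free to act
  on \<open>s\<close> by themselves.\<close>

lemma odd_lat_data_conj_iff:
  assumes x: "(p, q, r, b, s, t) \<in> lat_data n T" and y: "(p, q, r, b, s', t') \<in> lat_data n T" and p: "odd p"
  shows "conj_params p b s t s' t' \<longleftrightarrow>
    s mod gcd 2 b = s' mod gcd 2 b \<and> t = t'"
proof -
  have "b dvd t' - \<epsilon> * t \<longleftrightarrow> t = t'" if "\<epsilon> \<in> {1, -1}" for \<epsilon>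
    using dvd_sign_change[OF lat_data_D(10)[OF x p] lat_data_D(8,9)[OF x] lat_data_D(8,9)[OF y] that] .
  then show ?thesis
    unfolding conj_params_def using ex_half_shift[OF lat_data_D(3)[OF x], of s' s] p by auto
qed

lemma real_sum_odd_codivisors:
  assumes "n > 0" "b dvd n"
  shows "real (\<Sum>q | q dvd n div b \<and> odd (n div b div q). q * c) =
    real c * real (sigma1 (n div b)) - (if 2 * b dvd n then real c * real (sigma1 (n div (2 * b))) else 0)"
proof -
  have M: "n div b > 0"
    using assms by (metis dvd_mult_div_cancel gr0I mult_is_0)
  have "b > 0" using assms by (metis dvd_0_left gr0I less_numeral_extra(3))
  have e: "even (n div b) \<longleftrightarrow> 2 * b dvd n"
    using assms(2) \<open>b > 0\<close> by (metis dvd_div_iff_mult mult.commute neq0_conv)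
  have d: "n div b div 2 = n div (2 * b)"
    by (simp add: div_mult2_eq[symmetric] mult.commute)
  have "real (\<Sum>q | q dvd n div b \<and> odd (n div b div q). q * c) =
      real (\<Sum>q | q dvd n div b \<and> odd (n div b div q). q) * real c"
    by (simp add: sum_distrib_right)
  then show ?thesis
    unfolding sum_odd_codivisors[OF M] e d by (simp only:) (simp add: algebra_simps)
qed

section \<open>The three counts\<close>

text \<open>Writing \<open>p = 2 * c\<close> turns \<open>p * q * b = n\<close> into
  \<open>2 * b dvd n\<close> together with \<open>q dvd n div (2 * b)\<close>. Each such
  \<open>(b, q)\<close> carries \<open>q\<close> values of \<open>r\<close> and the sign classes of
  \<open>(s, t)\<close>.\<close>

lemma count_torus:
  assumes n: "n > 0"
  shows "finite (type_classes Torus n)"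
    and "real (card (type_classes Torus n)) =
      1/2 * (\<Sum>l | 2 * l dvd n. \<Sum>m | m dvd n div (2 * l). ((real l)^2 + 5/2 + 3/2 * (-1) ^ l) * real m)"
proof -
  define f :: "lat_data \<Rightarrow> nat \<times> nat \<times> int \<times> (int \<times> int) set" where
    "f = (\<lambda>(p, q, r, b, s, t). (nat b, nat q, r, {(s, t), (- s mod b, - t mod b)}))"
  define I where "I = (SIGMA b : {b. 2 * b dvd n}. SIGMA q : {q. q dvd n div (2 * b)}. {0..<int q} \<times> sign_classes b)"
  have evenp: "even p" if "(p, q, r, b, s, t) \<in> lat_data n Torus" for p q r b s t
    using lat_data_D(12)[OF that] by (simp add: lat_type_def split: if_splits)
  have ker: "f (p, q, r, b, s, t) = f (p', q', r', b', s', t') \<longleftrightarrow> p = p' \<and> q = q' \<and> r = r' \<and> b = b' \<and>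
    conj_params p b s t s' t'"
    if x: "(p, q, r, b, s, t) \<in> lat_data n Torus" and y: "(p', q', r', b', s', t') \<in> lat_data n Torus"
    for p q r b s t p' q' r' b' s' t'
  proof -
    note X = lat_data_D[OF x] and Y = lat_data_D[OF y]
    have "nat b = nat b' \<and> nat q = nat q' \<and> r = r' \<longleftrightarrow> p = p' \<and> q = q' \<and> r = r' \<and> b = b'"
    proof
      assume "nat b = nat b' \<and> nat q = nat q' \<and> r = r'"
      then have "b = b'" "q = q'" "r = r'"
        using X(2,3) Y(2,3) by auto
      then show "p = p' \<and> q = q' \<and> r = r' \<and> b = b'"
        using lat_data_eq x y by blast
    qed simp
    \<comment> \<open>Equality of the unordered pairs matches the two signs of
      \<open>conj_params\<close>; for even \<open>p\<close> there is no shift.\<close>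
    moreover have "{(s, t), (- s mod b, - t mod b)} = {(s', t'), (- s' mod b', - t' mod b')} \<longleftrightarrow>
      conj_params p b s t s' t'" if bb: "b = b'"
    proof -
      have id: "b dvd u' - 1 * u \<longleftrightarrow> u = u'" if "0 \<le> u" "u < b" "0 \<le> u'" "u' < b" for u u'
        using that int_dvd_diff_small[of b u' u] by auto
      have neg: "b dvd u' - (-1) * u \<longleftrightarrow> - u mod b = u'" if "0 \<le> u'" "u' < b" for u u'
      proof -
        have "b dvd u' - (-1) * u \<longleftrightarrow> u' mod b = - u mod b"
          by (simp add: mod_eq_dvd_iff)
        then show ?thesis using that by auto
      qed
      have neg': "- (- u mod b) mod b = u" if "0 \<le> u" "u < b" for u
        using that by (simp add: mod_minus_eq)
      have "{(s, t), (- s mod b, - t mod b)} = {(s', t'), (- s' mod b', - t' mod b')} \<longleftrightarrow>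
          (s, t) = (s', t') \<or> (- s mod b, - t mod b) = (s', t')"
        unfolding bb[symmetric] using neg'[OF X(6,7)] neg'[OF X(8,9)] by (auto simp: doubleton_eq_iff)
      then show ?thesis
        unfolding conj_params_def using evenp[OF x] id[of s s'] id[of t t'] neg[of s' s] neg[of t' t] X(6-9) Y(6-9) bb by auto
    qed
    ultimately show ?thesis
      unfolding f_def prod.case prod.inject by blast
  qed
  have image: "f ` lat_data n Torus = I"
  proof (intro equalityI subsetI)
    fix z assume "z \<in> f ` lat_data n Torus"
    then obtain p q r b s t where x: "(p, q, r, b, s, t) \<in> lat_data n Torus" and z: "z = f (p, q, r, b, s, t)"
      by auto
    note X = lat_data_D[OF x]
    obtain c where c: "nat p = 2 * c"
      using evenp[OF x] X(1) by (metis even_nat_iff evenE less_imp_le)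
    have "n = (2 * nat b) * (nat q * c)"
      using X(11) c by (simp add: ac_simps)
    then have "2 * nat b dvd n" "nat q dvd n div (2 * nat b)"
      using X(3) by simp_all
    moreover have "{(s, t), (- s mod b, - t mod b)} \<in> sign_classes (nat b)"
      using X(3,6-9) unfolding sign_classes_def by (intro image_eqI[of _ _ "(s, t)"]) simp_all
    ultimately show "z \<in> I"
      using X(2,4,5) by (simp add: z f_def I_def)
  next
    fix z assume "z \<in> I"
    then obtain b q r s t where z: "z = (b, q, r, {(s, t), (- s mod int b, - t mod int b)})"
      and b: "2 * b dvd n" and q: "q dvd n div (2 * b)" and r: "0 \<le> r" "r < int q"
      and st: "0 \<le> s" "s < int b" "0 \<le> t" "t < int b"
      by (auto simp: I_def sign_classes_def)
    obtain c where c: "n div (2 * b) = q * c" using q by (rule dvdE)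
    have nb: "n = b * (q * (2 * c))"
      using b c by (metis dvd_mult_div_cancel mult.assoc mult.left_commute)
    then have "b > 0" "q > 0" using n by (metis gr0I mult_is_0)+
    then have "b dvd n" "q dvd n div b" "even (n div b div q)"
      unfolding nb by simp_all
    then have "(int (n div b div q), int q, r, int b, s, t) \<in> lat_data n Torus"
      using n r st by (intro lat_dataI) simp_all
    then show "z \<in> f ` lat_data n Torus"
      by (rule rev_image_eqI) (simp add: z f_def)
  qed
  note inv = subgroup_classes_invariant[of n Torus f, OF ker]
  have fin_b: "finite {b. 2 * b dvd n}"
    by (rule finite_subset[of _ "{..n}"]) (use n dvd_imp_le in fastforce)+
  have fin_q: "finite {q. q dvd n div (2 * b)}" if "2 * b dvd n" for b
    using that n by (intro finite_divisors_nat) (auto elim!: dvdE)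
  have fin_s: "finite (sign_classes b)" for b
    by (simp add: sign_classes_def)
  have fin_I: "finite I"
    unfolding I_def using fin_b fin_q fin_s by (intro finite_SigmaI) auto
  then show "finite (type_classes Torus n)"
    using inv(2) image by simp
  have "card I = (\<Sum>b | 2 * b dvd n. \<Sum>q | q dvd n div (2 * b). q * card (sign_classes b))"
    unfolding I_def using fin_b fin_q fin_s
    by (subst card_SigmaI, simp, simp)
      (intro sum.cong HOL.refl, subst card_SigmaI, auto simp: card_cartesian_product)
  then have "real (card I) = (\<Sum>b | 2 * b dvd n. \<Sum>q | q dvd n div (2 * b). real q * real (card (sign_classes b)))"
    by simp
  also have "\<dots> = (\<Sum>b | 2 * b dvd n. \<Sum>q | q dvd n div (2 * b). 1/2 * (((real b)^2 + 5/2 + 3/2 * (-1) ^ b) * real q))"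
  proof (intro sum.cong HOL.refl)
    fix b q assume "b \<in> {b. 2 * b dvd n}"
    then have "b > 0" using n by (cases b) auto
    then show "real q * real (card (sign_classes b)) = 1/2 * (((real b)^2 + 5/2 + 3/2 * (-1) ^ b) * real q)"
      by (simp add: card_sign_classes algebra_simps)
  qed
  also have "\<dots> = 1/2 * (\<Sum>b | 2 * b dvd n. \<Sum>q | q dvd n div (2 * b). ((real b)^2 + 5/2 + 3/2 * (-1) ^ b) * real q)"
    by (simp add: sum_distrib_left)
  finally show "real (card (type_classes Torus n)) =
      1/2 * (\<Sum>l | 2 * l dvd n. \<Sum>m | m dvd n div (2 * l). ((real l)^2 + 5/2 + 3/2 * (-1) ^ l) * real m)"
    using inv(1) image by simp
qed

text \<open>Both amphicosms at once. The type fixes \<open>t\<close>, as \<open>0\<close> or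
  \<open>b / 2\<close>, and the second type demands even \<open>b\<close>. There remain
  \<open>q\<close> with odd codivisor, \<open>q\<close> values of \<open>r\<close>, and
  \<open>gcd 2 b\<close> classes of \<open>s\<close>.\<close>

lemma count_amphicosm:
  assumes n: "n > 0" and T: "T \<noteq> Torus"
  shows "finite (type_classes T n)"
    and "real (card (type_classes T n)) =
      (\<Sum>b | b dvd n \<and> (T = First_amphicosm \<or> even b). (3/2 + 1/2 * (-1) ^ b) * real (sigma1 (n div b)) -
        (if 2 * b dvd n then (3/2 + 1/2 * (-1) ^ b) * real (sigma1 (n div (2 * b))) else 0))"
proof -
  define g where "g b = nat (gcd 2 (int b))" for b
  have g_eq: "g b = (if even b then 2 else 1)" for b
  proof (cases "even b")
    case True
    then show ?thesis by (simp add: g_def gcd_proj1_iff)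
  next
    case False
    then have "gcd 2 (int b) = 1" by (simp add: coprime_iff_gcd_eq_1[symmetric])
    then show ?thesis using False by (simp add: g_def)
  qed
  have g_int: "gcd 2 (int b) = int (g b)" for b
    by (simp add: g_def)
  define f :: "lat_data \<Rightarrow> nat \<times> nat \<times> int \<times> int" where
    "f = (\<lambda>(p, q, r, b, s, t). (nat b, nat q, r, s mod gcd 2 b))"
  define I where "I = (SIGMA b : {b. b dvd n \<and> (T = First_amphicosm \<or> even b)}.
    SIGMA q : {q. q dvd n div b \<and> odd (n div b div q)}. {0..<int q} \<times> {0..<int (g b)})"
  have oddp: "odd p" if "(p, q, r, b, s, t) \<in> lat_data n T" for p q r b s t
    using lat_data_D(12)[OF that] T by (auto simp: lat_type_def split: if_splits)
  have tval: "t = (if T = First_amphicosm then 0 else b div 2) \<and> (T = First_amphicosm \<or> even b)"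
    if x: "(p, q, r, b, s, t) \<in> lat_data n T" for p q r b s t
  proof -
    have "lat_params p q b t"
      using x by (simp add: lat_data_def)
    then have "t \<noteq> 0 \<Longrightarrow> 2 * t = b"
      using lat_params_second oddp[OF x] lat_data_D(8,9)[OF x] by blast
    then show ?thesis
      using lat_data_D(12)[OF x] oddp[OF x] by (auto simp: lat_type_def split: if_splits)
  qed
  have ker: "f (p, q, r, b, s, t) = f (p', q', r', b', s', t') \<longleftrightarrow> p = p' \<and> q = q' \<and> r = r' \<and> b = b' \<and>
    conj_params p b s t s' t'"
    if x: "(p, q, r, b, s, t) \<in> lat_data n T" and y: "(p', q', r', b', s', t') \<in> lat_data n T"
    for p q r b s t p' q' r' b' s' t'
  proof -
    note X = lat_data_D[OF x] and Y = lat_data_D[OF y]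
    have "nat b = nat b' \<and> nat q = nat q' \<and> r = r' \<longleftrightarrow> p = p' \<and> q = q' \<and> r = r' \<and> b = b'"
    proof
      assume "nat b = nat b' \<and> nat q = nat q' \<and> r = r'"
      then have "b = b'" "q = q'" "r = r'"
        using X(2,3) Y(2,3) by auto
      then show "p = p' \<and> q = q' \<and> r = r' \<and> b = b'"
        using lat_data_eq x y by blast
    qed simp
    moreover have "s mod gcd 2 b = s' mod gcd 2 b' \<longleftrightarrow>
      conj_params p b s t s' t'"
      if eq: "p = p'" "q = q'" "r = r'" "b = b'"
    proof -
      have "t = t'"
        using tval[OF x] tval[OF y] eq(4) by metis
      then show ?thesis
        using odd_lat_data_conj_iff[OF x y[folded eq] oddp[OF x]] eq(4) by blast
    qed
    ultimately show ?thesis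
      unfolding f_def prod.case prod.inject by blast
  qed
  have image: "f ` lat_data n T = I"
  proof (intro equalityI subsetI)
    fix z assume "z \<in> f ` lat_data n T"
    then obtain p q r b s t where x: "(p, q, r, b, s, t) \<in> lat_data n T" and z: "z = f (p, q, r, b, s, t)"
      by auto
    note X = lat_data_D[OF x]
    have "odd (nat p)"
      using oddp[OF x] X(1) by (simp add: even_nat_iff)
    moreover have "T = First_amphicosm \<or> even (nat b)"
      using tval[OF x] X(3) by (simp add: even_nat_iff)
    moreover have "s mod gcd 2 b \<in> {0..<int (g (nat b))}"
      using X(3) by (simp add: g_int[symmetric])
    ultimately show "z \<in> I"
      using X(2,4,5) lat_data_index[OF x] by (simp add: z f_def I_def)
  next
    fix z assume "z \<in> I"
    then obtain b q r s where z: "z = (b, q, r, s)"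
      and b: "b dvd n" "T = First_amphicosm \<or> even b" and q: "q dvd n div b" "odd (n div b div q)"
      and r: "0 \<le> r" "r < int q" and s: "0 \<le> s" "s < int (g b)"
      by (auto simp: I_def)
    have b0: "b > 0" using n b(1) by (cases b) auto
    define t where "t = (if T = First_amphicosm then 0 else int b div 2)"
    have t: "0 \<le> t" "t < int b" "int b dvd 2 * t" "T = First_amphicosm \<longleftrightarrow> t = 0"
      using b(2) b0 by (auto simp: t_def)
    \<comment> \<open>A residue modulo \<open>g b\<close> is itself an admissible \<open>s\<close>,
      so every value of the invariant is attained.\<close>
    have gb: "int (g b) \<le> int b"
      using b0 by (auto simp: g_eq)
    have "(int (n div b div q), int q, r, int b, s, t) \<in> lat_data n T"
    proof (rule lat_dataI[OF n b(1) q(1) r s(1) _ t(1,2)])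
      show "s < int b" using s(2) gb by linarith
      show "T = (if even (n div b div q) then Torus else if t = 0 then First_amphicosm else Second_amphicosm)"
        using q(2) t(4) T by (cases T) auto
    qed (rule t(3))
    then show "z \<in> f ` lat_data n T"
      by (rule rev_image_eqI) (use s in \<open>simp add: z f_def g_int\<close>)
  qed
  note inv = subgroup_classes_invariant[of n T f, OF ker]
  have fin_b: "finite {b. b dvd n \<and> (T = First_amphicosm \<or> even b)}"
    by (rule finite_subset[of _ "{b. b dvd n}"]) (use n in auto)
  have fin_q: "finite {q. q dvd n div b \<and> odd (n div b div q)}" if "b dvd n" for b
  proof (rule finite_subset[of _ "{q. q dvd n div b}"])
    show "finite {q. q dvd n div b}"
      using that n by (intro finite_divisors_nat) (auto elim!: dvdE)
  qed auto
  have fin_I: "finite I"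
    unfolding I_def using fin_b fin_q by (intro finite_SigmaI) auto
  then show "finite (type_classes T n)"
    using inv(2) image by simp
  have "card I = (\<Sum>b | b dvd n \<and> (T = First_amphicosm \<or> even b).
      \<Sum>q | q dvd n div b \<and> odd (n div b div q). q * g b)"
    unfolding I_def using fin_b fin_q
    by (subst card_SigmaI, simp, simp)
      (intro sum.cong HOL.refl, subst card_SigmaI, auto simp: card_cartesian_product)
  then have "real (card I) = (\<Sum>b | b dvd n \<and> (T = First_amphicosm \<or> even b).
      real (\<Sum>q | q dvd n div b \<and> odd (n div b div q). q * g b))"
    by simp
  also have "\<dots> = (\<Sum>b | b dvd n \<and> (T = First_amphicosm \<or> even b).
      (3/2 + 1/2 * (-1) ^ b) * real (sigma1 (n div b)) -
        (if 2 * b dvd n then (3/2 + 1/2 * (-1) ^ b) * real (sigma1 (n div (2 * b))) else 0))"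
  proof (intro sum.cong HOL.refl)
    fix b assume "b \<in> {b. b dvd n \<and> (T = First_amphicosm \<or> even b)}"
    then have b: "b dvd n" by simp
    have "real (g b) = 3/2 + 1/2 * (-1) ^ b"
      by (simp add: g_eq)
    then show "real (\<Sum>q | q dvd n div b \<and> odd (n div b div q). q * g b) =
      (3/2 + 1/2 * (-1) ^ b) * real (sigma1 (n div b)) -
        (if 2 * b dvd n then (3/2 + 1/2 * (-1) ^ b) * real (sigma1 (n div (2 * b))) else 0)"
      unfolding real_sum_odd_codivisors[OF n b] by simp
  qed
  finally show "real (card (type_classes T n)) =
      (\<Sum>b | b dvd n \<and> (T = First_amphicosm \<or> even b). (3/2 + 1/2 * (-1) ^ b) * real (sigma1 (n div b)) -
        (if 2 * b dvd n then (3/2 + 1/2 * (-1) ^ b) * real (sigma1 (n div (2 * b))) else 0))"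
    using inv(1) image by simp
qed

lemma count_first_amphicosm:
  assumes n: "n > 0"
  shows "real (card (type_classes First_amphicosm n)) =
      (\<Sum>l | l dvd n. (3/2 + 1/2 * (-1) ^ l) * real (sigma1 (n div l)))
      - (\<Sum>l | 2 * l dvd n. (3/2 + 1/2 * (-1) ^ l) * real (sigma1 (n div (2 * l))))"
proof -
  have fin: "finite {l. l dvd n}" using n by simp
  have "{l. 2 * l dvd n} = {l \<in> {l. l dvd n}. 2 * l dvd n}"
    using dvd_mult_right by blast
  then have "(\<Sum>l | 2 * l dvd n. (3/2 + 1/2 * (-1) ^ l) * real (sigma1 (n div (2 * l)))) =
      (\<Sum>l | l dvd n. if 2 * l dvd n then (3/2 + 1/2 * (-1) ^ l) * real (sigma1 (n div (2 * l))) else 0)"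
    using sum.inter_filter[OF fin, of "\<lambda>l. (3/2 + 1/2 * (-1) ^ l) * real (sigma1 (n div (2 * l)))" "\<lambda>l. 2 * l dvd n"]
    by simp
  then show ?thesis
    using count_amphicosm(2)[OF n, of First_amphicosm] by (simp add: sum_subtractf)
qed

lemma count_second_amphicosm:
  assumes n: "n > 0"
  shows "real (card (type_classes Second_amphicosm n)) =
      2 * ((\<Sum>l | 2 * l dvd n. real (sigma1 (n div (2 * l)))) - (\<Sum>l | 4 * l dvd n. real (sigma1 (n div (4 * l)))))"
proof -
  have fin: "finite {l. 2 * l dvd n}"
    by (rule finite_subset[of _ "{l. l dvd n}"]) (use n dvd_mult_right in auto)
  have "4 * l dvd n \<Longrightarrow> 2 * l dvd n" for l
  proof -
    assume "4 * l dvd n"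
    moreover have "4 * l = 2 * l * 2" by simp
    ultimately show "2 * l dvd n" by (metis dvd_mult_left)
  qed
  then have "{l. 4 * l dvd n} = {l \<in> {l. 2 * l dvd n}. 4 * l dvd n}" by blast
  then have four: "(\<Sum>l | 4 * l dvd n. 2 * real (sigma1 (n div (4 * l)))) =
      (\<Sum>l | 2 * l dvd n. if 4 * l dvd n then 2 * real (sigma1 (n div (4 * l))) else 0)"
    using sum.inter_filter[OF fin, of "\<lambda>l. 2 * real (sigma1 (n div (4 * l)))" "\<lambda>l. 4 * l dvd n"] by simp
  have "real (card (type_classes Second_amphicosm n)) =
      (\<Sum>b | b dvd n \<and> even b. (3/2 + 1/2 * (-1) ^ b) * real (sigma1 (n div b)) -
        (if 2 * b dvd n then (3/2 + 1/2 * (-1) ^ b) * real (sigma1 (n div (2 * b))) else 0))"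
    using count_amphicosm(2)[OF n, of Second_amphicosm] by simp
  also have "\<dots> = (\<Sum>l | 2 * l dvd n. 2 * real (sigma1 (n div (2 * l))) -
        (if 4 * l dvd n then 2 * real (sigma1 (n div (4 * l))) else 0))"
    \<comment> \<open>Substitution \<open>b = 2 * l\<close>, for which the factor
      \<open>3/2 + 1/2 * (-1) ^ b\<close> is 2.\<close>
    by (rule sum.reindex_bij_witness[of _ "\<lambda>l. 2 * l" "\<lambda>b. b div 2"]) auto
  also have "\<dots> = 2 * ((\<Sum>l | 2 * l dvd n. real (sigma1 (n div (2 * l)))) - (\<Sum>l | 4 * l dvd n. real (sigma1 (n div (4 * l)))))"
    unfolding sum_subtractf four[symmetric] by (simp add: sum_distrib_left right_diff_distrib)
  finally show ?thesis .
qed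

section \<open>Coverings of the first amphicosm\<close>

text \<open>The rigidity demanded by \<open>covering_classes_deck\<close>: the isomorphism type of
  \<open>K\<close> determines \<open>lat_type\<close>, and the chart for that type supplies the
  homeomorphism.\<close>

lemma deck_subgroup_orbit_space:
  assumes K: "subgroup K (deck_group (range (amphi_act 0)))"
    and fin: "finite (rcosets\<^bsub>deck_group (range (amphi_act 0))\<^esub> K)"
    and iso: "deck_group K \<cong> deck_group (type_deck T)"
  shows "orbit_space K homeomorphic_space orbit_space (type_deck T)"
proof -
  obtain p q r b s t where l: "lat_params p q b t" "0 \<le> t" "t < b" "K = amphi_act 0 ` lat p q r b s t"
    by (rule deck_subgroup_lat[OF K fin])
  have "lat_type p t = T"
    using lat_deck_iso_iff[OF l(1-3)] iso l(4) by blast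
  then show ?thesis
    using lat_orbit_space[OF l(1-3)] l(4) by blast
qed

lemma fold_covering_B1_type:
  assumes n: "n > 0" and N: "fold_covering n N B1 p"
  shows "\<exists>T. N homeomorphic_space orbit_space (type_deck T) \<and> (odd n \<longrightarrow> T = First_amphicosm)"
proof -
  note D = amphi_act_deck(1)[of 0]
  obtain K f where K: "subgroup K (deck_group (range (amphi_act 0)))"
    and f: "uniformizes f K (range (amphi_act 0)) N p"
    by (rule fold_covering_uniformizes[OF D N[unfolded B1_eq] n])
  have fin: "finite (rcosets\<^bsub>deck_group (range (amphi_act 0))\<^esub> K)"
    and card: "card (rcosets\<^bsub>deck_group (range (amphi_act 0))\<^esub> K) = n"
    using uniformizes_fold_covering_iff[OF D K f] N[unfolded B1_eq] by simp_all
  obtain p q r b s t where l: "lat_params p q b t" "0 \<le> t" "t < b" "K = amphi_act 0 ` lat p q r b s t"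
    and idx: "card (rcosets\<^bsub>deck_group (range (amphi_act 0))\<^esub> K) = nat p * nat q * nat b"
    by (rule deck_subgroup_lat[OF K fin])
  have "N homeomorphic_space orbit_space K"
    by (rule uniformizes_orbit_space[OF D subgroup_deck[OF D K] f])
  also have "orbit_space K homeomorphic_space orbit_space (type_deck (lat_type p t))"
    unfolding l(4) by (rule lat_orbit_space[OF l(1-3)])
  finally have "N homeomorphic_space orbit_space (type_deck (lat_type p t))" .
  \<comment> \<open>All factors of an odd index are odd: odd \<open>p\<close> excludes the torus,
    and odd \<open>b\<close> excludes \<open>2 * t = b\<close>.\<close>
  moreover have "lat_type p t = First_amphicosm" if "odd n"
  proof -
    have "odd (nat p)" "odd (nat b)"
      using that idx card by auto
    then have "odd p" "odd b"
      using l(1) by (auto simp: lat_params_def even_nat_iff)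
    then have "t = 0"
      using lat_params_second[OF l(1) _ l(2,3)] by (metis dvd_triv_left)
    then show ?thesis
      using \<open>odd p\<close> by (simp add: lat_type_def)
  qed
  ultimately show ?thesis by blast
qed

lemma group_pi1_B1: "group pi1_B1"
  unfolding pi1_B1_def by (rule group_presented_group)

lemma group_pi1_B2: "group pi1_B2"
  unfolding pi1_B2_def by (rule group_presented_group)

text \<open>Coverings are matched with subgroups of the isometry group, these with subgroups of
  \<open>amphi 0\<close>, and those with subgroups of the presented group. Finiteness is tracked
  alongside because \<open>card\<close> is \<open>0\<close> on infinite sets.\<close>

lemma covering_classes_B1:
  fixes e :: "R3 \<Rightarrow> 'a"
  assumes n: "n > 0" and e: "inj e" and H: "group H" "H \<cong> deck_group (type_deck T)"
  shows "finite (covering_classes n (orbit_space (type_deck T)) B1 :: ('a topology \<times> ('a \<Rightarrow> R3 set)) set set)"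
    and "finite (subgroup_classes H pi1_B1 n)"
    and "card (covering_classes n (orbit_space (type_deck T)) B1 :: ('a topology \<times> ('a \<Rightarrow> R3 set)) set set) = conj_count H pi1_B1 n"
    and "conj_count H pi1_B1 n = card (type_classes T n)"
proof -
  let ?E = "deck_group (type_deck T)" and ?D = "deck_group (range (amphi_act 0))"
  have E: "group ?E" by (rule group_deck_group[OF deck_type_deck])
  have D: "group ?D" by (rule group_deck_group[OF amphi_act_deck(1)])
  have AD: "amphi 0 \<cong> ?D"
    using amphi_act_deck(2) by (auto simp: is_iso_def)
  have cov: "card (covering_classes n (orbit_space (type_deck T)) B1 :: ('a topology \<times> ('a \<Rightarrow> R3 set)) set set) =
      card (subgroup_classes ?E ?D n)"
    "finite (covering_classes n (orbit_space (type_deck T)) B1 :: ('a topology \<times> ('a \<Rightarrow> R3 set)) set set) \<longleftrightarrow>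
      finite (subgroup_classes ?E ?D n)"
    unfolding B1_eq
    by (rule covering_classes_deck[OF amphi_act_deck(1) deck_type_deck n e deck_subgroup_orbit_space]; assumption)+
  have left: "subgroup_classes H pi1_B1 n = subgroup_classes ?E pi1_B1 n"
    by (rule subgroup_classes_iso_left[OF H])
  have right: "card (subgroup_classes ?E pi1_B1 n) = card (subgroup_classes ?E (amphi 0) n)"
    "finite (subgroup_classes ?E pi1_B1 n) \<longleftrightarrow> finite (subgroup_classes ?E (amphi 0) n)"
    by (rule subgroup_classes_iso_right[OF group_pi1_B1 group_amphi pi1_B1_iso E])+
  have deck: "card (subgroup_classes ?E (amphi 0) n) = card (subgroup_classes ?E ?D n)"
    "finite (subgroup_classes ?E (amphi 0) n) \<longleftrightarrow> finite (subgroup_classes ?E ?D n)"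
    by (rule subgroup_classes_iso_right[OF group_amphi D AD E])+
  have fin: "finite (subgroup_classes ?E (amphi 0) n)"
    using count_torus(1)[OF n] count_amphicosm(1)[OF n, of T] by (cases "T = Torus") simp_all
  show "finite (covering_classes n (orbit_space (type_deck T)) B1 :: ('a topology \<times> ('a \<Rightarrow> R3 set)) set set)"
    using cov(2) deck(2) fin by simp
  show "finite (subgroup_classes H pi1_B1 n)"
    using left right(2) fin by simp
  show "card (covering_classes n (orbit_space (type_deck T)) B1 :: ('a topology \<times> ('a \<Rightarrow> R3 set)) set set) = conj_count H pi1_B1 n"
    using cov(1) deck(1) left right(1) by (simp add: conj_count_def)
  show "conj_count H pi1_B1 n = card (subgroup_classes ?E (amphi 0) n)"
    using left right(1) by (simp add: conj_count_def)
qed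

lemma pi1_type_deck_iso:
  "pi1_G1 \<cong> deck_group (type_deck Torus)" "pi1_B1 \<cong> deck_group (type_deck First_amphicosm)"
  "pi1_B2 \<cong> deck_group (type_deck Second_amphicosm)"
proof -
  have E: "group (deck_group (type_deck T))" for T
    by (rule group_deck_group[OF deck_type_deck])
  show "pi1_G1 \<cong> deck_group (type_deck Torus)"
    by (rule group.iso_sym[OF E type_deck_iso(1)])
  show "pi1_B1 \<cong> deck_group (type_deck First_amphicosm)"
    by (rule iso_trans[OF pi1_B1_iso group.iso_sym[OF E type_deck_iso(2)]])
  show "pi1_B2 \<cong> deck_group (type_deck Second_amphicosm)"
    by (rule iso_trans[OF pi1_B2_iso group.iso_sym[OF E type_deck_iso(3)]])
qed

lemma type_deck_spaces:
  "orbit_space (type_deck Torus) = G1" "orbit_space (type_deck First_amphicosm) = B1"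
  "orbit_space (type_deck Second_amphicosm) = B2"
  by (simp_all add: G1_eq B1_eq B2_eq)

theorem theorem3:
  fixes n :: nat
  assumes n_pos: "n > 0"
    and points: "\<exists>e :: R3 \<Rightarrow> 'a. inj e"
  shows
    "(\<forall>(N :: 'a topology) p. fold_covering n N B1 p \<longrightarrow>
        (odd n \<longrightarrow> N homeomorphic_space B1) \<and>
        (even n \<longrightarrow> N homeomorphic_space G1 \<or> N homeomorphic_space B1 \<or> N homeomorphic_space B2)) \<and>
     (finite (covering_classes n G1 B1 :: ('a topology \<times> ('a \<Rightarrow> R3 set)) set set) \<and>
      finite (subgroup_classes pi1_G1 pi1_B1 n) \<and>
      card (covering_classes n G1 B1 :: ('a topology \<times> ('a \<Rightarrow> R3 set)) set set)
        = conj_count pi1_G1 pi1_B1 n \<and>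
      real (conj_count pi1_G1 pi1_B1 n)
        = 1/2 * (\<Sum>l | 2 * l dvd n. \<Sum>m | m dvd n div (2 * l).
                   ((real l)^2 + 5/2 + 3/2 * (-1) ^ l) * real m)) \<and>
     (finite (covering_classes n B1 B1 :: ('a topology \<times> ('a \<Rightarrow> R3 set)) set set) \<and>
      finite (subgroup_classes pi1_B1 pi1_B1 n) \<and>
      card (covering_classes n B1 B1 :: ('a topology \<times> ('a \<Rightarrow> R3 set)) set set)
        = conj_count pi1_B1 pi1_B1 n \<and>
      real (conj_count pi1_B1 pi1_B1 n)
        = (\<Sum>l | l dvd n. (3/2 + 1/2 * (-1) ^ l) * real (sigma1 (n div l)))
          - (\<Sum>l | 2 * l dvd n. (3/2 + 1/2 * (-1) ^ l) * real (sigma1 (n div (2 * l))))) \<and>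
     (finite (covering_classes n B2 B1 :: ('a topology \<times> ('a \<Rightarrow> R3 set)) set set) \<and>
      finite (subgroup_classes pi1_B2 pi1_B1 n) \<and>
      card (covering_classes n B2 B1 :: ('a topology \<times> ('a \<Rightarrow> R3 set)) set set)
        = conj_count pi1_B2 pi1_B1 n \<and>
      real (conj_count pi1_B2 pi1_B1 n)
        = 2 * ((\<Sum>l | 2 * l dvd n. real (sigma1 (n div (2 * l))))
               - (\<Sum>l | 4 * l dvd n. real (sigma1 (n div (4 * l))))))"
proof -
  obtain e :: "R3 \<Rightarrow> 'a" where e: "inj e"
    using points by blast
  note torus = covering_classes_B1[OF n_pos e group_pi1_G1 pi1_type_deck_iso(1), unfolded type_deck_spaces]
  note first = covering_classes_B1[OF n_pos e group_pi1_B1 pi1_type_deck_iso(2), unfolded type_deck_spaces]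
  note second = covering_classes_B1[OF n_pos e group_pi1_B2 pi1_type_deck_iso(3), unfolded type_deck_spaces]
  have types: "(odd n \<longrightarrow> N homeomorphic_space B1) \<and>
      (even n \<longrightarrow> N homeomorphic_space G1 \<or> N homeomorphic_space B1 \<or> N homeomorphic_space B2)"
    if N: "fold_covering n N B1 p" for N :: "'a topology" and p
  proof -
    obtain T where "N homeomorphic_space orbit_space (type_deck T)" "odd n \<longrightarrow> T = First_amphicosm"
      using fold_covering_B1_type[OF n_pos N] by blast
    then show ?thesis
      by (cases T) (simp_all add: G1_eq B1_eq B2_eq)
  qed
  then have all: "\<forall>(N :: 'a topology) p. fold_covering n N B1 p \<longrightarrow> (odd n \<longrightarrow> N homeomorphic_space B1) \<and>
      (even n \<longrightarrow> N homeomorphic_space G1 \<or> N homeomorphic_space B1 \<or> N homeomorphic_space B2)"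
    by blast
  show ?thesis
    by (intro conjI all torus(1-3) first(1-3) second(1-3))
      (simp_all only: torus(4) first(4) second(4) count_torus(2)[OF n_pos]
        count_first_amphicosm[OF n_pos] count_second_amphicosm[OF n_pos])
qed

end
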